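(* Let $f$ be a radial eigencubic in $\mathbb{R}^n$. Then $f$ is of Clifford type if and only if for every choice of a normal form of $f$ the component $\psi_{030}$ is not identically zero and is reducible (over $\mathbb{R}$).
   Context: For a polynomial $f$ on $\mathbb{R}^n$ put $L(f)=|\nabla f|^2\Delta f-\sum_{i,j=1}^n f_{x_i}f_{x_j}f_{x_ix_j}$. A radial eigencubic in $\mathbb{R}^n$ is a homogeneous polynomial $f\not\equiv 0$ of degree 3 such that $L(f)=\lambda |x|^2 f$ for some constant $\lambda\in\mathbb{R}$, where it is assumed that $\lambda\neq 0$. Two cubic forms $f_1,f_2$ on $\mathbb{R}^n$ are congruent if $f_1(x)=cf_2(Ux)$ for some $U\in O(n)$ and some real $c\ne0$. Every radial eigencubic admits a normal form: an orthogonal decomposition $\mathbb{R}^n=\mathrm{span}(e_n)\oplus V_1\oplus V_2\oplus V_3$ ($e_n$ a unit vector, the $V_i$ possibly zero) such that, writing $x=x_ne_n+\xi+\eta+\zeta$ with $\xi\in V_1,\eta\in V_2,\zeta\in V_3$, after multiplication of $f$ by a nonzero constant, $$f=x_n^3-\tfrac32x_n(2|\xi|^2+|\eta|^2-|\zeta|^2)+\psi_{111}+\psi_{102}+\psi_{012}+\psi_{030},$$ where $\psi_{ijk}$ is a polynomial homogeneous of degree $i$ in $\xi$, $j$ in $\eta$ and $k$ in $\zeta$. For $m\ge1$, $q\ge0$, a symmetric Clifford system $\mathcal{A}=\{A_0,\dots,A_q\}\in\mathrm{Cliff}(\mathbb{R}^{2m},q)$ is a system of symmetric endomorphisms of $\mathbb{R}^{2m}$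 with $A_iA_j+A_jA_i=2\delta_{ij}\mathbf{1}$ (and, when $q=0$, $\operatorname{tr}A_0=0$). To it one associates the cubic form $C_{\mathcal A}(z,y)=\sum_{i=0}^q\langle y,A_iy\rangle z_{i+1}$ on $\mathbb{R}^{q+1}\times\mathbb{R}^{2m}$, which is a radial eigencubic. A radial eigencubic is of Clifford type if it is congruent to some $C_{\mathcal A}$, and exceptional otherwise. *)

theory Defs
  imports "Jordan_Normal_Form.Matrix" "HOL-Analysis.Analysis"
begin

(* Vectors of R^n are of type real^'n; Matrix.vec and Matrix.mat are used only for the
   Clifford systems, whose size 2m is existentially quantified in clifford_type.
   The clashing names and symbols below are given back to HOL-Analysis. *)
hide_const (open) Matrix.vec Matrix.row Matrix.col Matrix.mat
no_notation Matrix.vec_index (infixl \<open>$\<close> 100)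
no_notation Matrix.scalar_prod (infix \<open>\<bullet>\<close> 70)

(* Polynomials with real coefficients are identified with the functions they induce
   (R is infinite). *)
definition homogeneous_polynomial :: "nat \<Rightarrow> (real^'n \<Rightarrow> real) \<Rightarrow> bool" where
  "homogeneous_polynomial d f \<longleftrightarrow>
     real_polynomial_function f \<and> (\<forall>t x. f (t *\<^sub>R x) = t ^ d * f x)"

definition partial_deriv :: "'n \<Rightarrow> (real^'n \<Rightarrow> real) \<Rightarrow> real^'n \<Rightarrow> real" where
  "partial_deriv i f x = frechet_derivative f (at x) (axis i 1)"

definition L_op :: "(real^'n \<Rightarrow> real) \<Rightarrow> real^'n \<Rightarrow> real" where
  "L_op f x =
     (\<Sum>i\<in>UNIV. (partial_deriv i f x)\<^sup>2) * (\<Sum>i\<in>UNIV. partial_deriv i (partial_deriv i f) x)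
     - (\<Sum>i\<in>UNIV. \<Sum>j\<in>UNIV.
          partial_deriv i f x * partial_deriv j f x * partial_deriv j (partial_deriv i f) x)"

definition radial_eigencubic :: "(real^'n \<Rightarrow> real) \<Rightarrow> bool" where
  "radial_eigencubic f \<longleftrightarrow>
     homogeneous_polynomial 3 f \<and> (\<exists>x. f x \<noteq> 0) \<and>
     (\<exists>l. l \<noteq> 0 \<and> (\<forall>x. L_op f x = l * (norm x)\<^sup>2 * f x))"

definition congruent_cubics :: "(real^'n \<Rightarrow> real) \<Rightarrow> (real^'n \<Rightarrow> real) \<Rightarrow> bool" where
  "congruent_cubics f1 f2 \<longleftrightarrow>
     (\<exists>(U :: real^'n^'n) c. orthogonal_matrix U \<and> c \<noteq> 0 \<and> (\<forall>x. f1 x = c * f2 (U *v x)))"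

definition symmetric_clifford_system :: "nat \<Rightarrow> nat \<Rightarrow> (nat \<Rightarrow> real mat) \<Rightarrow> bool" where
  "symmetric_clifford_system m q A \<longleftrightarrow>
     m \<ge> 1 \<and>
     (\<forall>i\<le>q. A i \<in> carrier_mat (2 * m) (2 * m) \<and> transpose_mat (A i) = A i) \<and>
     (\<forall>i\<le>q. \<forall>j\<le>q. A i * A j + A j * A i = (if i = j then 2 else 0) \<cdot>\<^sub>m 1\<^sub>m (2 * m)) \<and>
     (q = 0 \<longrightarrow> (\<Sum>a<2 * m. A 0 $$ (a, a)) = 0)"

(* The coordinates of z are numbered from 0, so z_(i+1) is entry i. *)
definition clifford_cubic ::
    "nat \<Rightarrow> (nat \<Rightarrow> real mat) \<Rightarrow> real Matrix.vec \<Rightarrow> real Matrix.vec \<Rightarrow> real" where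
  "clifford_cubic q A z y =
     (\<Sum>i\<le>q. Matrix.scalar_prod y (A i *\<^sub>v y) * Matrix.vec_index z i)"

(* b enumerates the n coordinates of R^n, identifying R^n with R^(q+1) x R^(2m); its bijectivity
   forces n = q + 1 + 2m. The choice of b is immaterial, as coordinate permutations are
   orthogonal. *)
definition clifford_type :: "(real^'n \<Rightarrow> real) \<Rightarrow> bool" where
  "clifford_type f \<longleftrightarrow>
     (\<exists>m q A (b :: nat \<Rightarrow> 'n).
        symmetric_clifford_system m q A \<and> bij_betw b {..<q + 1 + 2 * m} UNIV \<and>
        congruent_cubics f
          (\<lambda>x. clifford_cubic q A
                 (Matrix.vec (q + 1) (\<lambda>i. x $ b i))
                 (Matrix.vec (2 * m) (\<lambda>i. x $ b (q + 1 + i)))))"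

definition orthogonal_subspaces :: "(real^'n) set \<Rightarrow> (real^'n) set \<Rightarrow> bool" where
  "orthogonal_subspaces V W \<longleftrightarrow> (\<forall>v\<in>V. \<forall>w\<in>W. orthogonal v w)"

definition orthogonal_decomposition ::
    "real^'n \<Rightarrow> (real^'n) set \<Rightarrow> (real^'n) set \<Rightarrow> (real^'n) set \<Rightarrow> bool" where
  "orthogonal_decomposition e V1 V2 V3 \<longleftrightarrow>
     norm e = 1 \<and> subspace V1 \<and> subspace V2 \<and> subspace V3 \<and>
     orthogonal_subspaces (span {e}) V1 \<and> orthogonal_subspaces (span {e}) V2 \<and>
     orthogonal_subspaces (span {e}) V3 \<and> orthogonal_subspaces V1 V2 \<and>
     orthogonal_subspaces V1 V3 \<and> orthogonal_subspaces V2 V3 \<and>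
     (\<forall>x. \<exists>t. \<exists>\<xi>\<in>V1. \<exists>\<eta>\<in>V2. \<exists>\<zeta>\<in>V3. x = t *\<^sub>R e + \<xi> + \<eta> + \<zeta>)"

(* Only the values of \<psi> on V1 x V2 x V3 matter; polynomial functions on this subspace are the
   restrictions of those on the ambient space. *)
definition trihomogeneous_polynomial ::
    "(real^'n) set \<Rightarrow> (real^'n) set \<Rightarrow> (real^'n) set \<Rightarrow> nat \<Rightarrow> nat \<Rightarrow> nat \<Rightarrow>
     ((real^'n) \<times> (real^'n) \<times> (real^'n) \<Rightarrow> real) \<Rightarrow> bool" where
  "trihomogeneous_polynomial V1 V2 V3 i j k \<psi> \<longleftrightarrow>
     real_polynomial_function \<psi> \<and>
     (\<forall>\<xi>\<in>V1. \<forall>\<eta>\<in>V2. \<forall>\<zeta>\<in>V3. \<forall>r s t.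
        \<psi> (r *\<^sub>R \<xi>, s *\<^sub>R \<eta>, t *\<^sub>R \<zeta>) = r ^ i * s ^ j * t ^ k * \<psi> (\<xi>, \<eta>, \<zeta>))"

definition normal_form ::
    "(real^'n \<Rightarrow> real) \<Rightarrow> real \<Rightarrow> real^'n \<Rightarrow> (real^'n) set \<Rightarrow> (real^'n) set \<Rightarrow> (real^'n) set \<Rightarrow>
     ((real^'n) \<times> (real^'n) \<times> (real^'n) \<Rightarrow> real) \<Rightarrow> ((real^'n) \<times> (real^'n) \<times> (real^'n) \<Rightarrow> real) \<Rightarrow>
     ((real^'n) \<times> (real^'n) \<times> (real^'n) \<Rightarrow> real) \<Rightarrow> ((real^'n) \<times> (real^'n) \<times> (real^'n) \<Rightarrow> real) \<Rightarrow> bool" where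
  "normal_form f c e V1 V2 V3 \<psi>111 \<psi>102 \<psi>012 \<psi>030 \<longleftrightarrow>
     c \<noteq> 0 \<and> orthogonal_decomposition e V1 V2 V3 \<and>
     trihomogeneous_polynomial V1 V2 V3 1 1 1 \<psi>111 \<and>
     trihomogeneous_polynomial V1 V2 V3 1 0 2 \<psi>102 \<and>
     trihomogeneous_polynomial V1 V2 V3 0 1 2 \<psi>012 \<and>
     trihomogeneous_polynomial V1 V2 V3 0 3 0 \<psi>030 \<and>
     (\<forall>t. \<forall>\<xi>\<in>V1. \<forall>\<eta>\<in>V2. \<forall>\<zeta>\<in>V3.
        c * f (t *\<^sub>R e + \<xi> + \<eta> + \<zeta>) =
          t ^ 3 - 3 / 2 * t * (2 * (norm \<xi>)\<^sup>2 + (norm \<eta>)\<^sup>2 - (norm \<zeta>)\<^sup>2)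
          + \<psi>111 (\<xi>, \<eta>, \<zeta>) + \<psi>102 (\<xi>, \<eta>, \<zeta>) + \<psi>012 (\<xi>, \<eta>, \<zeta>) + \<psi>030 (\<xi>, \<eta>, \<zeta>))"

(* Reducibility in the ring of real polynomials on the subspace V: the units of this ring are
   the nonzero constants, so for p not identically zero the two factors are non-units. *)
definition reducible_on :: "(real^'n) set \<Rightarrow> (real^'n \<Rightarrow> real) \<Rightarrow> bool" where
  "reducible_on V p \<longleftrightarrow>
     (\<exists>g h. real_polynomial_function g \<and> real_polynomial_function h \<and>
        \<not> g constant_on V \<and> \<not> h constant_on V \<and> (\<forall>x\<in>V. p x = g x * h x))"

end

theory Submission
  imports Defs
begin

section \<open>Radial eigencubics of Clifford type\<close>

text \<open>
  Polarising a cubic form \<open>f\<close> turns \<open>\<real>\<^sup>n\<close> into a commutative algebra with associative inner product and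
  \<open>6 f x = \<langle>x \<star> x, x\<rangle>\<close>; the equation for \<open>f\<close> becomes
  \<open>|x\<^sup>2|\<^sup>2 tr x - \<langle>x, x\<^sup>2 \<star> x\<^sup>2\<rangle> = 12 \<tau> |x|\<^sup>2 \<langle>x\<^sup>2, x\<rangle>\<close>. A maximum \<open>e\<close> of \<open>f\<close> on the unit sphere, scaled to
  \<open>f e = 1\<close>, satisfies \<open>e \<star> e = 6 e\<close>. Expanding the equation at \<open>e + s y\<close> gives the
  eigenvalues of multiplication by \<open>e\<close>, rules for products of eigenvectors, and finally \<open>\<tau> = - 3\<close>, that is,
  \<open>f\<close> is harmonic. This is the normal form.

  If \<open>\<psi>\<^sub>0\<^sub>3\<^sub>0\<close> is reducible, it has a linear factor; since it solves an eiconal equation, it is a multiple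
  of \<open>s\<^sup>3 - 3 s |y|\<^sup>2\<close> along a unit vector \<open>a\<close>. Then \<open>z\<^sub>0 = e + \<surd>2 a\<close> has square zero, which forces
  \<open>L\<^sup>3 = 81 L\<close> for multiplication by \<open>z\<^sub>0\<close>. Its kernel \<open>Z\<close> has zero multiplication,
  by a trace argument, and the elements of \<open>Z\<close> act on the orthogonal complement of \<open>Z\<close> as a Clifford system.

  Conversely, for a Clifford cubic every \<open>e\<close> as above is \<open>z + y\<close> with \<open>z \<star> y = 3 y\<close> and \<open>y \<star> y = 6 z\<close>,
  and \<open>\<psi>\<^sub>0\<^sub>3\<^sub>0\<close> is divisible by the linear form \<open>\<langle>z, \<cdot>\<rangle>\<close>.
\<close>

subsection \<open>Polynomials and self-adjoint operators\<close>

text \<open>The constant \<open>\<tau>\<close> is not known in advance, and the eigenvalues of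
  multiplication by \<open>e\<close> are roots of a cubic equation that depends on it. Only for
  \<open>\<tau> = - 3\<close> are these roots -6, -3 and 3, and only then does the trace term leave
  the equation. Harmonicity therefore has to precede all structure theory.

  The factor \<open>sqrt 2\<close> is read off from the goal. A Clifford idempotent
  \<open>e = z + y\<close> has |z|^2 = 1/3 and |y|^2 = 2/3, so a unit vector orthogonal to
  \<open>e\<close> in the plane of \<open>z\<close> and \<open>y\<close> is (2z - y)/sqrt 2 up to
  sign, and \<open>e + sqrt 2 *\<^sub>R a\<close> becomes 3z. The harmonic equation gives L^3 = 27
  |z0|^2 L for an element \<open>z0\<close> of square zero, and |3z|^2 = 3 produces the 81.

  The two implications treat normal forms differently. An arbitrary normal form of a Clifford cubic
  is translated back into the algebra: its unit vector satisfies
  \<open>e \<star> e = 6 *\<^sub>R e\<close> and its \<open>V2\<close> is the whole eigenspace for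
  -3. The other implication works with the normal form constructed at a maximum.\<close>

lemma quintic_coeffs_zero:
  fixes c0 c1 c2 c3 c4 c5 :: real
  assumes "\<And>s. c0 + s * c1 + s^2 * c2 + s^3 * c3 + s^4 * c4 + s^5 * c5 = 0"
  shows "c0 = 0" "c1 = 0" "c2 = 0" "c3 = 0" "c4 = 0" "c5 = 0"
proof -
  have "poly [:c0, c1, c2, c3, c4, c5:] s = 0" for s
    using assms[of s] by (simp add: algebra_simps power_numeral_reduce)
  then have "[:c0, c1, c2, c3, c4, c5:] = 0"
    using poly_all_0_iff_0 by blast
  then show "c0 = 0" "c1 = 0" "c2 = 0" "c3 = 0" "c4 = 0" "c5 = 0" by auto
qed

lemma nonneg_right_imp_nonneg_at_zero:
  fixes c0 c1 c2 c3 c4 c5 :: real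
  assumes "\<And>s. s > 0 \<Longrightarrow> 0 \<le> c0 + c1 * s + c2 * s^2 + c3 * s^3 + c4 * s^4 + c5 * s^5"
  shows "0 \<le> c0"
proof -
  have "((\<lambda>s. c0 + c1 * s + c2 * s^2 + c3 * s^3 + c4 * s^4 + c5 * s^5) \<longlongrightarrow>
      c0 + c1 * 0 + c2 * 0^2 + c3 * 0^3 + c4 * 0^4 + c5 * 0^5) (at_right 0)"
    by (intro tendsto_intros)
  moreover have "eventually (\<lambda>s. 0 \<le> c0 + c1 * s + c2 * s^2 + c3 * s^3 + c4 * s^4 + c5 * s^5)
      (at_right (0::real))"
    using assms by (auto intro!: eventually_at_rightI[of 0 1])
  ultimately have "0 \<le> c0 + c1 * 0 + c2 * 0^2 + c3 * 0^3 + c4 * 0^4 + c5 * 0^5"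
    by (rule tendsto_lowerbound) simp
  then show ?thesis by simp
qed

text \<open>First and second order conditions at a minimum, in algebraic form. Degree six is that of
  \<open>36 * (x \<bullet> x)^3 - (F x x x)^2\<close> along a line, to which
  \<open>maximum_conditions\<close> applies them.\<close>

lemma nonneg_near_zero_coeffs:
  fixes c1 c2 c3 c4 c5 c6 :: real
  assumes "\<And>s. c1 * s + c2 * s^2 + c3 * s^3 + c4 * s^4 + c5 * s^5 + c6 * s^6 \<ge> 0"
  shows "c1 = 0" "c2 \<ge> 0"
proof -
  have "0 \<le> c1 + c2 * s + c3 * s^2 + c4 * s^3 + c5 * s^4 + c6 * s^5" if "s > 0" for s
  proof -
    have "0 \<le> s * (c1 + c2 * s + c3 * s^2 + c4 * s^3 + c5 * s^4 + c6 * s^5)"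
      using assms[of s] by (simp add: algebra_simps power_numeral_reduce)
    then show ?thesis using that by (simp add: zero_le_mult_iff)
  qed
  then have "0 \<le> c1" by (rule nonneg_right_imp_nonneg_at_zero)
  moreover have "0 \<le> - c1 + c2 * s + (- c3) * s^2 + c4 * s^3 + (- c5) * s^4 + c6 * s^5"
    if "s > 0" for s
  proof -
    have "0 \<le> s * (- c1 + c2 * s + (- c3) * s^2 + c4 * s^3 + (- c5) * s^4 + c6 * s^5)"
      using assms[of "-s"] by (simp add: algebra_simps power_numeral_reduce)
    then show ?thesis using that by (simp add: zero_le_mult_iff)
  qed
  then have "0 \<le> - c1" by (rule nonneg_right_imp_nonneg_at_zero)
  ultimately show c1: "c1 = 0" by simp
  have "0 \<le> c2 + c3 * s + c4 * s^2 + c5 * s^3 + c6 * s^4 + 0 * s^5" if "s > 0" for s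
  proof -
    have "0 \<le> s^2 * (c2 + c3 * s + c4 * s^2 + c5 * s^3 + c6 * s^4)"
      using assms[of s] c1 by (simp add: algebra_simps power_numeral_reduce)
    then show ?thesis using that by (simp add: zero_le_mult_iff)
  qed
  then show "0 \<le> c2" by (rule nonneg_right_imp_nonneg_at_zero)
qed

lemma trace_orthonormal_basis:
  fixes L :: "'a::euclidean_space \<Rightarrow> 'a"
  assumes L: "linear L" and B: "pairwise orthogonal B" "\<And>b. b \<in> B \<Longrightarrow> norm b = 1"
    and fin: "finite B" and sp: "span B = UNIV"
  shows "(\<Sum>b\<in>B. L b \<bullet> b) = (\<Sum>i\<in>Basis. L i \<bullet> i)"
proof -
  have "L b \<bullet> b = (\<Sum>i\<in>Basis. (b \<bullet> i) * (L i \<bullet> b))" for b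
  proof -
    have "L b = (\<Sum>i\<in>Basis. (b \<bullet> i) *\<^sub>R L i)"
      by (subst euclidean_representation[of b, symmetric])
        (simp only: linear_sum[OF L] linear_scale[OF L] o_def)
    then show ?thesis by (simp add: inner_sum_left)
  qed
  then have "(\<Sum>b\<in>B. L b \<bullet> b) = (\<Sum>b\<in>B. \<Sum>i\<in>Basis. (b \<bullet> i) * (L i \<bullet> b))" by simp
  also have "\<dots> = (\<Sum>i\<in>Basis. \<Sum>b\<in>B. (b \<bullet> i) * (L i \<bullet> b))" by (rule sum.swap)
  also have "\<dots> = (\<Sum>i\<in>Basis. L i \<bullet> (\<Sum>b\<in>B. (i \<bullet> b) *\<^sub>R b))"
    by (simp add: inner_sum_right inner_commute)
  also have "\<dots> = (\<Sum>i\<in>Basis. L i \<bullet> i)"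
    using orthonormal_basis_expand[OF B _ fin] sp by simp
  finally show ?thesis .
qed

lemma orthonormal_basis_Un:
  fixes Z Y :: "'a::euclidean_space set"
  assumes B1: "B1 \<subseteq> Z" "pairwise orthogonal B1" "\<And>b. b \<in> B1 \<Longrightarrow> norm b = 1" "finite B1" "span B1 = Z"
    and B2: "B2 \<subseteq> Y" "pairwise orthogonal B2" "\<And>b. b \<in> B2 \<Longrightarrow> norm b = 1" "finite B2" "span B2 = Y"
    and ZY: "\<And>z y. z \<in> Z \<Longrightarrow> y \<in> Y \<Longrightarrow> z \<bullet> y = 0" "\<And>x. \<exists>z\<in>Z. \<exists>y\<in>Y. x = z + y"
  shows "B1 \<inter> B2 = {}" "pairwise orthogonal (B1 \<union> B2)" "span (B1 \<union> B2) = UNIV"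
proof -
  show "B1 \<inter> B2 = {}"
  proof (rule ccontr)
    assume "B1 \<inter> B2 \<noteq> {}"
    then obtain b where b: "b \<in> B1" "b \<in> B2" by blast
    then have "b \<bullet> b = 0" using ZY(1) B1(1) B2(1) by blast
    then show False using B1(3)[OF b(1)] by simp
  qed
  show "pairwise orthogonal (B1 \<union> B2)"
    unfolding pairwise_def
  proof (intro ballI impI)
    fix x y assume xy: "x \<in> B1 \<union> B2" "y \<in> B1 \<union> B2" "x \<noteq> y"
    have 1: "orthogonal u v" "orthogonal v u" if "u \<in> B1" "v \<in> B2" for u v
      using ZY(1)[of u v] that B1(1) B2(1) by (auto simp: orthogonal_def inner_commute)
    show "orthogonal x y" using xy 1 B1(2) B2(2) unfolding pairwise_def by blast
  qed
  have "x \<in> span (B1 \<union> B2)" for x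
  proof -
    obtain z y where zy: "z \<in> Z" "y \<in> Y" "x = z + y" using ZY(2) by blast
    have "z \<in> span (B1 \<union> B2)" using zy(1) B1(5) span_mono[of B1 "B1 \<union> B2"] by blast
    moreover have "y \<in> span (B1 \<union> B2)" using zy(2) B2(5) span_mono[of B2 "B1 \<union> B2"] by blast
    ultimately show ?thesis unfolding zy(3) by (rule span_add)
  qed
  then show "span (B1 \<union> B2) = UNIV" by blast
qed

lemma psd_null_vector:
  fixes a b :: real
  assumes "\<And>s. 0 \<le> s * b + s^2 * a"
  shows "b = 0"
  using nonneg_near_zero_coeffs(1)[of b a 0 0 0 0] assms by (simp add: mult.commute)

text \<open>A maximiser \<open>x\<close> of the Rayleigh quotient on the unit sphere of
  \<open>S\<close> works: the quadratic form of c - L is nonnegative on \<open>S\<close> and zero at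
  \<open>x\<close>, so (c - L) x is orthogonal to \<open>S\<close>, in which it lies.\<close>

lemma self_adjoint_eigenvector:
  fixes L :: "'a::euclidean_space \<Rightarrow> 'a"
  assumes L: "linear L" and S: "subspace S" "S \<noteq> {0}"
    and inv: "\<And>x. x \<in> S \<Longrightarrow> L x \<in> S"
    and sa: "\<And>x y. x \<in> S \<Longrightarrow> y \<in> S \<Longrightarrow> L x \<bullet> y = x \<bullet> L y"
  obtains x c where "x \<in> S" "norm x = 1" "L x = c *\<^sub>R x"
proof -
  have "compact (S \<inter> sphere 0 1)"
    using closed_subspace[OF S(1)] by (simp add: closed_Int_compact)
  moreover have "S \<inter> sphere 0 1 \<noteq> {}"
  proof -
    obtain x where "x \<in> S" "x \<noteq> 0" using S subspace_0 by fastforce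
    then have "(1 / norm x) *\<^sub>R x \<in> S \<inter> sphere 0 1"
      using S(1) by (simp add: subspace_scale)
    then show ?thesis by blast
  qed
  moreover have "continuous_on (S \<inter> sphere 0 1) (\<lambda>x. L x \<bullet> x)"
    using L by (intro continuous_intros linear_continuous_on linear_linear[THEN iffD2]) (simp_all
      add: linear_conv_bounded_linear)
  ultimately obtain x where "x \<in> S \<inter> sphere 0 1"
      and "\<forall>y\<in>S \<inter> sphere 0 1. L y \<bullet> y \<le> L x \<bullet> x"
    using continuous_attains_sup[of "S \<inter> sphere 0 1" "\<lambda>x. L x \<bullet> x"] by blast
  then have x: "x \<in> S" "norm x = 1"
      and mx: "\<And>y. y \<in> S \<Longrightarrow> norm y = 1 \<Longrightarrow> L y \<bullet> y \<le> L x \<bullet> x"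
    by auto
  define c where "c = L x \<bullet> x"
  have psd: "L y \<bullet> y \<le> c * (y \<bullet> y)" if "y \<in> S" for y
  proof (cases "y = 0")
    case True
    then show ?thesis using linear_0[OF L] by simp
  next
    case False
    have "L ((1 / norm y) *\<^sub>R y) \<bullet> ((1 / norm y) *\<^sub>R y) \<le> c"
      unfolding c_def using that False S(1) by (intro mx) (auto simp: subspace_scale)
    then have "(L y \<bullet> y) / (norm y)^2 \<le> c"
      by (simp add: linear_scale[OF L] power2_eq_square)
    then show ?thesis using False by (simp add: divide_simps power2_norm_eq_inner)
  qed
  have xx: "x \<bullet> x = 1" using x(2) by (simp add: norm_eq_1)
  have "(c *\<^sub>R x - L x) \<bullet> y = 0" if y: "y \<in> S" for y
  proof -
    have "0 \<le> s * (2 * ((c *\<^sub>R x - L x) \<bullet> y)) + s^2 * (c * (y \<bullet> y) - L y \<bullet> y)" for s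
    proof -
      have "x + s *\<^sub>R y \<in> S" using S(1) x y by (simp add: subspace_add subspace_scale)
      from psd[OF this] have "L x \<bullet> x + s * (L x \<bullet> y) + s * (L y \<bullet> x) + s^2 * (L y \<bullet> y)
          \<le> c * (x \<bullet> x + 2 * s * (x \<bullet> y) + s^2 * (y \<bullet> y))"
        by (simp add: linear_add[OF L] linear_scale[OF L] inner_add_left inner_add_right
            inner_commute algebra_simps power2_eq_square)
      moreover have "L y \<bullet> x = L x \<bullet> y" using sa[OF y x(1)] by (simp add: inner_commute)
      ultimately show ?thesis unfolding xx
        by (simp add: c_def[symmetric] inner_diff_left algebra_simps)
    qed
    from psd_null_vector[OF this] show ?thesis by simp
  qed
  moreover have "c *\<^sub>R x - L x \<in> S" using S(1) x inv by (simp add: subspace_diff subspace_scale)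
  ultimately have "L x = c *\<^sub>R x" by (metis eq_iff_diff_eq_0 inner_eq_zero_iff)
  then show ?thesis using that x by blast
qed

text \<open>Invariance and symmetry are asked on \<open>S\<close> only, so that the induction can
  pass to the complement in \<open>S\<close> of one eigenvector.\<close>

lemma self_adjoint_eigenbasis:
  fixes L :: "'a::euclidean_space \<Rightarrow> 'a"
  assumes L: "linear L" and "subspace S"
    and "\<And>x. x \<in> S \<Longrightarrow> L x \<in> S"
    and "\<And>x y. x \<in> S \<Longrightarrow> y \<in> S \<Longrightarrow> L x \<bullet> y = x \<bullet> L y"
  shows "\<exists>B\<subseteq>S. pairwise orthogonal B \<and> (\<forall>b\<in>B. norm b = 1) \<and> finite B \<and> span B = S \<and>
    (\<forall>b\<in>B. \<exists>c. L b = c *\<^sub>R b)"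
  using assms(2-)
proof (induction "dim S" arbitrary: S rule: less_induct)
  case less
  show ?case
  proof (cases "S = {0}")
    case True
    then show ?thesis by (intro exI[of _ "{}"]) auto
  next
    case False
    obtain x c where x: "x \<in> S" "norm x = 1" "L x = c *\<^sub>R x"
      using self_adjoint_eigenvector[OF L less.prems(1) False less.prems(2,3)] by metis
    define T where "T = {y \<in> S. y \<bullet> x = 0}"
    have sT: "subspace T" using less.prems(1)
      by (auto simp: T_def subspace_def inner_add_left)
    have TS: "T \<subseteq> S" by (auto simp: T_def)
    have "x \<notin> T" using x(2) by (simp add: T_def norm_eq_1)
    then have "T \<subset> S" using TS x(1) by blast
    then have dim: "dim T < dim S"
      using dim_psubset[of T S] sT less.prems(1) by (simp add: span_eq_iff[THEN iffD2])
    have "L y \<in> T" if "y \<in> T" for y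
      using that less.prems(2)[of y] less.prems(3)[of y x] x by (simp add: T_def)
    moreover have "L y \<bullet> y' = y \<bullet> L y'" if "y \<in> T" "y' \<in> T" for y y'
      using that TS less.prems(3) by blast
    ultimately obtain B where B: "B \<subseteq> T" "pairwise orthogonal B" "\<forall>b\<in>B. norm b = 1" "finite B"
        "span B = T" "\<forall>b\<in>B. \<exists>c. L b = c *\<^sub>R b"
      using less.hyps[OF dim sT] by blast
    have "span (insert x B) = S"
    proof
      show "span (insert x B) \<subseteq> S"
        using B(1) TS x(1) less.prems(1) by (simp add: span_minimal)
      show "S \<subseteq> span (insert x B)"
      proof
        fix y assume y: "y \<in> S"
        have "y - (y \<bullet> x) *\<^sub>R x \<in> T"
          using y x less.prems(1) by (auto simp: T_def subspace_diff subspace_scale inner_diff_left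
            norm_eq_1)
        then have "y - (y \<bullet> x) *\<^sub>R x \<in> span B" using B by simp
        then show "y \<in> span (insert x B)" using span_breakdown_eq by blast
      qed
    qed
    moreover have "pairwise orthogonal (insert x B)"
      using B(1,2) by (auto simp: pairwise_insert T_def orthogonal_def inner_commute)
    ultimately show ?thesis
      using B x TS by (intro exI[of _ "insert x B"]) auto
  qed
qed

subsection \<open>Metrised algebras and the Hsiang identity\<close>

locale metrised_algebra =
  fixes m :: "'a::euclidean_space \<Rightarrow> 'a \<Rightarrow> 'a" (infixl "\<star>" 70)
  assumes add_left: "(x + y) \<star> z = x \<star> z + y \<star> z"
    and scale_left: "(c *\<^sub>R x) \<star> y = c *\<^sub>R (x \<star> y)"
    and commute: "x \<star> y = y \<star> x"
    and assoc: "(x \<star> y) \<bullet> z = x \<bullet> (y \<star> z)"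
begin

definition F :: "'a \<Rightarrow> 'a \<Rightarrow> 'a \<Rightarrow> real" where
  "F x y z = (x \<star> y) \<bullet> z"

text \<open>The trace of multiplication by \<open>x\<close>. For the cubic form
  \<open>F x x x / 6\<close> the Hessian at \<open>x\<close> is multiplication by \<open>x\<close>,
  so this is the Laplacian of the form.\<close>

definition tr :: "'a \<Rightarrow> real" where
  "tr x = (\<Sum>b\<in>Basis. F x b b)"

lemma add_right: "z \<star> (x + y) = z \<star> x + z \<star> y"
  by (metis add_left commute)

lemma scale_right: "y \<star> (c *\<^sub>R x) = c *\<^sub>R (y \<star> x)"
  by (metis scale_left commute)

lemma zero_left [simp]: "0 \<star> x = 0"
  using scale_left[of 0 0 x] by simp

lemma zero_right [simp]: "x \<star> 0 = 0"
  by (metis zero_left commute)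

lemma minus_left: "(- x) \<star> y = - (x \<star> y)"
  using scale_left[of "-1" x y] by simp

lemma minus_right: "y \<star> (- x) = - (y \<star> x)"
  using scale_right[of y "-1" x] by simp

lemma diff_left: "(x - y) \<star> z = x \<star> z - y \<star> z"
  using add_left[of x "- y" z] by (simp add: minus_left)

lemma diff_right: "z \<star> (x - y) = z \<star> x - z \<star> y"
  using add_right[of z x "- y"] by (simp add: minus_right)

lemmas star_expand = add_left add_right scale_left scale_right minus_left minus_right
  diff_left diff_right

lemma linear_star: "linear ((\<star>) x)"
  by (rule linearI) (simp_all add: star_expand)

lemma F_swap12: "F x y z = F y x z"
  by (simp add: F_def commute)

lemma F_swap23: "F x y z = F x z y"
proof -
  have "(x \<star> y) \<bullet> z = y \<bullet> (x \<star> z)" unfolding commute[of x y] by (rule assoc)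
  then show ?thesis by (simp add: F_def inner_commute)
qed

lemmas F_perm = F_swap12 F_swap23

lemma F_expand:
  "F (x + x') y z = F x y z + F x' y z" "F x (y + y') z = F x y z + F x y' z"
  "F x y (z + z') = F x y z + F x y z'"
  "F (x - x') y z = F x y z - F x' y z" "F x (y - y') z = F x y z - F x y' z"
  "F x y (z - z') = F x y z - F x y z'"
  "F (- x) y z = - F x y z" "F x (- y) z = - F x y z" "F x y (- z) = - F x y z"
  "F (c *\<^sub>R x) y z = c * F x y z" "F x (c *\<^sub>R y) z = c * F x y z" "F x y (c *\<^sub>R z) = c * F x y z"
  by (simp_all add: F_def star_expand inner_add_left inner_add_right inner_diff_left inner_diff_right)

lemma F_0 [simp]: "F 0 y z = 0" "F x 0 z = 0" "F x y 0 = 0"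
  by (simp_all add: F_def)

lemma inner_star: "x \<bullet> (y \<star> z) = F x y z"
  by (simp add: F_def assoc)

lemma tr_add: "tr (x + y) = tr x + tr y"
  by (simp add: tr_def F_expand sum.distrib)

lemma tr_scale: "tr (c *\<^sub>R x) = c * tr x"
  by (simp add: tr_def F_expand sum_distrib_left)

lemma tr_diff: "tr (x - y) = tr x - tr y"
  by (simp add: tr_def F_expand sum_subtractf)

lemma tr_orthonormal_basis:
  assumes "pairwise orthogonal B" "\<And>b. b \<in> B \<Longrightarrow> norm b = 1" "finite B" "span B = UNIV"
  shows "tr x = (\<Sum>b\<in>B. F x b b)"
  unfolding tr_def F_def
  using trace_orthonormal_basis[OF linear_star assms] by simp

end

text \<open>The equation L(f) = \<lambda> |x|^2 f for \<open>6 f x = F x x x\<close>: the gradient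
  is half of \<open>x \<star> x\<close> and the Hessian is multiplication by \<open>x\<close>, which
  gives \<lambda> = 18 \<tau>.\<close>

locale hsiang_algebra = metrised_algebra +
  fixes \<tau> :: real
  assumes hsiang: "((x \<star> x) \<bullet> (x \<star> x)) * tr x - F x (x \<star> x) (x \<star> x) = 12 * \<tau> * (x \<bullet> x) * F x x x"
begin

text \<open>The coefficients of \<open>s, \<dots>, s\<^sup>4\<close> in the defining identity at \<open>p + s q\<close>.\<close>

lemma hsiang_coeffs:
  fixes p q :: 'a
  defines "P \<equiv> p \<star> p" and "M \<equiv> p \<star> q" and "Q \<equiv> q \<star> q"
  shows "4 * (P \<bullet> M) * tr p + (P \<bullet> P) * tr q - (4 * F p P M + F q P P)
      = 12 * \<tau> * (3 * (p \<bullet> p) * F p p q + 2 * (p \<bullet> q) * F p p p)"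
    and "(4 * (M \<bullet> M) + 2 * (P \<bullet> Q)) * tr p + 4 * (P \<bullet> M) * tr q
        - (4 * F p M M + 2 * F p P Q + 4 * F q P M)
      = 12 * \<tau> * (3 * (p \<bullet> p) * F p q q + 6 * (p \<bullet> q) * F p p q + (q \<bullet> q) * F p p p)"
    and "4 * (M \<bullet> Q) * tr p + (4 * (M \<bullet> M) + 2 * (P \<bullet> Q)) * tr q
        - (4 * F p M Q + 4 * F q M M + 2 * F q P Q)
      = 12 * \<tau> * ((p \<bullet> p) * F q q q + 6 * (p \<bullet> q) * F p q q + 3 * (q \<bullet> q) * F p p q)"
    and "(Q \<bullet> Q) * tr p + 4 * (M \<bullet> Q) * tr q - (F p Q Q + 4 * F q M Q)
      = 12 * \<tau> * (2 * (p \<bullet> q) * F q q q + 3 * (q \<bullet> q) * F p q q)"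
proof -
  define c0 where "c0 = (P \<bullet> P) * tr p - F p P P - 12 * \<tau> * (p \<bullet> p) * F p p p"
  define c1 where "c1 = 4 * (P \<bullet> M) * tr p + (P \<bullet> P) * tr q - (4 * F p P M + F q P P)
      - 12 * \<tau> * (3 * (p \<bullet> p) * F p p q + 2 * (p \<bullet> q) * F p p p)"
  define c2 where "c2 = (4 * (M \<bullet> M) + 2 * (P \<bullet> Q)) * tr p + 4 * (P \<bullet> M) * tr q
        - (4 * F p M M + 2 * F p P Q + 4 * F q P M)
      - 12 * \<tau> * (3 * (p \<bullet> p) * F p q q + 6 * (p \<bullet> q) * F p p q + (q \<bullet> q) * F p p p)"
  define c3 where "c3 = 4 * (M \<bullet> Q) * tr p + (4 * (M \<bullet> M) + 2 * (P \<bullet> Q)) * tr q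
        - (4 * F p M Q + 4 * F q M M + 2 * F q P Q)
      - 12 * \<tau> * ((p \<bullet> p) * F q q q + 6 * (p \<bullet> q) * F p q q + 3 * (q \<bullet> q) * F p p q)"
  define c4 where "c4 = (Q \<bullet> Q) * tr p + 4 * (M \<bullet> Q) * tr q - (F p Q Q + 4 * F q M Q)
      - 12 * \<tau> * (2 * (p \<bullet> q) * F q q q + 3 * (q \<bullet> q) * F p q q)"
  define c5 where "c5 = (Q \<bullet> Q) * tr q - F q Q Q - 12 * \<tau> * (q \<bullet> q) * F q q q"
  note c_defs = c0_def c1_def c2_def c3_def c4_def c5_def
  have main: "c0 + s * c1 + s^2 * c2 + s^3 * c3 + s^4 * c4 + s^5 * c5 = 0" for s
  proof -
    let ?x = "p + s *\<^sub>R q"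
    have X: "?x \<star> ?x = P + (2 * s) *\<^sub>R M + s^2 *\<^sub>R Q"
    proof -
      have "(2 * s) *\<^sub>R M = s *\<^sub>R M + s *\<^sub>R M" by (simp flip: scaleR_add_left)
      then show ?thesis
        by (simp add: P_def M_def Q_def star_expand commute[of q p] power2_eq_square add.assoc
              scaleR_add_right)
    qed
    have i: "(?x \<star> ?x) \<bullet> (?x \<star> ?x) = P \<bullet> P + 4 * s * (P \<bullet> M) + s^2 * (4 * (M \<bullet> M) + 2 * (P \<bullet> Q))
        + 4 * s^3 * (M \<bullet> Q) + s^4 * (Q \<bullet> Q)"
      unfolding X by (simp add: inner_add_left inner_add_right inner_commute[of M P]
          inner_commute[of Q P] inner_commute[of Q M] algebra_simps power_numeral_reduce)
    have ii: "F ?x (?x \<star> ?x) (?x \<star> ?x) = F p P P + s * (4 * F p P M + F q P P)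
        + s^2 * (4 * F p M M + 2 * F p P Q + 4 * F q P M)
        + s^3 * (4 * F p M Q + 4 * F q M M + 2 * F q P Q) + s^4 * (F p Q Q + 4 * F q M Q)
        + s^5 * F q Q Q"
      unfolding X by (simp add: F_expand F_swap23[of _ M P] F_swap23[of _ Q P] F_swap23[of _ Q M]
          algebra_simps power_numeral_reduce)
    have iii: "F ?x ?x ?x = F p p p + 3 * s * F p p q + 3 * s^2 * F p q q + s^3 * F q q q"
      by (simp add: F_expand F_swap12[of q p] F_swap23[of p q p] F_swap23[of q q p]
          algebra_simps power_numeral_reduce)
    have iv: "?x \<bullet> ?x = p \<bullet> p + 2 * s * (p \<bullet> q) + s^2 * (q \<bullet> q)"
      by (simp add: inner_add_left inner_add_right inner_commute[of q p] algebra_simps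
          power_numeral_reduce)
    have "((?x \<star> ?x) \<bullet> (?x \<star> ?x)) * (tr p + s * tr q) - F ?x (?x \<star> ?x) (?x \<star> ?x)
        - 12 * \<tau> * (?x \<bullet> ?x) * F ?x ?x ?x = 0"
      using hsiang[of ?x] by (simp add: tr_add tr_scale)
    then show ?thesis
      unfolding i ii iii iv c_defs by (simp add: algebra_simps power_numeral_reduce)
  qed
  note z = quintic_coeffs_zero[OF main]
  show "4 * (P \<bullet> M) * tr p + (P \<bullet> P) * tr q - (4 * F p P M + F q P P)
      = 12 * \<tau> * (3 * (p \<bullet> p) * F p p q + 2 * (p \<bullet> q) * F p p p)"
    using z(2) by (simp add: c_defs)
  show "(4 * (M \<bullet> M) + 2 * (P \<bullet> Q)) * tr p + 4 * (P \<bullet> M) * tr q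
        - (4 * F p M M + 2 * F p P Q + 4 * F q P M)
      = 12 * \<tau> * (3 * (p \<bullet> p) * F p q q + 6 * (p \<bullet> q) * F p p q + (q \<bullet> q) * F p p p)"
    using z(3) by (simp add: c_defs)
  show "4 * (M \<bullet> Q) * tr p + (4 * (M \<bullet> M) + 2 * (P \<bullet> Q)) * tr q
        - (4 * F p M Q + 4 * F q M M + 2 * F q P Q)
      = 12 * \<tau> * ((p \<bullet> p) * F q q q + 6 * (p \<bullet> q) * F p q q + 3 * (q \<bullet> q) * F p p q)"
    using z(4) by (simp add: c_defs)
  show "(Q \<bullet> Q) * tr p + 4 * (M \<bullet> Q) * tr q - (F p Q Q + 4 * F q M Q)
      = 12 * \<tau> * (2 * (p \<bullet> q) * F q q q + 3 * (q \<bullet> q) * F p q q)"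
    using z(5) by (simp add: c_defs)
qed

end

text \<open>The genuine idempotent is \<open>e / 6\<close>. The unit vector is kept because
  \<open>F x x x / 6\<close> takes the value 1 at it, the coefficient of the leading cube in the
  normal form.\<close>

locale hsiang_idempotent = hsiang_algebra +
  fixes e :: 'a
  assumes norm_e: "norm e = 1" and star_e: "e \<star> e = 6 *\<^sub>R e"
begin

lemma inner_e: "e \<bullet> e = 1"
  using norm_e by (simp add: norm_eq_1)

lemma F_ee: "F e e x = 6 * (e \<bullet> x)"
  by (simp add: F_def star_e)

lemma star_e_perp: "y \<bullet> e = 0 \<Longrightarrow> (e \<star> y) \<bullet> e = 0"
  using F_ee[of y] F_swap23[of e y e] by (simp add: F_def inner_commute)

lemma tr_e: "tr e = 6 + 2 * \<tau>"
  using hsiang[of e] by (simp add: star_e F_expand F_ee inner_e)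

lemma F_e_e_star: "F e e (x \<star> y) = 6 * F e x y"
  by (simp add: F_ee inner_star)

context
  fixes y assumes y: "y \<bullet> e = 0"
begin

lemma ey: "e \<bullet> y = 0" "F e e y = 0"
  using y by (simp_all add: inner_commute F_ee)

text \<open>The coefficient of \<open>s\<close> at \<open>e + s *\<^sub>R y\<close>. Together with
  \<open>tr_e\<close> it makes the trace a multiple of the inner product with \<open>e\<close>, with
  factor \<open>6 + 2 * \<tau>\<close>; hence harmonicity amounts to
  \<open>\<tau> = - 3\<close>.\<close>

lemma tr_perp: "tr y = 0"
  using hsiang_coeffs(1)[where p = e and q = y]
  by (simp add: star_e F_expand inner_e ey inner_star F_swap12[of y e] F_swap23[of e y e] F_e_e_star)

text \<open>The coefficient of \<open>s^2\<close> at \<open>e + s *\<^sub>R y\<close>. On an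
  eigenvector of multiplication by \<open>e\<close> it turns into an equation for the eigenvalue,
  \<open>eig_char\<close>.\<close>

lemma quadratic_identity:
  "F e (e \<star> y) (e \<star> y) - 2 * \<tau> * ((e \<star> y) \<bullet> (e \<star> y)) + 3 * \<tau> * F e y y + 18 * \<tau> * (y \<bullet> y) = 0"
proof -
  have "e \<bullet> (y \<star> y) = F e y y" "e \<bullet> (e \<star> y) = 0" "F y e (e \<star> y) = (e \<star> y) \<bullet> (e \<star> y)" "F e e e = 6"
    using ey(2) by (simp_all add: inner_star F_def[of y e] commute[of y e] F_ee inner_e)
  then show ?thesis
    using hsiang_coeffs(2)[where p = e and q = y]
    unfolding star_e F_expand inner_scaleR_left inner_scaleR_right inner_e ey tr_e tr_perp F_e_e_star
    by (simp add: algebra_simps)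
qed

text \<open>The coefficient of \<open>s^3\<close>, the source of the selection rule
  \<open>eig_cubic\<close>.\<close>

lemma cubic_identity:
  "(3 + 2 * \<tau>) * F (e \<star> y) y y - F (e \<star> (e \<star> y)) y y - F y (e \<star> y) (e \<star> y) = 3 * \<tau> * F y y y"
proof -
  have "F e (e \<star> y) (y \<star> y) = F (e \<star> (e \<star> y)) y y"
    by (simp add: F_def assoc)
  moreover have "F y e (y \<star> y) = F (e \<star> y) y y" "(e \<star> y) \<bullet> (y \<star> y) = F (e \<star> y) y y"
    by (simp_all add: F_def assoc commute[of y e])
  ultimately show ?thesis
    using hsiang_coeffs(3)[where p = e and q = y]
    unfolding star_e F_expand inner_scaleR_left inner_scaleR_right inner_e ey tr_e tr_perp
    by (simp add: algebra_simps)
qed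

text \<open>The coefficient of \<open>s^4\<close>, the source of the norms of products of
  eigenvectors.\<close>

lemma quartic_identity:
  "(6 + 2 * \<tau>) * ((y \<star> y) \<bullet> (y \<star> y)) - F e (y \<star> y) (y \<star> y) - 4 * ((y \<star> (e \<star> y)) \<bullet> (y \<star> y))
    = 36 * \<tau> * (y \<bullet> y) * F e y y"
proof -
  have "F y (e \<star> y) (y \<star> y) = (y \<star> (e \<star> y)) \<bullet> (y \<star> y)"
    by (simp add: F_def)
  then show ?thesis
    using hsiang_coeffs(4)[where p = e and q = y]
    unfolding star_e F_expand inner_scaleR_left inner_scaleR_right inner_e ey tr_e tr_perp
    by (simp add: algebra_simps)
qed

end

end

subsection \<open>Harmonicity\<close>

text \<open>The polynomial is that of \<open>eig_char\<close>. It rules out a positive \<tau>: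
  eigenvalues with sum \<open>2 * \<tau>\<close> would include a positive one, and maximality of
  \<open>e\<close> bounds them by 3.\<close>

lemma positive_no_root:
  fixes t a :: real
  assumes "t > 0" "0 < a" "a \<le> 3"
  shows "a^3 - 2 * t * a^2 + 3 * t * a + 18 * t > 0"
proof -
  have "0 \<le> (3 - a) * (2 * a + 3)" using assms by simp
  then have "0 \<le> 18 + 3 * a - 2 * a^2" by (simp add: algebra_simps power2_eq_square)
  then have "0 \<le> t * (18 + 3 * a - 2 * a^2)" using assms by simp
  moreover have "a^3 > 0" using assms by simp
  moreover have "a^3 - 2 * t * a^2 + 3 * t * a + 18 * t = a^3 + t * (18 + 3 * a - 2 * a^2)"
    by (simp add: algebra_simps)
  ultimately show ?thesis by linarith
qed

text \<open>With \<open>T = - \<tau>\<close>, a single negative eigenvalue \<open>- b\<close>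
  already bounds \<open>T\<close> from below.\<close>

lemma negative_root_bound:
  fixes T b :: real
  assumes "T > 0" "b > 0" "- (b^3) + 2 * T * b^2 + 3 * T * b - 18 * T = 0"
  shows "T > 1 / 2"
proof (rule ccontr)
  assume "\<not> T > 1 / 2"
  then have T: "T \<le> 1 / 2" by simp
  have eq: "b^3 = T * (2 * b^2 + 3 * b - 18)" using assms(3) by (simp add: algebra_simps)
  moreover have "b^3 > 0" using assms by simp
  ultimately have "2 * b^2 + 3 * b - 18 > 0" using assms(1) by (simp add: zero_less_mult_iff)
  then have "b^3 \<le> (1 / 2) * (2 * b^2 + 3 * b - 18)"
    unfolding eq by (intro mult_right_mono[OF T]) simp
  then have "2 * b^3 \<le> 2 * b^2 + 3 * b - 18" by simp
  moreover have "2 * b^3 - (2 * b^2 + 3 * b - 18) = 2 * b * (b - 1)^2 + 2 * (b - 5 / 4)^2 + (18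
      - 25 / 8)"
    by (simp add: algebra_simps power2_eq_square power3_eq_cube)
  moreover have "2 * b * (b - 1)^2 + 2 * (b - 5 / 4)^2 + (18 - 25 / 8) > 0"
    using assms(2) by (intro add_nonneg_pos add_nonneg_nonneg) auto
  ultimately show False by simp
qed

text \<open>At \<open>T = 1 / 2\<close> the number 2 is a root, and increasing \<open>T\<close>
  lowers the value at 2. Excluding the eigenvalue 2 matters because it is the only one that
  \<open>eig_square_parallel\<close> leaves in \<open>tau_eq\<close>.\<close>

lemma positive_root_bound:
  fixes T r :: real
  assumes "T > 1 / 2" "r > 0" "r^3 + 2 * T * r^2 - 3 * T * r - 18 * T = 0"
  shows "r > 2"
proof (rule ccontr)
  assume "\<not> r > 2"
  then have r: "r \<le> 2" by simp
  have "r^3 \<le> 2^3" using r assms(2) by (intro power_mono) auto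
  moreover have "0 \<le> (2 - r) * (2 * r + 1)" using r assms(2) by simp
  then have "0 \<le> T * ((2 - r) * (2 * r + 1))" using assms(1) by simp
  then have "T * (2 * r^2 - 3 * r - 18) \<le> T * (- 16)"
    using assms(1) by (simp add: algebra_simps power2_eq_square)
  ultimately show False using assms(1,3) by (simp add: algebra_simps)
qed

section \<open>Eigenvectors of multiplication by \<open>e\<close> and the value of \<tau>\<close>

context hsiang_idempotent
begin

text \<open>Orthogonality to \<open>e\<close> excludes \<open>e\<close> itself, whose eigenvalue is
  6. The zero vector satisfies the predicate for every \<open>a\<close>.\<close>

definition eig :: "real \<Rightarrow> 'a \<Rightarrow> bool" where
  "eig a x \<longleftrightarrow> x \<bullet> e = 0 \<and> e \<star> x = a *\<^sub>R x"

lemma eig_scale: "eig a x \<Longrightarrow> eig a (c *\<^sub>R x)"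
  by (simp add: eig_def star_expand)

lemma eig_add: "eig a x \<Longrightarrow> eig a y \<Longrightarrow> eig a (x + y)"
  by (simp add: eig_def star_expand inner_add_left scaleR_add_right)

lemma eig_F: "eig a x \<Longrightarrow> F e x y = a * (x \<bullet> y)"
  by (simp add: eig_def F_def)

lemma eig_perp:
  assumes "eig a x" "eig b y" "a \<noteq> b"
  shows "x \<bullet> y = 0"
  using eig_F[OF assms(1), of y] eig_F[OF assms(2), of x] F_swap23[of e x y] assms(3)
  by (simp add: inner_commute)

text \<open>The cubic form \<open>G\<close> of \<open>cubic_identity\<close> vanishes on the
  complement of \<open>e\<close>, hence so does its polarisation by inclusion and exclusion, which
  on eigenvectors is a scalar multiple of \<open>F x y z\<close>. Products of eigenvectors are thus
  confined to triples of eigenvalues on a quadric.\<close>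

lemma eig_cubic:
  assumes x: "eig a x" and y: "eig b y" and z: "eig c z"
  shows "((6 + 4 * \<tau>) * (a + b + c) - (a^2 + b^2 + c^2) - (a + b + c)^2 - 18 * \<tau>) * F x y z = 0"
proof -
  define G where "G = (\<lambda>y. (3 + 2 * \<tau>) * F (e \<star> y) y y - F (e \<star> (e \<star> y)) y y
      - F y (e \<star> y) (e \<star> y) - 3 * \<tau> * F y y y)"
  have G0: "G u = 0" if "u \<bullet> e = 0" for u
    using cubic_identity[OF that] by (simp add: G_def)
  have perp: "x \<bullet> e = 0" "y \<bullet> e = 0" "z \<bullet> e = 0"
      and ev: "e \<star> x = a *\<^sub>R x" "e \<star> y = b *\<^sub>R y" "e \<star> z = c *\<^sub>R z"
    using assms by (auto simp: eig_def)
  have "G (x + y + z) - G (x + y) - G (x + z) - G (y + z) + G x + G y + G z =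
     ((6 + 4 * \<tau>) * (a + b + c) - (a^2 + b^2 + c^2) - (a + b + c)^2 - 18 * \<tau>) * F x y z"
    unfolding G_def star_expand ev F_expand
    by (simp add: F_swap12[of y x] F_swap12[of z x] F_swap12[of z y] F_swap23[of _ z y]
        F_swap23[of _ z x] F_swap23[of _ y x] algebra_simps power2_eq_square)
  then show ?thesis using perp by (simp add: G0 inner_add_left)
qed

lemma eig_char:
  assumes x: "eig a x" "x \<noteq> 0"
  shows "a^3 - 2 * \<tau> * a^2 + 3 * \<tau> * a + 18 * \<tau> = 0"
proof -
  have "(a^3 - 2 * \<tau> * a^2 + 3 * \<tau> * a + 18 * \<tau>) * (x \<bullet> x) = 0"
    using quadratic_identity[of x] x(1) eig_F[OF x(1), of x]
    by (simp add: eig_def F_expand algebra_simps power2_eq_square power3_eq_cube)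
  then show ?thesis using x(2) by simp
qed

text \<open>When the square is parallel to \<open>e\<close>, \<open>quartic_identity\<close> becomes
  a second equation for \<open>a\<close>. Eliminating the cube with \<open>eig_char\<close> leaves
  the factors \<open>a + 6\<close> and \<open>a - 2\<close>.\<close>

lemma eig_square_parallel:
  assumes x: "eig a x" "norm x = 1" and sq: "x \<star> x = a *\<^sub>R e" and a: "a \<noteq> 0" and \<tau>: "\<tau> \<noteq> 0"
  shows "a = - 6 \<or> a = 2"
proof -
  have xx: "x \<bullet> x = 1" using x(2) by (simp add: norm_eq_1)
  have "2 * \<tau> * a^2 - 4 * a^3 = 36 * \<tau> * a"
    using quartic_identity[of x] x(1) eig_F[OF x(1), of x]
    by (simp add: eig_def star_expand sq F_expand F_ee inner_e xx algebra_simps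
        power2_eq_square power3_eq_cube)
  moreover have "a^3 - 2 * \<tau> * a^2 + 3 * \<tau> * a + 18 * \<tau> = 0"
    using eig_char[OF x(1)] x(2) by (metis norm_zero zero_neq_one)
  ultimately have "6 * \<tau> * ((a + 6) * (a - 2)) = 0"
    by (simp add: algebra_simps power2_eq_square power3_eq_cube)
  then show ?thesis using \<tau> by auto
qed

text \<open>Adjoining \<open>e\<close>, with eigenvalue 6, gives an orthonormal basis of the whole
  space, so the eigenvalues on the complement add up to \<open>tr e - 6\<close>.\<close>

lemma eigenbasis:
  obtains B \<alpha> where "finite B" "pairwise orthogonal B" "\<And>b. b \<in> B \<Longrightarrow> norm b = 1"
    "span B = {x. x \<bullet> e = 0}" "\<And>b. b \<in> B \<Longrightarrow> eig (\<alpha> b) b" "(\<Sum>b\<in>B. \<alpha> b) = 2 * \<tau>"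
proof -
  let ?S = "{x. x \<bullet> e = 0}"
  have "subspace ?S" by (auto simp: subspace_def inner_add_left)
  moreover have "e \<star> x \<in> ?S" if "x \<in> ?S" for x using that star_e_perp by simp
  moreover have "(e \<star> x) \<bullet> y = x \<bullet> (e \<star> y)" for x y
    by (metis assoc commute)
  ultimately obtain B where B: "B \<subseteq> ?S" "pairwise orthogonal B" "\<forall>b\<in>B. norm b = 1" "finite B"
      "span B = ?S" "\<forall>b\<in>B. \<exists>c. e \<star> b = c *\<^sub>R b"
    using self_adjoint_eigenbasis[OF linear_star[of e], of ?S] by blast
  then obtain \<alpha> where \<alpha>: "\<And>b. b \<in> B \<Longrightarrow> e \<star> b = \<alpha> b *\<^sub>R b" by metis
  have eig: "eig (\<alpha> b) b" if "b \<in> B" for b using that B(1) \<alpha> by (auto simp: eig_def)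
  have "e \<notin> B" using B(1) inner_e by auto
  have "x \<in> span (insert e B)" for x
  proof -
    have "x - (x \<bullet> e) *\<^sub>R e \<in> span B"
      unfolding B(5) by (simp add: inner_diff_left inner_e)
    then show ?thesis using span_breakdown_eq by blast
  qed
  then have "span (insert e B) = UNIV" by blast
  moreover have "pairwise orthogonal (insert e B)"
    using B(1,2) by (auto simp: pairwise_insert orthogonal_def inner_commute)
  ultimately have "tr e = (\<Sum>b\<in>insert e B. F e b b)"
    using B(3,4) norm_e by (intro tr_orthonormal_basis) auto
  also have "\<dots> = 6 + (\<Sum>b\<in>B. \<alpha> b)"
  proof -
    have "F e b b = \<alpha> b" if "b \<in> B" for b
      using eig_F[OF eig[OF that], of b] B(3) that by (simp add: norm_eq_1)
    then show ?thesis using \<open>e \<notin> B\<close> B(4) by (simp add: F_ee inner_e)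
  qed
  finally have "(\<Sum>b\<in>B. \<alpha> b) = 2 * \<tau>" by (simp add: tr_e)
  then show ?thesis using that[OF B(4,2)] B(3,5) eig by blast
qed

lemma square_eigenvector:
  assumes B: "finite B" "pairwise orthogonal B" "\<And>b. b \<in> B \<Longrightarrow> norm b = 1" "span B = {x. x \<bullet> e = 0}"
    and y: "eig a y" "norm y = 1" and F: "\<And>b. b \<in> B \<Longrightarrow> F y y b = 0"
  shows "y \<star> y = a *\<^sub>R e"
proof -
  have "(y \<star> y) \<bullet> e = a"
    using eig_F[OF y(1), of y] y(2) F_swap12[of e y y] F_swap23[of y e y] by (simp add: F_def norm_eq_1)
  then have "y \<star> y - a *\<^sub>R e \<in> span B"
    unfolding B(4) by (simp add: inner_diff_left inner_e)
  moreover have "(y \<star> y - a *\<^sub>R e) \<bullet> b = 0" if "b \<in> B" for b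
  proof -
    have "b \<bullet> e = 0" using that B(4) span_superset by blast
    then have "e \<bullet> b = 0" by (simp add: inner_commute)
    then show ?thesis using F[OF that] by (simp add: F_def inner_diff_left)
  qed
  then have "orthogonal (y \<star> y - a *\<^sub>R e) x" if "x \<in> span B" for x
    using orthogonal_to_span[OF that] by (simp add: orthogonal_def)
  ultimately have "orthogonal (y \<star> y - a *\<^sub>R e) (y \<star> y - a *\<^sub>R e)" by blast
  then show ?thesis by (simp add: orthogonal_self)
qed

text \<open>If the trace did not vanish, some eigenvector \<open>y\<close> of multiplication by \<open>e\<close> would have its
  square parallel to \<open>e\<close>, by the selection rule \<open>eig_cubic\<close>.\<close>

lemma tau_eq:
  assumes \<tau>0: "\<tau> \<noteq> 0" and mx: "\<And>y. y \<bullet> e = 0 \<Longrightarrow> F e y y \<le> 3 * (y \<bullet> y)"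
  shows "\<tau> = - 3"
proof (rule ccontr)
  assume n3: "\<tau> \<noteq> - 3"
  obtain B \<alpha> where B: "finite B" "pairwise orthogonal B" "\<And>b. b \<in> B \<Longrightarrow> norm b = 1"
    "span B = {x. x \<bullet> e = 0}" and eig: "\<And>b. b \<in> B \<Longrightarrow> eig (\<alpha> b) b"
    and sum: "(\<Sum>b\<in>B. \<alpha> b) = 2 * \<tau>"
    using eigenbasis by blast
  have bb: "b \<bullet> b = 1" "b \<noteq> 0" if "b \<in> B" for b using B(3)[OF that] by (auto simp: norm_eq_1)
  have char: "\<alpha> b^3 - 2 * \<tau> * \<alpha> b^2 + 3 * \<tau> * \<alpha> b + 18 * \<tau> = 0" if "b \<in> B" for b
    using eig_char[OF eig[OF that] bb(2)[OF that]] .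
  have le3: "\<alpha> b \<le> 3" if "b \<in> B" for b
    using mx[of b] eig_F[OF eig[OF that], of b] bb[OF that] eig[OF that] by (simp add: eig_def)
  have par: "\<alpha> b = 2" if "b \<in> B" "\<And>c. c \<in> B \<Longrightarrow> F b b c = 0" for b
  proof -
    have "\<alpha> b \<noteq> 0" using char[OF that(1)] \<tau>0 by auto
    then have "\<alpha> b = - 6 \<or> \<alpha> b = 2"
      using eig_square_parallel[OF eig[OF that(1)] B(3)[OF that(1)]
          square_eigenvector[OF B eig[OF that(1)] B(3)[OF that(1)] that(2)]] \<tau>0 by blast
    \<comment> \<open>The number -6 solves \<open>eig_char\<close> only for
      \<open>\<tau> = - 3\<close>.\<close>
    moreover have "\<alpha> b \<noteq> - 6" using char[OF that(1)] n3 by auto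
    ultimately show ?thesis by blast
  qed
  have "\<tau> < 0"
  proof (rule ccontr)
    assume "\<not> \<tau> < 0"
    then have pos: "\<tau> > 0" using \<tau>0 by simp
    have "\<exists>b\<in>B. \<alpha> b > 0"
      using sum pos sum_nonpos[of B \<alpha>] by (metis linorder_not_less mult_pos_pos zero_less_numeral)
    then obtain b where "b \<in> B" "\<alpha> b > 0" by blast
    then show False using positive_no_root[OF pos _ le3] char by (metis less_irrefl)
  qed
  define T where "T = - \<tau>"
  have T: "T > 0" "\<tau> = - T" "T \<noteq> 3" using \<open>\<tau> < 0\<close> n3 by (auto simp: T_def)
  have charT: "\<alpha> b^3 + 2 * T * \<alpha> b^2 - 3 * T * \<alpha> b - 18 * T = 0" if "b \<in> B" for b
    using char[OF that] by (simp add: T(2))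
  have sel: "F x y z = 0" if "x \<in> B" "y \<in> B" "z \<in> B"
      "(6 - 4 * T) * (\<alpha> x + \<alpha> y + \<alpha> z) - (\<alpha> x^2 + \<alpha> y^2 + \<alpha> z^2) - (\<alpha> x + \<alpha> y + \<alpha> z)^2 + 18 * T \<noteq> 0"
    for x y z
    using eig_cubic[OF eig[OF that(1)] eig[OF that(2)] eig[OF that(3)]] that(4) by (simp add: T(2))
  have "\<exists>b\<in>B. \<alpha> b < 0"
    using sum T(1,2) sum_nonneg[of B \<alpha>] by (smt (verit))
  then obtain n where n: "n \<in> B" "\<alpha> n < 0" by blast
  have T2: "T > 1 / 2"
    using negative_root_bound[of T "- \<alpha> n"] charT[OF n(1)] n(2) T(1) by simp
  show False
  proof (cases "\<exists>b\<in>B. \<alpha> b > 0")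
    case True
    then obtain y where y: "y \<in> B" "\<alpha> y > 0" by blast
    define r where "r = \<alpha> y"
    have r: "r > 2" "r^3 + 2 * T * r^2 - 3 * T * r - 18 * T = 0"
      using positive_root_bound[OF T2] charT[OF y(1)] y(2) by (auto simp: r_def)
    have "r \<noteq> 3" using r(2) T(3) by auto
    have "F y y c = 0" if c: "c \<in> B" for c
    proof (rule sel[OF y(1) y(1) c], fold r_def)
      define d where "d = \<alpha> c"
      have d: "d^3 + 2 * T * d^2 - 3 * T * d - 18 * T = 0" using charT[OF c] by (simp add: d_def)
      then have "d \<noteq> 0" using T(1) by auto
      \<comment> \<open>Both \<open>r\<close> and \<open>d\<close> are roots of the same cubic. The
        difference quotient is the relation that makes the selection factor split into linear
        factors.\<close>
      have "(r - d) * (r^2 + r * d + d^2 + 2 * T * (r + d) - 3 * T) = 0"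
        using r(2) d by (simp add: algebra_simps power2_eq_square power3_eq_cube)
      then have cases: "d = r \<or> r^2 + r * d + d^2 + 2 * T * (r + d) - 3 * T = 0" by auto
      have "(6 - 4 * T) * (r + r + d) - (r^2 + r^2 + d^2) - (r + r + d)^2 + 18 * T \<noteq> 0"
      proof (cases "d = r")
        case True
        have "(6 - 4 * T) * (r + r + d) - (r^2 + r^2 + d^2) - (r + r + d)^2 + 18 * T
            = - (6 * (r * (2 * r - 3) + T * (2 * r - 3)))"
          unfolding True by (simp add: algebra_simps power2_eq_square)
        moreover have "r * (2 * r - 3) + T * (2 * r - 3) > 0"
          using r(1) T(1) by (intro add_pos_pos mult_pos_pos) auto
        ultimately show ?thesis by (simp only: neg_equal_0_iff_equal mult_eq_0_iff) simp
      next
        case False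
        then have q: "r^2 + r * d + d^2 + 2 * T * (r + d) - 3 * T = 0" using cases by blast
        have "(6 - 4 * T) * (r + r + d) - (r^2 + r^2 + d^2) - (r + r + d)^2 + 18 * T
            = - 2 * ((2 * r + 2 * T + d) * (r - 3))"
          using q by (simp add: algebra_simps power2_eq_square)
        \<comment> \<open>The three roots add up to \<open>- 2 * T\<close>, so this is the
          difference of \<open>r\<close> and the third root: \<open>r\<close> is a simple
          root.\<close>
        moreover have "2 * r + 2 * T + d \<noteq> 0"
        proof
          assume "2 * r + 2 * T + d = 0"
          then have "d = - 2 * r - 2 * T" by simp
          then have "3 * r^2 + T * (4 * r - 3) = 0"
            using q by (simp only:) (simp add: algebra_simps power2_eq_square)
          moreover have "3 * r^2 > 0" "T * (4 * r - 3) > 0" using r(1) T(1) by auto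
          ultimately show False by linarith
        qed
        ultimately show ?thesis using \<open>r \<noteq> 3\<close> by simp
      qed
      then show "(6 - 4 * T) * (r + r + \<alpha> c) - (r^2 + r^2 + (\<alpha> c)^2) - (r + r + \<alpha> c)^2 + 18 * T \<noteq> 0"
        by (simp add: d_def)
    qed
    then have "r = 2" unfolding r_def by (rule par[OF y(1)])
    then show False using r(1) by simp
  next
    case False
    define b where "b = - \<alpha> n"
    have b: "b > 0" using n by (simp add: b_def)
    have charb: "- (b^3) + 2 * T * b^2 + 3 * T * b - 18 * T = 0"
      using charT[OF n(1)] by (simp add: b_def)
    \<comment> \<open>All eigenvalues are nonpositive with sum \<open>- 2 * T\<close>, so two
      distinct ones \<open>- b\<close> and \<open>- d\<close> satisfy
      \<open>b + d \<le> 2 * T\<close>. This contradicts the difference quotient of the cubic at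
      \<open>b\<close> and \<open>d\<close>.\<close>
    have all: "\<alpha> c = - b" if c: "c \<in> B" for c
    proof (rule ccontr)
      assume ne: "\<alpha> c \<noteq> - b"
      define d where "d = - \<alpha> c"
      have nonpos: "\<alpha> x \<le> 0" if "x \<in> B" for x using False that by (simp add: not_less)
      have d: "- (d^3) + 2 * T * d^2 + 3 * T * d - 18 * T = 0" "d \<ge> 0" "d \<noteq> b"
        using charT[OF c] nonpos[OF c] ne by (auto simp: d_def)
      have "c \<noteq> n" using ne by (auto simp: b_def)
      then have "(\<Sum>x\<in>B - {c, n}. \<alpha> x) + (- d - b) = 2 * \<tau>"
        using sum B(1) c n(1) sum.subset_diff[of "{c, n}" B \<alpha>] by (simp add: d_def b_def)
      moreover have "(\<Sum>x\<in>B - {c, n}. \<alpha> x) \<le> 0" using nonpos by (intro sum_nonpos) auto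
      ultimately have le: "b + d \<le> 2 * T" using T(2) by simp
      have "(b - d) * (- (b^2 + b * d + d^2) + 2 * T * (b + d) + 3 * T) = 0"
        using charb d(1) by (simp add: algebra_simps power2_eq_square power3_eq_cube)
      then have "- (b^2 + b * d + d^2) + 2 * T * (b + d) + 3 * T = 0" using d(3) by simp
      moreover have "(b + d) * (2 * T - (b + d)) \<ge> 0" using b d(2) le by simp
      moreover have "b * d \<ge> 0" using b d(2) by simp
      ultimately show False using T(1) by (simp add: algebra_simps power2_eq_square)
    qed
    define k where "k = real (card B)"
    have kb: "k * b = 2 * T" using sum all T(2) by (simp add: k_def)
    \<comment> \<open>Otherwise \<open>par\<close> would force the eigenvalue 2 on \<open>n\<close>.
      A nonzero product makes the selection factor vanish at three equal eigenvalues
      \<open>- b\<close>, and the trace relation then leaves only multiplicity two and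
      \<open>T = 3\<close>.\<close>
    have "\<not> (\<forall>c\<in>B. F n n c = 0)" using par[OF n(1)] n(2) by fastforce
    then have "(6 - 4 * T) * (- b + - b + - b) - ((- b)^2 + (- b)^2 + (- b)^2) - (- b + - b + - b)^2
        + 18 * T = 0"
      using sel[OF n(1) n(1)] all n(1) by metis
    then have "12 * T * b - 18 * b - 12 * b^2 + 18 * T = 0"
      by (simp add: algebra_simps power2_eq_square)
    moreover have "T = k * b / 2" using kb by simp
    ultimately have "b * ((k - 2) * (2 * b + 3)) = 0"
      by (simp only:) (simp add: algebra_simps power2_eq_square)
    then have "k = 2" using b by simp
    then have "T = b" using kb by simp
    then have "b * ((b - 3) * (b + 6)) = 0"
      using charb by (simp only:) (simp add: algebra_simps power2_eq_square power3_eq_cube)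
    then have "b = 3" using b by simp
    then show False using \<open>T = b\<close> T(3) by simp
  qed
qed

end

section \<open>Splittings of Clifford type\<close>

context metrised_algebra
begin

text \<open>A Clifford cubic without coordinates. By the last condition the multiplications by an
  orthonormal basis of \<open>Z\<close>, divided by \<open>sqrt k\<close>, act on \<open>Y\<close>
  as anticommuting symmetric involutions; \<open>k\<close> absorbs the scale of the cubic
  form.\<close>

definition clifford_split :: "'a set \<Rightarrow> 'a set \<Rightarrow> real \<Rightarrow> bool" where
  "clifford_split Z Y k \<longleftrightarrow> subspace Z \<and> subspace Y \<and> k > 0 \<and>
     (\<forall>z\<in>Z. \<forall>y\<in>Y. z \<bullet> y = 0) \<and> (\<forall>x. \<exists>z\<in>Z. \<exists>y\<in>Y. x = z + y) \<and>
     (\<forall>z\<in>Z. \<forall>z'\<in>Z. z \<star> z' = 0) \<and> (\<forall>x\<in>Y. \<forall>y\<in>Y. \<forall>z\<in>Y. F x y z = 0) \<and>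
     (\<forall>z\<in>Z. \<forall>y\<in>Y. (z \<star> y) \<bullet> (z \<star> y) = k * (z \<bullet> z) * (y \<bullet> y))"

lemma F_polarise:
  assumes S: "subspace S" and F: "\<And>y. y \<in> S \<Longrightarrow> F y y y = 0" and "x \<in> S" "y \<in> S" "z \<in> S"
  shows "F x y z = 0"
proof -
  have "F (x + y + z) (x + y + z) (x + y + z) - F (x + y) (x + y) (x + y)
      - F (x + z) (x + z) (x + z) - F (y + z) (y + z) (y + z)
      + F x x x + F y y y + F z z z = 6 * F x y z"
    unfolding F_expand
    by (simp add: F_swap12[of y x] F_swap12[of z x] F_swap12[of z y] F_swap23[of _ z y]
        F_swap23[of _ z x] F_swap23[of _ y x] algebra_simps)
  moreover have "x + y + z \<in> S" "x + y \<in> S" "x + z \<in> S" "y + z \<in> S"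
    using assms by (simp_all add: subspace_add)
  ultimately show ?thesis using F[of "x + y + z"] F[of "x + y"] F[of "x + z"] F[of "y + z"]
      F[OF assms(3)] F[OF assms(4)] F[OF assms(5)] by linarith
qed

end

subsection \<open>Peirce decomposition\<close>

locale harmonic_hsiang = hsiang_idempotent m "- 3" e
  for m :: "'a::euclidean_space \<Rightarrow> 'a \<Rightarrow> 'a" (infixl "\<star>" 70) and e :: 'a
begin

lemma tr_zero: "tr x = 0"
proof -
  have "(x - (x \<bullet> e) *\<^sub>R e) \<bullet> e = 0" by (simp add: inner_diff_left inner_e)
  from tr_perp[OF this] show ?thesis by (simp add: tr_diff tr_scale tr_e)
qed

lemma eig_zero:
  assumes "eig a x" "eig b y" "eig c z" "(a + b + c)^2 + (a^2 + b^2 + c^2) + 6 * (a + b + c) \<noteq> 54"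
  shows "F x y z = 0"
  using eig_cubic[OF assms(1-3)] assms(4) by simp

abbreviation "V1 \<equiv> eig (- 6)"
abbreviation "V2 \<equiv> eig (- 3)"
abbreviation "V3 \<equiv> eig 3"

text \<open>Of the ten unordered triples of eigenvalues these six are excluded. The remaining four
  lie on the quadric of \<open>eig_zero\<close> and are the components \<psi>111, \<psi>102,
  \<psi>012 and \<psi>030.\<close>

lemma F_selection:
  "V1 x \<Longrightarrow> V1 y \<Longrightarrow> V1 z \<Longrightarrow> F x y z = 0"
  "V1 x \<Longrightarrow> V1 y \<Longrightarrow> V2 z \<Longrightarrow> F x y z = 0"
  "V1 x \<Longrightarrow> V1 y \<Longrightarrow> V3 z \<Longrightarrow> F x y z = 0"
  "V1 x \<Longrightarrow> V2 y \<Longrightarrow> V2 z \<Longrightarrow> F x y z = 0"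
  "V2 x \<Longrightarrow> V2 y \<Longrightarrow> V3 z \<Longrightarrow> F x y z = 0"
  "V3 x \<Longrightarrow> V3 y \<Longrightarrow> V3 z \<Longrightarrow> F x y z = 0"
  by (erule (2) eig_zero; simp add: power2_eq_square)+

lemma V_perp:
  "V1 x \<Longrightarrow> V2 y \<Longrightarrow> x \<bullet> y = 0" "V1 x \<Longrightarrow> V3 y \<Longrightarrow> x \<bullet> y = 0" "V2 x \<Longrightarrow> V3 y \<Longrightarrow> x \<bullet> y = 0"
  by (erule (1) eig_perp; simp)+

lemma V_e: "eig a x \<Longrightarrow> x \<bullet> e = 0" "eig a x \<Longrightarrow> e \<bullet> x = 0" "eig a x \<Longrightarrow> e \<star> x = a *\<^sub>R x"
  by (simp_all add: eig_def inner_commute)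

text \<open>For \<open>\<tau> = - 3\<close> the equation \<open>eig_char\<close> has exactly the
  roots -6, -3 and 3, so the eigenbasis is distributed over three eigenspaces.\<close>

lemma V_decomp:
  assumes "x \<bullet> e = 0"
  obtains x1 x2 x3 where "V1 x1" "V2 x2" "V3 x3" "x = x1 + x2 + x3"
proof -
  obtain B \<alpha> where B: "finite B" "pairwise orthogonal B" "\<And>b. b \<in> B \<Longrightarrow> norm b = 1"
    "span B = {x. x \<bullet> e = 0}" and eig: "\<And>b. b \<in> B \<Longrightarrow> eig (\<alpha> b) b"
    and "(\<Sum>b\<in>B. \<alpha> b) = 2 * (- 3)"
    using eigenbasis by blast
  let ?S = "{x. \<exists>x1 x2 x3. V1 x1 \<and> V2 x2 \<and> V3 x3 \<and> x = x1 + x2 + x3}"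
  have z: "eig a 0" for a by (simp add: eig_def)
  have S_I: "x1 + x2 + x3 \<in> ?S" if "V1 x1" "V2 x2" "V3 x3" for x1 x2 x3
    using that by (intro CollectI exI conjI) (rule refl | assumption)+
  have "subspace ?S"
    unfolding subspace_def
  proof (intro conjI ballI allI)
    show "0 \<in> ?S" using S_I[OF z z z] by simp
    fix x y assume "x \<in> ?S" "y \<in> ?S"
    then obtain x1 x2 x3 y1 y2 y3 where V: "V1 x1" "V2 x2" "V3 x3" "V1 y1" "V2 y2" "V3 y3"
      and xy: "x = x1 + x2 + x3" "y = y1 + y2 + y3" by blast
    have "x + y = (x1 + y1) + (x2 + y2) + (x3 + y3)" unfolding xy by simp
    then show "x + y \<in> ?S"
      using S_I[OF eig_add[OF V(1,4)] eig_add[OF V(2,5)] eig_add[OF V(3,6)]] by (simp only:)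
  next
    fix x and c :: real assume "x \<in> ?S"
    then obtain x1 x2 x3 where V: "V1 x1" "V2 x2" "V3 x3" and x: "x = x1 + x2 + x3" by blast
    have "c *\<^sub>R x = c *\<^sub>R x1 + c *\<^sub>R x2 + c *\<^sub>R x3" unfolding x by (simp add: scaleR_add_right)
    then show "c *\<^sub>R x \<in> ?S"
      using S_I[OF eig_scale[OF V(1)] eig_scale[OF V(2)] eig_scale[OF V(3)], of c c c] by (simp only:)
  qed
  moreover have "B \<subseteq> ?S"
  proof
    fix b assume b: "b \<in> B"
    have "b \<noteq> 0" using B(3)[OF b] by auto
    then have "(\<alpha> b)^3 + 6 * (\<alpha> b)^2 - 9 * \<alpha> b - 54 = 0" using eig_char[OF eig[OF b]] by simp
    then have "(\<alpha> b + 6) * ((\<alpha> b + 3) * (\<alpha> b - 3)) = 0"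
      by (simp add: algebra_simps power2_eq_square power3_eq_cube)
    then consider "\<alpha> b = - 6" | "\<alpha> b = - 3" | "\<alpha> b = 3"
      unfolding mult_eq_0_iff by linarith
    then show "b \<in> ?S"
    proof cases
      case 1
      then show ?thesis using S_I[of b 0 0] eig[OF b] z by simp
    next
      case 2
      then show ?thesis using S_I[of 0 b 0] eig[OF b] z by simp
    next
      case 3
      then show ?thesis using S_I[of 0 0 b] eig[OF b] z by simp
    qed
  qed
  ultimately have "span B \<subseteq> ?S" by (simp add: span_minimal)
  moreover have "x \<in> span B" using assms B(4) by simp
  ultimately have "x \<in> ?S" by (rule subsetD)
  then show ?thesis using that by blast
qed

lemma V_components:
  assumes "u \<bullet> e = 0"
  obtains x y z where "V1 x" "V2 y" "V3 z" "u = x + y + z" "u \<bullet> x = x \<bullet> x" "u \<bullet> y = y \<bullet> y"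
      "u \<bullet> z = z \<bullet> z"
proof -
  obtain x y z where x: "V1 x" "V2 y" "V3 z" "u = x + y + z" using V_decomp[OF assms] .
  have "x \<bullet> y = 0" "x \<bullet> z = 0" "y \<bullet> z = 0" "y \<bullet> x = 0" "z \<bullet> x = 0" "z \<bullet> y = 0"
    using V_perp(1)[OF x(1,2)] V_perp(2)[OF x(1,3)] V_perp(3)[OF x(2,3)] by (simp_all add: inner_commute)
  then show ?thesis using that[OF x] unfolding x(4) by (simp add: inner_add_left)
qed

lemma V3_I:
  assumes "u \<bullet> e = 0" "\<And>x. V1 x \<Longrightarrow> u \<bullet> x = 0" "\<And>x. V2 x \<Longrightarrow> u \<bullet> x = 0"
  shows "V3 u"
proof -
  obtain x y z where "V1 x" "V2 y" "V3 z" "u = x + y + z" "u \<bullet> x = x \<bullet> x" "u \<bullet> y = y \<bullet> y" "u \<bullet> z = z \<bullet> z"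
    using V_components[OF assms(1)] .
  then show ?thesis using assms(2,3) by simp
qed

lemma V2_I:
  assumes "u \<bullet> e = 0" "\<And>x. V1 x \<Longrightarrow> u \<bullet> x = 0" "\<And>x. V3 x \<Longrightarrow> u \<bullet> x = 0"
  shows "V2 u"
proof -
  obtain x y z where "V1 x" "V2 y" "V3 z" "u = x + y + z" "u \<bullet> x = x \<bullet> x" "u \<bullet> y = y \<bullet> y" "u \<bullet> z = z \<bullet> z"
    using V_components[OF assms(1)] .
  then show ?thesis using assms(2,3) by simp
qed

lemma eq_e_I:
  assumes "\<And>x. V1 x \<Longrightarrow> u \<bullet> x = 0" "\<And>x. V2 x \<Longrightarrow> u \<bullet> x = 0" "\<And>x. V3 x \<Longrightarrow> u \<bullet> x = 0"
  shows "u = (u \<bullet> e) *\<^sub>R e"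
proof -
  let ?v = "u - (u \<bullet> e) *\<^sub>R e"
  have v: "?v \<bullet> e = 0" by (simp add: inner_diff_left inner_e)
  have perp: "?v \<bullet> x = 0" if "V1 x \<or> V2 x \<or> V3 x" for x
    using that assms V_e(2) by (auto simp: inner_diff_left)
  obtain x y z where V: "V1 x" "V2 y" "V3 z" "?v = x + y + z"
    "?v \<bullet> x = x \<bullet> x" "?v \<bullet> y = y \<bullet> y" "?v \<bullet> z = z \<bullet> z" using V_components[OF v] .
  have "x = 0" "y = 0" "z = 0" using V(5-7) perp V(1-3) by simp_all
  then show ?thesis using V(4) by simp
qed

text \<open>The coefficient of \<open>s^2\<close> in \<open>quartic_identity\<close> at
  \<open>x + s *\<^sub>R u\<close>, that is, its polarisation of bidegree (2,2).\<close>

lemma quartic_coeff: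
  assumes x: "x \<bullet> e = 0" and u: "u \<bullet> e = 0"
  shows "4 * F e (x \<star> u) (x \<star> u) + 2 * F e (x \<star> x) (u \<star> u)
      + 4 * ((x \<star> (e \<star> x)) \<bullet> (u \<star> u) + 2 * ((x \<star> (e \<star> u) + u \<star> (e \<star> x)) \<bullet> (x \<star> u)) + (u \<star> (e \<star> u)) \<bullet>
          (x \<star> x))
    = 108 * ((x \<bullet> x) * F e u u + 4 * (x \<bullet> u) * F e x u + (u \<bullet> u) * F e x x)"
proof -
  define X M U where "X = x \<star> x" and "M = x \<star> u" and "U = u \<star> u"
  define p0 p1 p2 where "p0 = x \<star> (e \<star> x)" and "p1 = x \<star> (e \<star> u) + u \<star> (e \<star> x)" and "p2 = u \<star> (e \<star> u)"
  define c0 where "c0 = F e X X + 4 * (p0 \<bullet> X) - 108 * ((x \<bullet> x) * F e x x)"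
  define c1 where "c1 = 4 * F e X M + 4 * (2 * (p0 \<bullet> M) + p1 \<bullet> X)
    - 108 * ((x \<bullet> x) * (2 * F e x u) + 2 * (x \<bullet> u) * F e x x)"
  define c2 where "c2 = 4 * F e M M + 2 * F e X U + 4 * (p0 \<bullet> U + 2 * (p1 \<bullet> M) + p2 \<bullet> X)
    - 108 * ((x \<bullet> x) * F e u u + 4 * (x \<bullet> u) * F e x u + (u \<bullet> u) * F e x x)"
  define c3 where "c3 = 4 * F e M U + 4 * (p1 \<bullet> U + 2 * (p2 \<bullet> M))
    - 108 * (2 * (x \<bullet> u) * F e u u + (u \<bullet> u) * (2 * F e x u))"
  define c4 where "c4 = F e U U + 4 * (p2 \<bullet> U) - 108 * ((u \<bullet> u) * F e u u)"
  have main: "c0 + s * c1 + s^2 * c2 + s^3 * c3 + s^4 * c4 + s^5 * 0 = 0" for s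
  proof -
    let ?w = "x + s *\<^sub>R u"
    have t: "(2 * s) *\<^sub>R M = s *\<^sub>R M + s *\<^sub>R M" by (simp flip: scaleR_add_left)
    have W: "?w \<star> ?w = X + (2 * s) *\<^sub>R M + s^2 *\<^sub>R U"
      unfolding t
      by (simp add: X_def M_def U_def star_expand commute[of u x] power2_eq_square add.assoc
        scaleR_add_right)
    have P: "?w \<star> (e \<star> ?w) = p0 + s *\<^sub>R p1 + s^2 *\<^sub>R p2"
      by (simp add: p0_def p1_def p2_def star_expand power2_eq_square add.assoc scaleR_add_right)
    have "?w \<bullet> e = 0" using x u by (simp add: inner_add_left)
    from quartic_identity[OF this]
    have "F e (?w \<star> ?w) (?w \<star> ?w) + 4 * ((?w \<star> (e \<star> ?w)) \<bullet> (?w \<star> ?w))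
        - 108 * ((?w \<bullet> ?w) * F e ?w ?w) = 0"
      by simp
    then show ?thesis
      unfolding W P c0_def c1_def c2_def c3_def c4_def
      by (simp add: F_expand inner_add_left inner_add_right inner_commute[of u x] F_swap23[of e u x]
          F_swap23[of e M X] F_swap23[of e U X] F_swap23[of e U M] algebra_simps power_numeral_reduce)
  qed
  from quintic_coeffs_zero(3)[OF main] show ?thesis
    by (simp add: c2_def X_def M_def U_def p0_def p1_def p2_def)
qed

text \<open>Polarising \<open>quartic_coeff\<close> once more, in \<open>u = y + z\<close>, while
  multiplication by \<open>e\<close> acts by scalars on the three arguments. All norms of products
  below are instances of this identity.\<close>

lemma eig_quartic:
  assumes x: "eig a x" and y: "eig b y" and z: "eig c z"
  shows "(e \<star> (x \<star> x) + (2 * a + b + c) *\<^sub>R (x \<star> x)) \<bullet> (y \<star> z)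
      + 2 * ((e \<star> (x \<star> y) + (2 * a + b + c) *\<^sub>R (x \<star> y)) \<bullet> (x \<star> z))
    = 27 * (2 * a + b + c) * ((x \<bullet> x) * (y \<bullet> z) + 2 * ((x \<bullet> y) * (x \<bullet> z)))"
proof -
  note [simp] = V_e(3)[OF x] V_e(3)[OF y] V_e(3)[OF z]
  have perp: "x \<bullet> e = 0" "y \<bullet> e = 0" "z \<bullet> e = 0" "(y + z) \<bullet> e = 0"
    using V_e(1)[OF x] V_e(1)[OF y] V_e(1)[OF z] by (simp_all add: inner_add_left)
  have Fe: "F e x v = a * (x \<bullet> v)" "F e y v = b * (y \<bullet> v)" "F e z v = c * (z \<bullet> v)" for v
    using eig_F[OF x] eig_F[OF y] eig_F[OF z] by blast+
  note q = quartic_coeff[OF perp(1,4)] quartic_coeff[OF perp(1,2)] quartic_coeff[OF perp(1,3)]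
  have sw: "F e (x \<star> z) (x \<star> y) = F e (x \<star> y) (x \<star> z)" by (rule F_swap23)
  have eF: "(e \<star> u) \<bullet> v = F e u v" for u v by (simp add: F_def)
  have "(e \<star> (x \<star> x) + (2 * a + b + c) *\<^sub>R (x \<star> x)) \<bullet> (y \<star> z)
      + 2 * ((e \<star> (x \<star> y) + (2 * a + b + c) *\<^sub>R (x \<star> y)) \<bullet> (x \<star> z))
    = 27 * (2 * a + b + c) * ((x \<bullet> x) * (y \<bullet> z)) + 216 * (a * ((x \<bullet> y) * (x \<bullet> z)))"
    using q unfolding inner_add_left inner_scaleR_left eF
    by (simp add: star_expand F_expand Fe inner_add_left inner_add_right sw commute[of y x]
      commute[of z x]
        commute[of z y] inner_commute[of y x] inner_commute[of z x] inner_commute[of z y]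
        inner_commute[of "x \<star> z" "x \<star> y"] inner_commute[of "y \<star> y" "x \<star> x"]
        inner_commute[of "z \<star> z" "x \<star> x"] inner_commute[of "y \<star> z" "x \<star> x"] algebra_simps)
  \<comment> \<open>Eigenvectors for different eigenvalues are orthogonal, so both sides vanish
    unless the three eigenvalues agree, and then both factors are \<open>216 * a\<close>.\<close>
  moreover have "27 * (2 * a + b + c) * (2 * ((x \<bullet> y) * (x \<bullet> z))) = 216 * (a * ((x \<bullet> y) * (x \<bullet> z)))"
    using eig_perp[OF x y] eig_perp[OF x z] by (cases "a = b"; cases "a = c") simp_all
  ultimately show ?thesis by (simp only: distrib_left)
qed

lemma V11: "V1 x \<Longrightarrow> x \<star> x = (- 6 * (x \<bullet> x)) *\<^sub>R e"
proof -
  assume x: "V1 x"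
  have "x \<star> x = ((x \<star> x) \<bullet> e) *\<^sub>R e"
    by (rule eq_e_I) (use F_selection(1-3)[OF x x] in \<open>auto simp: F_def\<close>)
  moreover have "(x \<star> x) \<bullet> e = - 6 * (x \<bullet> x)"
    using eig_F[OF x, of x] F_swap12[of e x x] F_swap23[of x e x] by (simp add: F_def)
  ultimately show ?thesis by simp
qed

lemma V12:
  assumes x: "V1 x" and y: "V2 y"
  shows "V3 (x \<star> y)"
proof (rule V3_I)
  show "(x \<star> y) \<bullet> e = 0"
    using eig_F[OF x, of y] V_perp(1)[OF x y] F_swap12[of e x y] F_swap23[of x e y] by (simp add: F_def)
  show "(x \<star> y) \<bullet> u = 0" if "V1 u" for u
    using F_selection(2)[OF x that y] F_swap23[of x y u] by (simp add: F_def)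
  show "(x \<star> y) \<bullet> u = 0" if "V2 u" for u
    using F_selection(4)[OF x y that] by (simp add: F_def)
qed

text \<open>In \<open>eig_quartic\<close> the square of \<open>x\<close> is a multiple of
  \<open>e\<close> and \<open>x \<star> y\<close> lies in \<open>V3\<close>, so every term is
  explicit. Multiplication by \<open>x\<close> embeds \<open>V2\<close> into \<open>V3\<close>
  isometrically up to the factor 3 |x|.\<close>

lemma V12_inner:
  assumes x: "V1 x" and y: "V2 y" and z: "V2 z"
  shows "(x \<star> y) \<bullet> (x \<star> z) = 9 * (x \<bullet> x) * (y \<bullet> z)"
proof -
  have "e \<bullet> (y \<star> z) = - 3 * (y \<bullet> z)" using eig_F[OF y, of z] by (simp add: inner_star)
  then show ?thesis
    using eig_quartic[OF x y z] V_e(3)[OF V12[OF x y]] V_perp(1)[OF x y]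
    by (simp add: V11[OF x] star_expand star_e inner_add_left algebra_simps)
qed

text \<open>With the third vector in \<open>V3\<close> the term of \<open>x \<star> x\<close> and
  the right side of \<open>eig_quartic\<close> vanish, while \<open>x \<star> y\<close> enters with
  the factor 3 - 12, which is not zero.\<close>

lemma V112_V3:
  assumes x: "V1 x" and y: "V2 y" and z: "V3 z"
  shows "F x (x \<star> y) z = 0"
proof -
  have "e \<bullet> (y \<star> z) = 0" using eig_F[OF y, of z] V_perp(3)[OF y z] by (simp add: inner_star)
  then have "(x \<star> y) \<bullet> (x \<star> z) = 0"
    using eig_quartic[OF x y z] V_e(3)[OF V12[OF x y]] V_perp(1)[OF x y]  V_perp(3)[OF y z]
    by (simp add: V11[OF x] star_expand star_e inner_add_left algebra_simps)
  then show ?thesis using F_swap12[of x "x \<star> y" z] by (simp add: F_def assoc)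
qed

text \<open>On \<open>V2\<close> the vector \<open>v / 2\<close> is the gradient of
  \<open>F y y y / 6\<close>, so the value of \<open>v \<bullet> v\<close> is an eiconal equation
  for \<psi>030. It is \<open>eig_quartic\<close> with three equal arguments.\<close>

lemma V2_square:
  assumes y: "V2 y"
  obtains v where "V2 v" "y \<star> y = (- 3 * (y \<bullet> y)) *\<^sub>R e + v" "v \<bullet> v = 18 * (y \<bullet> y)^2"
    "\<And>u. V2 u \<Longrightarrow> v \<bullet> u = F y y u"
proof -
  define v where "v = y \<star> y - (- 3 * (y \<bullet> y)) *\<^sub>R e"
  have e: "(y \<star> y) \<bullet> e = - 3 * (y \<bullet> y)"
    using eig_F[OF y, of y] F_swap12[of e y y] F_swap23[of y e y] by (simp add: F_def)
  have ve: "v \<bullet> e = 0" by (simp add: v_def inner_add_left e inner_e)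
  have v: "V2 v"
  proof (rule V2_I[OF ve])
    show "v \<bullet> u = 0" if "V1 u" for u
      using F_selection(4)[OF that y y] F_swap12[of u y y] F_swap23[of y u y] V_e(2)[OF that]
      by (simp add: v_def inner_add_left F_def)
    show "v \<bullet> u = 0" if "V3 u" for u
      using F_selection(5)[OF y y that] V_e(2)[OF that] by (simp add: v_def inner_add_left F_def)
  qed
  have yy: "y \<star> y = (- 3 * (y \<bullet> y)) *\<^sub>R e + v" by (simp add: v_def)
  have "v \<bullet> v = 18 * (y \<bullet> y)^2"
    using eig_quartic[OF y y y] V_e[OF v]
    by (simp add: yy star_expand star_e inner_add_left inner_add_right inner_e algebra_simps
      power2_eq_square)
  moreover have "v \<bullet> u = F y y u" if "V2 u" for u
    using V_e(2)[OF that] by (simp add: v_def F_def inner_add_left)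
  ultimately show ?thesis using that v yy by blast
qed

end

section \<open>The cubic form on \<open>V2\<close> when it vanishes on a hyperplane\<close>

context harmonic_hsiang
begin

lemma V2_polar:
  assumes y: "V2 y" and z: "V2 z" and yz: "y \<bullet> z = 0"
  shows "V2 (y \<star> z)"
proof (rule V2_I)
  show "(y \<star> z) \<bullet> e = 0"
    using eig_F[OF y, of z] yz F_swap12[of e y z] F_swap23[of y e z] by (simp add: F_def)
  show "(y \<star> z) \<bullet> u = 0" if "V1 u" for u
    using F_selection(4)[OF that y z] F_swap12[of u y z] F_swap23[of y u z] by (simp add: F_def)
  show "(y \<star> z) \<bullet> u = 0" if "V3 u" for u
    using F_selection(5)[OF y z that] by (simp add: F_def)
qed

lemma subspace_V2_perp: "subspace {y. V2 y \<and> a \<bullet> y = 0}"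
  unfolding subspace_def
  by (auto simp: eig_add eig_scale inner_add_right) (simp add: eig_def)

text \<open>Restricted to \<open>V2\<close>, the cubic form solves the eiconal equation \<open>V2_square\<close>; if it vanishes on
  a hyperplane, this forces the form \<open>s\<^sup>3 - 3 s |y|\<^sup>2\<close>, up to a constant.\<close>

context
  fixes a assumes a: "V2 a" "norm a = 1" and van: "\<And>y. V2 y \<Longrightarrow> a \<bullet> y = 0 \<Longrightarrow> F y y y = 0"
begin

lemma aa: "a \<bullet> a = 1" using a by (simp add: norm_eq_1)

text \<open>Serves twice: for \<open>y\<close> in the hyperplane, and for \<open>y = a\<close> once
  \<open>hyperplane_F\<close> supplies its second hypothesis.\<close>

lemma square_parallel:
  assumes y: "V2 y" and F: "\<And>u. V2 u \<Longrightarrow> a \<bullet> u = 0 \<Longrightarrow> F y y u = 0"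
  shows "y \<star> y = (- 3 * (y \<bullet> y)) *\<^sub>R e + F y y a *\<^sub>R a" "(F y y a)^2 = 18 * (y \<bullet> y)^2"
proof -
  obtain v where v: "V2 v" "y \<star> y = (- 3 * (y \<bullet> y)) *\<^sub>R e + v" "v \<bullet> v = 18 * (y \<bullet> y)^2"
    "\<And>u. V2 u \<Longrightarrow> v \<bullet> u = F y y u" using V2_square[OF y] by blast
  define u where "u = v - F y y a *\<^sub>R a"
  have u: "V2 u" "a \<bullet> u = 0"
    using eig_add[OF v(1) eig_scale[OF a(1), of "- F y y a"]] v(4)[OF a(1)]
    by (simp_all add: u_def inner_diff_right aa inner_commute)
  have "u \<bullet> u = 0" using v(4)[OF u(1)] u(2) F[OF u]
    by (simp add: u_def inner_diff_left inner_diff_right inner_commute)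
  then have vv: "v = F y y a *\<^sub>R a" by (simp add: u_def)
  show "y \<star> y = (- 3 * (y \<bullet> y)) *\<^sub>R e + F y y a *\<^sub>R a" using v(2) vv by simp
  show "(F y y a)^2 = 18 * (y \<bullet> y)^2" using v(3) unfolding vv by (simp add: aa power2_eq_square)
qed

lemma hyperplane_square:
  assumes y: "V2 y" "a \<bullet> y = 0"
  shows "y \<star> y = (- 3 * (y \<bullet> y)) *\<^sub>R e + F a y y *\<^sub>R a" "(F a y y)^2 = 18 * (y \<bullet> y)^2"
proof -
  have "F y y u = 0" if "V2 u" "a \<bullet> u = 0" for u
    using F_polarise[OF subspace_V2_perp[of a], of y y u] van y that by simp
  from square_parallel[OF y(1) this]
  show "y \<star> y = (- 3 * (y \<bullet> y)) *\<^sub>R e + F a y y *\<^sub>R a" "(F a y y)^2 = 18 * (y \<bullet> y)^2"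
    using F_swap23[of y y a] F_swap12[of a y y] by simp_all
qed

text \<open>The eiconal equation keeps \<open>F a y y\<close> away from zero, so this factor cancels
  from \<open>eig_quartic\<close> at \<open>y\<close>, \<open>y\<close>, \<open>a\<close>.\<close>

lemma hyperplane_F:
  assumes y: "V2 y" "a \<bullet> y = 0"
  shows "F a a y = 0"
proof (cases "y = 0")
  case False
  have "F a y y \<noteq> 0" using hyperplane_square(2)[OF y] False by auto
  moreover have "F a y y * F a a y = 0"
  proof -
    have ye: "y \<bullet> a = 0" using y by (simp add: inner_commute)
    have "e \<bullet> (y \<star> a) = 0" using eig_F[OF y(1), of a] ye by (simp add: inner_star)
    moreover have "a \<bullet> (y \<star> a) = F a a y" by (simp add: inner_star F_swap23)
    ultimately show ?thesis
      using eig_quartic[OF y(1) y(1) a(1)] ye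
      by (simp add: hyperplane_square(1)[OF y] star_expand star_e V_e(3)[OF a(1)] inner_add_left
        inner_diff_left)
        blast
  qed
  ultimately show ?thesis by simp
qed simp

lemma direction_square: "a \<star> a = (- 3) *\<^sub>R e + F a a a *\<^sub>R a" "(F a a a)^2 = 18"
  using square_parallel[OF a(1) hyperplane_F] by (simp_all add: aa)

text \<open>The eiconal equation determines \<open>F a y y\<close> up to sign, and
  \<open>eig_quartic\<close> expresses |a \<star> y|^2 through it. The positive sign would give
  \<open>a \<star> y = 0\<close>, contradicting \<open>F a y y \<noteq> 0\<close>; the negative sign
  is the equality case of Cauchy-Schwarz for \<open>a \<star> y\<close> and
  \<open>y\<close>.\<close>

lemma direction_star:
  assumes y: "V2 y" "a \<bullet> y = 0" and pos: "F a a a = 3 * sqrt 2"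
  shows "a \<star> y = (- 3 * sqrt 2) *\<^sub>R y"
proof -
  define w k where "w = y \<star> a" and "k = F a y y"
  have ya: "y \<bullet> a = 0" using y by (simp add: inner_commute)
  have w: "V2 w" using V2_polar[OF y(1) a(1) ya] by (simp add: w_def)
  have wy: "w \<bullet> y = k" by (simp add: w_def k_def F_def commute)
  have "e \<bullet> (a \<star> a) = - 3" "a \<bullet> (a \<star> a) = 3 * sqrt 2"
    using V_e(2)[OF a(1)] pos by (simp_all add: direction_square(1) inner_add_right inner_diff_right
      inner_e aa V_e(1)[OF a(1)])
  then have ww: "w \<bullet> w = 9 * (y \<bullet> y) - 3 * sqrt 2 * k / 2"
    using eig_quartic[OF y(1) a(1) a(1)] ya V_e(3)[OF w]
    by (simp add: hyperplane_square(1)[OF y] star_expand star_e V_e(3)[OF a(1)] inner_add_left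
      inner_diff_left
        w_def[symmetric] k_def[symmetric] aa algebra_simps)
  have k2: "k^2 = 18 * (y \<bullet> y)^2" using hyperplane_square(2)[OF y] by (simp add: k_def)
  have r: "sqrt 2 * sqrt 2 = (2::real)" by simp
  have k: "k = - 3 * sqrt 2 * (y \<bullet> y)"
  proof (cases "y = 0")
    case True
    then show ?thesis by (simp add: k_def)
  next
    case False
    have "(k - 3 * sqrt 2 * (y \<bullet> y)) * (k + 3 * sqrt 2 * (y \<bullet> y)) = k^2
        - 9 * (sqrt 2 * sqrt 2) * (y \<bullet> y)^2"
      by (simp add: algebra_simps power2_eq_square)
    also have "\<dots> = 0" using k2 by simp
    finally consider "k = 3 * sqrt 2 * (y \<bullet> y)" | "k = - 3 * sqrt 2 * (y \<bullet> y)" by auto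
    then show ?thesis
    proof cases
      case 1
      have "w \<bullet> w = 9 * (y \<bullet> y) - 9 * (sqrt 2 * sqrt 2) * (y \<bullet> y) / 2"
        using ww 1 by simp
      then have "w \<bullet> w = 0" by simp
      then have "k = 0" using wy by simp
      then show ?thesis using 1 False by simp
    qed simp
  qed
  have "(w + (3 * sqrt 2) *\<^sub>R y) \<bullet> (w + (3 * sqrt 2) *\<^sub>R y) = w \<bullet> w + 6 * sqrt 2 * k
      + 9 * (sqrt 2 * sqrt 2) * (y \<bullet> y)"
    using wy by (simp add: inner_add_left inner_add_right inner_commute)
  also have "\<dots> = 9 * (y \<bullet> y) + 9 * (sqrt 2 * sqrt 2) * (y \<bullet> y) / 2
      - 18 * (sqrt 2 * sqrt 2) * (y \<bullet> y) + 9 * (sqrt 2 * sqrt 2) * (y \<bullet> y)"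
    unfolding ww unfolding k by simp
  also have "\<dots> = 0" by simp
  finally have "w + (3 * sqrt 2) *\<^sub>R y = 0" by simp
  then show ?thesis using commute[of y a] by (simp add: w_def eq_neg_iff_add_eq_0)
qed

end

section \<open>Elements of square zero and the kernel of multiplication by one of them\<close>

lemma nil_cube:
  assumes z: "z \<star> z = 0"
  shows "z \<star> (z \<star> (z \<star> y)) = (27 * (z \<bullet> z)) *\<^sub>R (z \<star> y)"
proof -
  define D where "D = (\<lambda>u v. F z (z \<star> u) (z \<star> v) - 27 * (z \<bullet> z) * F z u v)"
  have Fz: "F z z u = 0" for u by (simp add: F_def z)
  \<comment> \<open>Without trace and with \<open>z \<star> z = 0\<close> the coefficient of
    \<open>s^2\<close> at \<open>z + s *\<^sub>R u\<close> reduces to one term with factor -4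
    against one with factor \<open>36 * \<tau>\<close>; for \<open>\<tau> = - 3\<close> the quotient
    is 27.\<close>
  have diag: "D u u = 0" for u
    using hsiang_coeffs(2)[where p = z and q = u] z by (simp add: tr_zero D_def Fz)
  have "D u v = 0" for u v
  proof -
    have "D (u + v) (u + v) = D u u + 2 * D u v + D v v"
      by (simp add: D_def star_expand F_expand F_swap23[of z "z \<star> v"
        "z \<star> u"] F_swap23[of z v u] algebra_simps)
    then show ?thesis by (simp add: diag)
  qed
  then have "(z \<star> (z \<star> (z \<star> y)) - (27 * (z \<bullet> z)) *\<^sub>R (z \<star> y)) \<bullet> v = 0" for v
  proof -
    have "(z \<star> (z \<star> (z \<star> y))) \<bullet> v = F z (z \<star> y) (z \<star> v)"
      using assoc[of "z \<star> (z \<star> y)" z v] by (simp add: F_def commute[of z "z \<star> (z \<star> y)"])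
    then show ?thesis using \<open>\<And>u v. D u v = 0\<close>[of y v] by (simp add: D_def F_def inner_diff_left)
  qed
  then show ?thesis by (metis inner_eq_zero_iff right_minus_eq)
qed

lemma nil_cubic:
  assumes z: "z \<star> z = 0"
  shows "F z (z \<star> y) (y \<star> y) + F y (z \<star> y) (z \<star> y)
    = 9 * ((z \<bullet> z) * F y y y + 6 * (z \<bullet> y) * F z y y)"
proof -
  have Fz: "F z z u = 0" for u by (simp add: F_def z)
  show ?thesis
    using hsiang_coeffs(3)[where p = z and q = y] z by (simp add: tr_zero Fz)
qed

text \<open>In a Clifford algebra with \<open>e = z + y\<close>, where \<open>z \<in> Z\<close> and \<open>y \<in> Y\<close>, the vector \<open>a\<close> below is a
  multiple of \<open>2 z - y\<close>; hence \<open>z\<^sub>0\<close> and \<open>y\<^sub>0\<close> are multiples of \<open>z\<close> and \<open>y\<close>.\<close>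

context
  fixes a assumes a: "V2 a" "norm a = 1" and a_star: "a \<star> a = (- 3) *\<^sub>R e + (3 * sqrt 2) *\<^sub>R a"
    and a_perp: "\<And>y. V2 y \<Longrightarrow> a \<bullet> y = 0 \<Longrightarrow> a \<star> y = (- 3 * sqrt 2) *\<^sub>R y"
begin

definition z0 :: 'a where "z0 = e + sqrt 2 *\<^sub>R a"
definition y0 :: 'a where "y0 = sqrt 2 *\<^sub>R e - a"
definition Z :: "'a set" where "Z = {x. z0 \<star> x = 0}"
definition Y :: "'a set" where "Y = {y. \<forall>z\<in>Z. z \<bullet> y = 0}"

lemma a_inner: "a \<bullet> a = 1" "a \<bullet> e = 0" "e \<bullet> a = 0" "e \<star> a = (- 3) *\<^sub>R a" "a \<star> e = (- 3) *\<^sub>R a"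
  using a V_e[OF a(1)] commute[of a e] by (simp_all add: norm_eq_1)

lemma z0_z0: "z0 \<star> z0 = 0"
  by (simp add: z0_def star_expand star_e a_inner a_star algebra_simps flip: scaleR_add_left)

lemma z0_y0: "z0 \<star> y0 = 9 *\<^sub>R y0"
  by (simp add: z0_def y0_def star_expand star_e a_inner a_star algebra_simps flip: scaleR_add_left)

lemma z0_inner: "z0 \<bullet> z0 = 3"
  by (simp add: z0_def inner_add_left inner_add_right inner_e a_inner)

lemma subspace_Z: "subspace Z"
  by (simp add: Z_def subspace_def star_expand)

lemma subspace_Y: "subspace Y"
  by (simp add: Y_def subspace_def inner_add_right)

lemma z0_Z: "z0 \<in> Z"
  by (simp add: Z_def z0_z0)

lemma star_z0_Y: "z0 \<star> u \<in> Y"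
proof -
  have "z \<bullet> (z0 \<star> u) = 0" if "z \<in> Z" for z
    using that F_swap23[of z0 u z] F_swap23[of z z0 u] by (simp add: Z_def F_def inner_commute)
  then show ?thesis by (simp add: Y_def)
qed

lemma z0_sq: "z0 \<star> (z0 \<star> (z0 \<star> u)) = 81 *\<^sub>R (z0 \<star> u)"
  using nil_cube[OF z0_z0, of u] by (simp add: z0_inner)

lemma z0_sq_Y:
  assumes "y \<in> Y"
  shows "z0 \<star> (z0 \<star> y) = 81 *\<^sub>R y"
proof -
  let ?w = "z0 \<star> (z0 \<star> y) - 81 *\<^sub>R y"
  have "?w \<in> Z" by (simp add: Z_def star_expand z0_sq)
  moreover have "?w \<in> Y" using star_z0_Y assms subspace_Y by (simp add: subspace_diff subspace_scale)
  ultimately have "?w \<bullet> ?w = 0" by (simp add: Y_def)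
  then show ?thesis by simp
qed

lemma Z_Y_decomp: "\<exists>z\<in>Z. \<exists>y\<in>Y. x = z + y"
proof -
  have "x - (1 / 81) *\<^sub>R (z0 \<star> (z0 \<star> x)) \<in> Z" by (simp add: Z_def star_expand z0_sq)
  moreover have "(1 / 81) *\<^sub>R (z0 \<star> (z0 \<star> x)) \<in> Y" using star_z0_Y subspace_Y
      by (simp add: subspace_scale)
  moreover have "x = (x - (1 / 81) *\<^sub>R (z0 \<star> (z0 \<star> x))) + (1 / 81) *\<^sub>R (z0 \<star> (z0 \<star> x))" by simp
  ultimately show ?thesis by blast
qed

text \<open>On \<open>Y\<close> multiplication by \<open>z0\<close> has eigenvalues 9 and -9, with
  components \<open>p\<close> and \<open>q\<close> of \<open>y\<close>. The relation
  \<open>rel\<close> multiplies \<open>F p p p\<close> by 81 on one side and by -54 on the other, so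
  it vanishes, and so does \<open>F q q q\<close>. For \<open>p + q\<close> it compares the factors
  -81 and -162 of \<open>F p p q + F p q q\<close>.\<close>

lemma F_YYY_diag:
  assumes y: "y \<in> Y"
  shows "F y y y = 0"
proof -
  have rel: "F u (z0 \<star> u) (z0 \<star> u) = - 54 * F u u u" if u: "u \<in> Y" for u
  proof -
    have "F z0 (z0 \<star> u) (u \<star> u) = 81 * F u u u"
      unfolding F_def[of z0] z0_sq_Y[OF u] by (simp add: inner_star F_expand)
    moreover have "z0 \<bullet> u = 0" using u z0_Z by (simp add: Y_def)
    ultimately show ?thesis using nil_cubic[OF z0_z0, of u] by (simp add: z0_inner)
  qed
  define p q where "p = (1 / 2) *\<^sub>R (y + (1 / 9) *\<^sub>R (z0 \<star> y))"
      and "q = (1 / 2) *\<^sub>R (y - (1 / 9) *\<^sub>R (z0 \<star> y))"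
  have pq: "y = p + q" by (simp add: p_def q_def algebra_simps flip: scaleR_add_left)
  have Y: "p \<in> Y" "q \<in> Y" unfolding p_def q_def
    using y star_z0_Y subspace_Y by (simp_all add: subspace_add subspace_diff subspace_scale)
  have z: "z0 \<star> p = 9 *\<^sub>R p" "z0 \<star> q = - (9 *\<^sub>R q)"
    by (simp_all add: p_def q_def star_expand z0_sq_Y[OF y] algebra_simps)
  have "F p p p = 0" "F q q q = 0"
    using rel[OF Y(1)] rel[OF Y(2)] by (simp_all add: z F_expand)
  moreover have "F (p + q) (z0 \<star> (p + q)) (z0 \<star> (p + q)) = - 54 * F (p + q) (p + q) (p + q)"
    using rel[of "p + q"] y pq by simp
  ultimately show ?thesis
    unfolding pq by (simp add: star_expand z F_expand F_swap12[of q p] F_swap23[of _ q p])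
qed

lemma F_YYY: "x \<in> Y \<Longrightarrow> y \<in> Y \<Longrightarrow> z \<in> Y \<Longrightarrow> F x y z = 0"
  by (rule F_polarise[OF subspace_Y F_YYY_diag])

text \<open>Such a \<open>w\<close> is orthogonal to \<open>z0\<close> and \<open>y0\<close>, hence
  to \<open>e\<close> and \<open>a\<close>. On the part of \<open>V2\<close> orthogonal to
  \<open>a\<close>, \<open>z0\<close> acts as -9, so \<open>w\<close> has no component there. The
  two values of \<open>F\<close> are displayed as nonnegative multiples of one square, which
  prepares the trace argument.\<close>

lemma Z_components:
  assumes w: "w \<in> Z" "w \<bullet> z0 = 0"
  obtains x z where "V1 x" "V3 z" "w = x + z" "F y0 w w = 9 / sqrt 2 * ((z
      - (sqrt 2 / 3) *\<^sub>R (a \<star> x)) \<bullet> (z - (sqrt 2 / 3) *\<^sub>R (a \<star> x)))"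
    "F e w w = 3 * ((z - (sqrt 2 / 3) *\<^sub>R (a \<star> x)) \<bullet> (z - (sqrt 2 / 3) *\<^sub>R (a \<star> x)))"
proof -
  have zw: "z0 \<star> w = 0" using w by (simp add: Z_def)
  then have wz: "(z0 \<star> u) \<bullet> w = 0" for u
    using F_swap23[of z0 u w] by (simp add: F_def)
  have "y0 \<bullet> w = 0" using wz[of y0] by (simp add: z0_y0)
  moreover have "w \<bullet> e + sqrt 2 * (w \<bullet> a) = 0" using w(2) by (simp add: z0_def inner_add_right)
  moreover have "sqrt 2 * (w \<bullet> e) - w \<bullet> a = 0"
    using calculation(1) by (simp add: y0_def inner_diff_left inner_commute[of w])
  moreover have "3 * (w \<bullet> e) = (w \<bullet> e + sqrt 2 * (w \<bullet> a)) + sqrt 2 * (sqrt 2 * (w \<bullet> e) - w \<bullet> a)"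
    by (simp add: algebra_simps)
  ultimately have we: "w \<bullet> e = 0" "w \<bullet> a = 0" by simp_all
  obtain x y z where V: "V1 x" "V2 y" "V3 z" and wxyz: "w = x + y + z" using V_decomp[OF we(1)] .
  have "a \<bullet> y = 0"
    using we(2) V_perp(1)[OF V(1) a(1)] V_perp(3)[OF a(1) V(3)] unfolding wxyz
    by (simp add: inner_add_left inner_commute[of z a] inner_commute[of y a])
  then have "z0 \<star> y = - 9 *\<^sub>R y"
    using a_perp[OF V(2)] V_e(3)[OF V(2)]
      by (simp add: z0_def star_expand algebra_simps flip: scaleR_add_left)
  then have "y \<bullet> w = 0" using wz[of y] by simp
  then have "y \<bullet> y = 0"
    using V_perp(1)[OF V(1,2)] V_perp(3)[OF V(2,3)] unfolding wxyz
    by (simp add: inner_add_right inner_commute[of y x])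
  then have wxz: "w = x + z" using wxyz by simp
  define A where "A = a \<star> x"
  have xz: "x \<bullet> z = 0" "z \<bullet> x = 0" using V_perp(2)[OF V(1,3)] by (simp_all add: inner_commute)
  have AA: "A \<bullet> A = 9 * (x \<bullet> x)"
    using V12_inner[OF V(1) a(1) a(1)] a_inner commute[of a x] by (simp add: A_def)
  have "A \<bullet> x = 0" using F_selection(2)[OF V(1,1) a(1)] F_swap12[of a x x] F_swap23[of x a x]
    by (simp add: A_def F_def)
  have "(z0 \<star> w) \<bullet> x = 0" by (simp add: zw)
  \<comment> \<open>Pairing \<open>z0 \<star> w = 0\<close> with \<open>x\<close> ties the
    \<open>V3\<close> component to the \<open>V1\<close> component.\<close>
  then have Az: "sqrt 2 * (z \<bullet> A) = 6 * (x \<bullet> x)"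
    using \<open>A \<bullet> x = 0\<close> F_swap23[of a z x]  V_e(3)[OF V(1)] V_e(3)[OF V(3)] xz
    unfolding wxz by (simp add: z0_def star_expand inner_add_left inner_diff_left A_def F_def
        inner_commute[of z "a \<star> x"])
  have Fe: "F e w w = - 6 * (x \<bullet> x) + 3 * (z \<bullet> z)"
    using xz V_e(3)[OF V(1)] V_e(3)[OF V(3)] unfolding wxz F_def
    by (simp add: star_expand inner_add_left inner_add_right inner_diff_left)
  \<comment> \<open>The coefficient \<open>sqrt 2 / 3\<close> completes the square: with
    \<open>Az\<close> and \<open>AA\<close> the result is one third of
    \<open>F e w w\<close>.\<close>
  have "(z - (sqrt 2 / 3) *\<^sub>R A) \<bullet> (z - (sqrt 2 / 3) *\<^sub>R A) = z \<bullet> z - 2 / 3 * (sqrt 2 * (z \<bullet> A))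
      + 2 / 9 * (A \<bullet> A)"
    by (simp add: inner_diff_left inner_diff_right inner_commute[of A z] algebra_simps)
  also have "\<dots> = z \<bullet> z - 2 * (x \<bullet> x)" unfolding Az AA by simp
  finally have Fe': "F e w w = 3 * ((z - (sqrt 2 / 3) *\<^sub>R A) \<bullet> (z - (sqrt 2 / 3) *\<^sub>R A))"
    using Fe by simp
  have "F z0 w w = 0" by (simp add: F_def zw)
  then have "F e w w + sqrt 2 * F a w w = 0" by (simp add: z0_def F_expand)
  moreover have "sqrt 2 * F y0 w w = 2 * F e w w - sqrt 2 * F a w w"
    by (simp add: y0_def F_expand algebra_simps)
  ultimately have "sqrt 2 * F y0 w w = 3 * F e w w" by simp
  then have "F y0 w w = 3 / sqrt 2 * F e w w" by (simp add: field_simps)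
  then show ?thesis using that[OF V(1,3) wxz] Fe' by (simp add: A_def)
qed

lemma y0_Y: "y0 \<in> Y"
  using star_z0_Y[of "(1 / 9) *\<^sub>R y0"] by (simp add: star_expand z0_y0)

text \<open>The component of \<open>w\<close> along \<open>z0\<close> does not contribute, since
  \<open>z0\<close> annihilates \<open>Z\<close>; the rest is a multiple of a square by
  \<open>Z_components\<close>.\<close>

lemma F_y0_nonneg:
  assumes w: "w \<in> Z"
  shows "F y0 w w \<ge> 0"
proof -
  define s where "s = (w \<bullet> z0) / 3"
  define u where "u = w - s *\<^sub>R z0"
  have u: "u \<in> Z" "u \<bullet> z0 = 0"
    using w z0_Z subspace_Z
    by (simp_all add: u_def s_def subspace_diff subspace_scale inner_diff_left z0_inner)
  have wu: "w = u + s *\<^sub>R z0" by (simp add: u_def)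
  have "F y0 z0 v = 0" if "v \<in> Z" for v
  proof -
    have "z0 \<star> v = 0" using that by (simp add: Z_def)
    then show ?thesis using F_swap12[of y0 z0 v] F_swap23[of z0 y0 v] by (simp add: F_def)
  qed
  then have "F y0 w w = F y0 u u"
    using u(1) z0_Z F_swap23[of y0 u z0] unfolding wu by (simp add: F_expand)
  moreover obtain x z where "F y0 u u = 9 / sqrt 2 * ((z - (sqrt 2 / 3) *\<^sub>R (a \<star> x)) \<bullet> (z
      - (sqrt 2 / 3) *\<^sub>R (a \<star> x)))"
    using Z_components[OF u] by blast
  ultimately show ?thesis by simp
qed

text \<open>The quadratic form of \<open>y\<^sub>0\<close> is nonnegative on \<open>Z\<close>, vanishes on \<open>Y\<close>, and has trace zero.\<close>

lemma F_y0_Z: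
  assumes w: "w \<in> Z" "norm w = 1"
  shows "F y0 w w = 0"
proof -
  define W where "W = {z \<in> Z. z \<bullet> w = 0}"
  have "subspace W" using subspace_Z by (simp add: W_def subspace_def inner_add_left)
  then obtain B1 where B1: "B1 \<subseteq> W" "pairwise orthogonal B1" "\<And>x. x \<in> B1 \<Longrightarrow> norm x = 1"
    "independent B1" "card B1 = dim W" "span B1 = W" using orthonormal_basis_subspace by metis
  obtain B2 where B2: "B2 \<subseteq> Y" "pairwise orthogonal B2" "\<And>x. x \<in> B2 \<Longrightarrow> norm x = 1"
    "independent B2" "card B2 = dim Y" "span B2 = Y" using orthonormal_basis_subspace[OF subspace_Y]
        by metis
  have fin: "finite B1" "finite B2" using B1(4) B2(4) by (simp_all add: independent_imp_finite)
  have ww: "w \<bullet> w = 1" using w(2) by (simp add: norm_eq_1)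
  let ?C = "insert w B1"
  have C: "?C \<subseteq> Z" "pairwise orthogonal ?C" "\<And>b. b \<in> ?C \<Longrightarrow> norm b = 1" "finite ?C"
    using B1(1-3) w fin by (auto simp: W_def pairwise_insert orthogonal_def inner_commute)
  have "w \<notin> B1" using B1(1) ww by (auto simp: W_def)
  have spC: "span ?C = Z"
  proof
    show "span ?C \<subseteq> Z" using C(1) subspace_Z by (rule span_minimal)
    show "Z \<subseteq> span ?C"
    proof
      fix z assume "z \<in> Z"
      then have "z - (z \<bullet> w) *\<^sub>R w \<in> span B1"
        unfolding B1(6) using w(1) subspace_Z
          by (simp add: W_def subspace_diff subspace_scale inner_diff_left ww)
      then show "z \<in> span ?C" using span_breakdown_eq by blast
    qed
  qed
  have ZY: "z \<bullet> y = 0" if "z \<in> Z" "y \<in> Y" for z y using that by (simp add: Y_def)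
  note un = orthonormal_basis_Un[OF C spC B2(1-3) fin(2) B2(6) ZY Z_Y_decomp]
  have "(\<Sum>b\<in>?C \<union> B2. F y0 b b) = 0"
    using tr_orthonormal_basis[OF un(2) _ _ un(3), of y0] C(3) B2(3) fin tr_zero[of y0] by auto
  moreover have "(\<Sum>b\<in>B2. F y0 b b) = 0"
    using F_YYY[OF y0_Y] B2(1) by (intro sum.neutral) blast
  moreover have "(\<Sum>b\<in>?C \<union> B2. F y0 b b) = (\<Sum>b\<in>?C. F y0 b b) + (\<Sum>b\<in>B2. F y0 b b)"
    using fin un(1) by (intro sum.union_disjoint) auto
  moreover have "(\<Sum>b\<in>?C. F y0 b b) = F y0 w w + (\<Sum>b\<in>B1. F y0 b b)"
    using fin \<open>w \<notin> B1\<close> by simp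
  moreover have "(\<Sum>b\<in>B1. F y0 b b) \<ge> 0" using F_y0_nonneg C(1) by (intro sum_nonneg) blast
  ultimately show ?thesis using F_y0_nonneg[OF w(1)] by linarith
qed

lemma F_y0_Z': "w \<in> Z \<Longrightarrow> F y0 w w = 0"
proof (cases "w = 0")
  case False
  assume w: "w \<in> Z"
  have "(1 / norm w) *\<^sub>R w \<in> Z" using w subspace_Z by (simp add: subspace_scale)
  from F_y0_Z[OF this] show ?thesis using False by (simp add: F_expand)
qed simp

text \<open>As \<open>F y0 w w\<close> is zero, the square in \<open>Z_components\<close> vanishes,
  so \<open>w = x + r *\<^sub>R A\<close> is determined by its \<open>V1\<close> component. It
  remains to pair \<open>w \<star> w\<close> with each eigenspace and with \<open>e\<close>.\<close>

lemma Z_square_perp: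
  assumes w: "w \<in> Z" "w \<bullet> z0 = 0"
  shows "w \<star> w = 0"
proof -
  define r where "r = sqrt 2 / 3"
  obtain x z where x: "V1 x" and z: "V3 z" and wxz: "w = x + z"
    and n: "F y0 w w = 9 / sqrt 2 * ((z - (sqrt 2 / 3) *\<^sub>R (a \<star> x)) \<bullet> (z - (sqrt 2 / 3) *\<^sub>R (a \<star> x)))"
    and Fe: "F e w w = 3 * ((z - (sqrt 2 / 3) *\<^sub>R (a \<star> x)) \<bullet> (z - (sqrt 2 / 3) *\<^sub>R (a \<star> x)))"
    using Z_components[OF w] by blast
  define A where "A = x \<star> a"
  have zA: "z = r *\<^sub>R A" using n F_y0_Z'[OF w(1)] by (simp add: A_def r_def commute[of x a])
  have Few: "F e w w = 0" using Fe zA by (simp add: A_def r_def commute[of x a])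
  have A: "V3 A" using V12[OF x a(1)] by (simp add: A_def)
  have wA: "w = x + r *\<^sub>R A" using wxz zA by simp
  have F3: "F x A u = 0" if "V3 u" for u using V112_V3[OF x a(1) that] by (simp add: A_def)
  have sq: "F w w u = F x x u + 2 * r * F x A u + r^2 * F A A u" for u
    unfolding wA by (simp add: F_expand F_swap12[of A x] power2_eq_square algebra_simps)
  have 1: "F w w u = 0" if u: "V1 u" for u
  proof -
    \<comment> \<open>Linearising \<open>V112_V3\<close> in its \<open>V1\<close> argument leaves
      \<open>F u A A\<close> as the only surviving term.\<close>
    have "F (x + u) ((x + u) \<star> a) A = 0" using V112_V3[OF eig_add[OF x u] a(1) A] .
    moreover have "F x (x \<star> a) A = 0" "F u (u \<star> a) A = 0" "F x (u \<star> a) A = 0"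
      using V112_V3[OF x a(1) A] V112_V3[OF u a(1) A] F3[OF V12[OF u a(1)]] F_swap23[of x A "u \<star> a"]
      by simp_all
    ultimately have "F u A A = 0" by (simp add: star_expand F_expand A_def)
    moreover have "F x x u = 0" "F x A u = 0"
      using F_selection(1)[OF x x u] F_selection(3)[OF x u A] F_swap23[of x A u] by simp_all
    ultimately show ?thesis unfolding sq using F_swap23[of A A u] F_swap12[of A u A] by simp
  qed
  have 3: "F w w u = 0" if u: "V3 u" for u
    unfolding sq using F_selection(3)[OF x x u] F3[OF u] F_selection(6)[OF A A u] by simp
  have zw: "z0 \<star> w = 0" using w by (simp add: Z_def)
  then have "F z0 w w = 0" by (simp add: F_def)
  then have Fa: "F a w w = 0" using Few by (simp add: z0_def F_expand)
  have rr: "sqrt 2 * r = 2 / 3" "3 * r = sqrt 2" "r \<noteq> 0" by (simp_all add: r_def)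
  \<comment> \<open>This is \<open>z0 \<star> w = 0\<close> solved for the product of
    \<open>A\<close> and \<open>a\<close>.\<close>
  have aA: "A \<star> a = 9 *\<^sub>R x - (3 * sqrt 2) *\<^sub>R A"
  proof -
    have "0 = z0 \<star> w" using zw by simp
    also have "z0 \<star> w = - 6 *\<^sub>R x + (3 * r) *\<^sub>R A + sqrt 2 *\<^sub>R A + (sqrt 2 * r) *\<^sub>R (A \<star> a)"
      unfolding z0_def wA
      by (simp add: star_expand V_e(3)[OF x] V_e(3)[OF A] commute[of a A] A_def[symmetric]
        commute[of a x]
          algebra_simps)
    also have "\<dots> = (2 / 3) *\<^sub>R (A \<star> a - (9 *\<^sub>R x - (3 * sqrt 2) *\<^sub>R A))"
      unfolding rr by (simp add: algebra_simps flip: scaleR_add_left)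
    finally show ?thesis by simp
  qed
  have 2: "F w w u = 0" if u: "V2 u" for u
  proof -
    define v where "v = u - (a \<bullet> u) *\<^sub>R a"
    have v: "V2 v" "a \<bullet> v = 0"
      using eig_add[OF u eig_scale[OF a(1), of "- (a \<bullet> u)"]] a_inner
      by (simp_all add: v_def inner_diff_right)
    have xAv: "F x A v = 0"
      using V12_inner[OF x a(1) v(1)] v(2) F_swap23[of x A v] inner_commute[of A "x \<star> v"]
      by (simp add: A_def F_def)
    \<comment> \<open>For the eigenvalues 3, -3, -3 the weight \<open>2 * a + b + c\<close> of
      \<open>eig_quartic\<close> is zero, so only the terms with \<open>e\<close> remain. They
      contribute 9 sqrt 2 and -18 sqrt 2 times \<open>F A A v\<close>.\<close>
    have "(e \<star> (A \<star> A)) \<bullet> (a \<star> v) + 2 * ((e \<star> (A \<star> a)) \<bullet> (A \<star> v)) = 0"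
      using eig_quartic[OF A a(1) v(1)] by simp
    moreover have "(e \<star> (A \<star> A)) \<bullet> (a \<star> v) = 9 * sqrt 2 * F A A v"
    proof -
      have "(e \<star> (A \<star> A)) \<bullet> v = (A \<star> A) \<bullet> (e \<star> v)" using assoc[of "A \<star> A" e v] by (simp add: commute)
      then show ?thesis using a_perp[OF v] V_e(3)[OF v(1)] by (simp add: F_def)
    qed
    moreover have "(e \<star> (A \<star> a)) \<bullet> (A \<star> v) = - 9 * sqrt 2 * F A A v"
    proof -
      have "x \<bullet> (A \<star> v) = 0" "A \<bullet> (A \<star> v) = F A A v" using xAv by (simp_all add: inner_star)
      then show ?thesis unfolding aA by (simp add: star_expand V_e(3)[OF x] V_e(3)[OF A] inner_diff_left)
    qed
    ultimately have "F A A v = 0" by simp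
    then have "F w w v = 0" unfolding sq using F_selection(2)[OF x x v(1)] xAv by simp
    moreover have "F w w a = 0" using Fa F_swap12[of a w w] F_swap23[of w a w] by simp
    moreover have "u = v + (a \<bullet> u) *\<^sub>R a" by (simp add: v_def)
    ultimately show ?thesis by (metis F_expand(3,12) add_0 mult_zero_right)
  qed
  have "w \<star> w = ((w \<star> w) \<bullet> e) *\<^sub>R e"
    by (rule eq_e_I) (use 1 2 3 in \<open>simp_all add: F_def\<close>)
  moreover have "(w \<star> w) \<bullet> e = 0"
    using Few F_swap12[of e w w] F_swap23[of w e w] by (simp add: F_def)
  ultimately show ?thesis by simp
qed

lemma Z_star_Z: "z \<in> Z \<Longrightarrow> z' \<in> Z \<Longrightarrow> z \<star> z' = 0"
proof -
  have sq: "w \<star> w = 0" if w: "w \<in> Z" for w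
  proof -
    define s where "s = (w \<bullet> z0) / 3"
    define u where "u = w - s *\<^sub>R z0"
    have u: "u \<in> Z" "u \<bullet> z0 = 0"
      using w z0_Z subspace_Z
      by (simp_all add: u_def s_def subspace_diff subspace_scale inner_diff_left z0_inner)
    have wu: "w = u + s *\<^sub>R z0" by (simp add: u_def)
    have "z0 \<star> u = 0" using u(1) by (simp add: Z_def)
    then show ?thesis
      unfolding wu by (simp add: star_expand Z_square_perp[OF u] z0_z0 commute[of u z0])
  qed
  assume z: "z \<in> Z" "z' \<in> Z"
  have "(z + z') \<star> (z + z') = 0" using z subspace_Z by (simp add: sq subspace_add)
  then have "2 *\<^sub>R (z \<star> z') = 0" using z by (simp add: star_expand sq commute[of z' z] scaleR_2)
  then show ?thesis by simp
qed

lemma Z_star_Y: "z \<in> Z \<Longrightarrow> z \<star> u \<in> Y"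
proof -
  assume z: "z \<in> Z"
  have "z' \<bullet> (z \<star> u) = 0" if "z' \<in> Z" for z'
    using Z_star_Z[OF that z] by (simp add: inner_star F_def)
  then show ?thesis by (simp add: Y_def)
qed

text \<open>Every \<open>z0 + s *\<^sub>R w\<close> lies in \<open>Z\<close> and so has square zero;
  \<open>nil_cube\<close> becomes an identity in \<open>s\<close>, read off here in degrees one and
  two.\<close>

lemma nil_cube_polar:
  assumes w: "w \<in> Z" "w \<bullet> z0 = 0"
  shows "z0 \<star> (z0 \<star> (w \<star> y)) + z0 \<star> (w \<star> (z0 \<star> y)) + w \<star> (z0 \<star> (z0 \<star> y)) = 81 *\<^sub>R (w \<star> y)"
    and "z0 \<star> (w \<star> (w \<star> y)) + w \<star> (z0 \<star> (w \<star> y)) + w \<star> (w \<star> (z0 \<star> y)) = (27 * (w \<bullet> w)) *\<^sub>R (z0 \<star> y)"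
proof -
  let ?E1 = "z0 \<star> (z0 \<star> (w \<star> y)) + z0 \<star> (w \<star> (z0 \<star> y)) + w \<star> (z0 \<star> (z0 \<star> y)) - 81 *\<^sub>R (w \<star> y)"
  let ?E2 = "z0 \<star> (w \<star> (w \<star> y)) + w \<star> (z0 \<star> (w \<star> y)) + w \<star> (w \<star> (z0 \<star> y)) - (27 * (w \<bullet> w)) *\<^sub>R (z0 \<star> y)"
  have ww: "w \<star> w = 0" using Z_star_Z w by blast
  have main: "0 + s * (?E1 \<bullet> v) + s^2 * (?E2 \<bullet> v) + s^3 * 0 + s^4 * 0 + s^5 * 0 = 0" for s v
  proof -
    let ?u = "z0 + s *\<^sub>R w"
    have "?u \<in> Z" using w z0_Z subspace_Z by (simp add: subspace_add subspace_scale)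
    then have "?u \<star> ?u = 0" using Z_star_Z by blast
    from nil_cube[OF this, of y]
    have "?u \<star> (?u \<star> (?u \<star> y)) - (27 * (?u \<bullet> ?u)) *\<^sub>R (?u \<star> y) = 0" by simp
    moreover have "?u \<bullet> ?u = 3 + s^2 * (w \<bullet> w)"
      using w(2) by (simp add: inner_add_left inner_add_right z0_inner inner_commute[of z0 w]
        power2_eq_square)
    moreover have "?u \<star> (?u \<star> (?u \<star> y)) - (27 * (3 + s^2 * (w \<bullet> w))) *\<^sub>R (?u \<star> y)
      = (z0 \<star> (z0 \<star> (z0 \<star> y)) - 81 *\<^sub>R (z0 \<star> y)) + s *\<^sub>R ?E1 + s^2 *\<^sub>R ?E2
        + s^3 *\<^sub>R (w \<star> (w \<star> (w \<star> y)) - (27 * (w \<bullet> w)) *\<^sub>R (w \<star> y))"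
      by (simp add: star_expand algebra_simps power2_eq_square power3_eq_cube)
    ultimately have "s *\<^sub>R ?E1 + s^2 *\<^sub>R ?E2 = 0"
      using z0_sq[of y] nil_cube[OF ww, of y] by simp
    then have "(s *\<^sub>R ?E1 + s^2 *\<^sub>R ?E2) \<bullet> v = 0" by simp
    then show ?thesis by (simp only: inner_add_left inner_scaleR_left)
  qed
  have "?E1 \<bullet> v = 0" for v by (rule quintic_coeffs_zero(2)[OF main])
  from this[of ?E1] show "z0 \<star> (z0 \<star> (w \<star> y)) + z0 \<star> (w \<star> (z0 \<star> y)) + w \<star> (z0 \<star> (z0 \<star> y))
      = 81 *\<^sub>R (w \<star> y)"
    by simp
  have "?E2 \<bullet> v = 0" for v by (rule quintic_coeffs_zero(3)[OF main])
  from this[of ?E2] show "z0 \<star> (w \<star> (w \<star> y)) + w \<star> (z0 \<star> (w \<star> y)) + w \<star> (w \<star> (z0 \<star> y))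
      = (27 * (w \<bullet> w)) *\<^sub>R (z0 \<star> y)"
    by simp
qed

text \<open>On \<open>Y\<close> two of the three terms in the first polarised identity are
  \<open>81 *\<^sub>R (w \<star> y)\<close>, which fixes the third,
  \<open>z0 \<star> (w \<star> (z0 \<star> y))\<close>. A further multiplication by
  \<open>z0\<close> undoes the outer one up to 81.\<close>

lemma anticommute:
  assumes w: "w \<in> Z" "w \<bullet> z0 = 0" and y: "y \<in> Y"
  shows "w \<star> (z0 \<star> y) = - (z0 \<star> (w \<star> y))"
proof -
  have "z0 \<star> (w \<star> (z0 \<star> y)) = - (81 *\<^sub>R (w \<star> y))"
    using nil_cube_polar(1)[OF w, of y] z0_sq_Y[OF y] z0_sq_Y[OF Z_star_Y[OF w(1), of y]]
    by (simp add: scale_right eq_neg_iff_add_eq_0 add.commute)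
  then have "z0 \<star> (z0 \<star> (w \<star> (z0 \<star> y))) = - (81 *\<^sub>R (z0 \<star> (w \<star> y)))"
    by (simp add: star_expand)
  then have "81 *\<^sub>R (w \<star> (z0 \<star> y)) = 81 *\<^sub>R (- (z0 \<star> (w \<star> y)))"
    using z0_sq_Y[OF Z_star_Y[OF w(1), of "z0 \<star> y"]] by simp
  then show ?thesis unfolding scaleR_cancel_left by simp
qed

text \<open>Anticommutation cancels the first two terms of the second polarised identity, which
  settles the claim on multiples by \<open>z0\<close>; every element of \<open>Y\<close> is one,
  since \<open>z0\<close> acts there with square 81.\<close>

lemma square_Y:
  assumes w: "w \<in> Z" "w \<bullet> z0 = 0" and y: "y \<in> Y"
  shows "w \<star> (w \<star> y) = (27 * (w \<bullet> w)) *\<^sub>R y"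
proof -
  have *: "w \<star> (w \<star> (z0 \<star> u)) = (27 * (w \<bullet> w)) *\<^sub>R (z0 \<star> u)" if "u \<in> Y" for u
    using nil_cube_polar(2)[OF w, of u] anticommute[OF w Z_star_Y[OF w(1), of u]] by simp
  have "w \<star> (w \<star> (z0 \<star> (z0 \<star> y))) = (27 * (w \<bullet> w)) *\<^sub>R (z0 \<star> (z0 \<star> y))"
    by (rule *[OF star_z0_Y])
  then have "81 *\<^sub>R (w \<star> (w \<star> y)) = 81 *\<^sub>R ((27 * (w \<bullet> w)) *\<^sub>R y)"
    using z0_sq_Y[OF y] by (simp add: scale_right)
  then show ?thesis unfolding scaleR_cancel_left by simp
qed

lemma star_norm:
  assumes z: "z \<in> Z" and y: "y \<in> Y"
  shows "(z \<star> y) \<bullet> (z \<star> y) = 27 * (z \<bullet> z) * (y \<bullet> y)"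
proof -
  define s where "s = (z \<bullet> z0) / 3"
  define w where "w = z - s *\<^sub>R z0"
  have w: "w \<in> Z" "w \<bullet> z0 = 0" "z0 \<bullet> w = 0"
    using z z0_Z subspace_Z
    by (simp_all add: w_def s_def subspace_diff subspace_scale inner_diff_left inner_diff_right
      z0_inner inner_commute)
  have zw: "z = w + s *\<^sub>R z0" by (simp add: w_def)
  have sa: "(u \<star> y) \<bullet> (v \<star> y) = (v \<star> (u \<star> y)) \<bullet> y" for u v
    using assoc[of "u \<star> y" v y] commute[of v "u \<star> y"] by simp
  have "(w \<star> y) \<bullet> (w \<star> y) = 27 * (w \<bullet> w) * (y \<bullet> y)" by (simp add: sa square_Y[OF w(1,2) y])
  moreover have "(z0 \<star> y) \<bullet> (z0 \<star> y) = 81 * (y \<bullet> y)" by (simp add: sa z0_sq_Y[OF y])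
  moreover have "(w \<star> y) \<bullet> (z0 \<star> y) = - ((w \<star> y) \<bullet> (z0 \<star> y))"
    using sa[of w z0] sa[of z0 w] anticommute[OF w(1,2) y] by (simp add: inner_commute)
  ultimately show ?thesis
    using w(2,3) unfolding zw
    by (simp add: star_expand inner_add_left inner_add_right inner_commute[of "z0 \<star> y"
      "w \<star> y"] z0_inner algebra_simps)
qed

lemma clifford_split_Z_Y: "clifford_split Z Y 27"
  unfolding clifford_split_def
  using subspace_Z subspace_Y Z_Y_decomp Z_star_Z F_YYY star_norm by (auto simp: Y_def)

lemma Z_nontrivial: "Z \<noteq> {0}"
  by (metis inner_zero_left singletonD z0_Z z0_inner zero_neq_numeral)

end

text \<open>The square of \<open>F a a a\<close> is 18. Replacing \<open>a\<close> by
  \<open>- a\<close> keeps the hyperplane, so the sign can be taken positive.\<close>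

lemma clifford_split_if_hyperplane:
  assumes a: "V2 a" "norm a = 1" and van: "\<And>y. V2 y \<Longrightarrow> a \<bullet> y = 0 \<Longrightarrow> F y y y = 0"
  shows "\<exists>Z Y. clifford_split Z Y 27 \<and> Z \<noteq> {0}"
proof -
  have pos: "\<exists>Z Y. clifford_split Z Y 27 \<and> Z \<noteq> {0}"
    if b: "V2 b" "norm b = 1" "\<And>y. V2 y \<Longrightarrow> b \<bullet> y = 0 \<Longrightarrow> F y y y = 0" "F b b b = 3 * sqrt 2" for b
  proof -
    have "b \<star> b = (- 3) *\<^sub>R e + (3 * sqrt 2) *\<^sub>R b" using direction_square(1)[OF b(1-3)] b(4) by simp
    moreover have "b \<star> y = (- 3 * sqrt 2) *\<^sub>R y" if "V2 y" "b \<bullet> y = 0" for y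
      using direction_star[OF b(1-3) that b(4)] .
    ultimately show ?thesis using clifford_split_Z_Y[OF b(1,2)] Z_nontrivial[OF b(1,2)] by blast
  qed
  have "(F a a a)^2 = (3 * sqrt 2)^2" using direction_square(2)[OF a van]
      by (simp add: power_mult_distrib)
  then consider "F a a a = 3 * sqrt 2" | "F a a a = - (3 * sqrt 2)" unfolding power2_eq_iff by blast
  then show ?thesis
  proof cases
    case 1
    then show ?thesis using pos[OF a van] by blast
  next
    case 2
    have "V2 (- a)" using eig_scale[OF a(1), of "- 1"] by simp
    moreover have "F (- a) (- a) (- a) = 3 * sqrt 2" using 2 by (simp add: F_expand)
    ultimately show ?thesis using pos[of "- a"] a(2) van by simp
  qed
qed

end

subsection \<open>Polynomial functions and cubic forms\<close>

lemma real_polynomial_function_line: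
  assumes "real_polynomial_function g"
  shows "\<exists>q. \<forall>t. g (x + t *\<^sub>R d) = poly q t"
  using assms
proof induction
  case (linear f)
  then interpret bounded_linear f .
  have "f (x + t *\<^sub>R d) = poly [:f x, f d:] t" for t by (simp add: add scaleR)
  then show ?case by blast
next
  case (const c)
  have "c = poly [:c:] t" for t :: real by simp
  then show ?case by blast
next
  case (add f g)
  then obtain p q where "\<forall>t. f (x + t *\<^sub>R d) = poly p t" "\<forall>t. g (x + t *\<^sub>R d) = poly q t" by blast
  then have "\<forall>t. f (x + t *\<^sub>R d) + g (x + t *\<^sub>R d) = poly (p + q) t" by simp
  then show ?case by blast
next
  case (mult f g)
  then obtain p q where "\<forall>t. f (x + t *\<^sub>R d) = poly p t" "\<forall>t. g (x + t *\<^sub>R d) = poly q t" by blast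
  then have "\<forall>t. f (x + t *\<^sub>R d) * g (x + t *\<^sub>R d) = poly (p * q) t" by simp
  then show ?case by blast
qed

text \<open>On the line through \<open>x\<close> and \<open>y\<close> both functions are nonzero
  polynomials in one variable, and their product has a non-root. In other words, polynomial
  functions on a subspace form a domain.\<close>

lemma real_polynomial_functions_common_nonzero:
  assumes f: "real_polynomial_function f" and g: "real_polynomial_function g"
    and V: "subspace V" "x \<in> V" "y \<in> V" and nz: "f x \<noteq> 0" "g y \<noteq> 0"
  obtains z where "z \<in> V" "f z \<noteq> 0" "g z \<noteq> 0"
proof -
  obtain p where p: "\<And>t. f (x + t *\<^sub>R (y - x)) = poly p t" using real_polynomial_function_line[OF f]
      by blast
  obtain q where q: "\<And>t. g (x + t *\<^sub>R (y - x)) = poly q t" using real_polynomial_function_line[OF g]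
      by blast
  have "poly p 0 \<noteq> 0" "poly q 1 \<noteq> 0" using p[of 0] q[of 1] nz by simp_all
  then have "p * q \<noteq> 0" by auto
  then obtain t where "poly (p * q) t \<noteq> 0" using poly_all_0_iff_0[of "p * q"] by blast
  then have "f (x + t *\<^sub>R (y - x)) \<noteq> 0" "g (x + t *\<^sub>R (y - x)) \<noteq> 0" using p q by simp_all
  moreover have "x + t *\<^sub>R (y - x) \<in> V" using V by (simp add: subspace_add subspace_diff subspace_scale)
  ultimately show ?thesis using that by blast
qed

text \<open>That the coefficients depend polynomially on the direction lets
  \<open>factors_of_homogeneous_polynomial\<close> compare degrees along different rays.\<close>

lemma real_polynomial_function_ray:
  assumes "real_polynomial_function g"
  shows "\<exists>Q. (\<forall>x t. g (t *\<^sub>R x) = poly (Q x) t) \<and> (\<forall>i. real_polynomial_function (\<lambda>x. coeff (Q x) i))"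
  using assms
proof induction
  case (linear f)
  note f = linear
  have "f (t *\<^sub>R x) = poly [:0, f x:] t" for t x
    using bounded_linear.linear[OF f] by (simp add: linear_scale)
  moreover have "coeff [:0, f x:] i = (if i = 1 then f x else 0)" for x i
    by (auto simp: coeff_pCons split: nat.split)
  then have "real_polynomial_function (\<lambda>x. coeff [:0, f x:] i)" for i
    using f by (cases "i = 1") auto
  ultimately show ?case by (intro exI[of _ "\<lambda>x. [:0, f x:]"]) blast
next
  case (const c)
  have "c = poly [:c:] t" for t :: real by simp
  then show ?case by (intro exI[of _ "\<lambda>x. [:c:]"]) auto
next
  case (add f g)
  then obtain P Q where "\<forall>x t. f (t *\<^sub>R x) = poly (P x) t"
      "\<forall>i. real_polynomial_function (\<lambda>x. coeff (P x) i)"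
    "\<forall>x t. g (t *\<^sub>R x) = poly (Q x) t" "\<forall>i. real_polynomial_function (\<lambda>x. coeff (Q x) i)" by blast
  then show ?case by (intro exI[of _ "\<lambda>x. P x + Q x"]) auto
next
  case (mult f g)
  then obtain P Q where PQ: "\<forall>x t. f (t *\<^sub>R x) = poly (P x) t"
      "\<forall>i. real_polynomial_function (\<lambda>x. coeff (P x) i)"
    "\<forall>x t. g (t *\<^sub>R x) = poly (Q x) t" "\<forall>i. real_polynomial_function (\<lambda>x. coeff (Q x) i)" by blast
  then have "real_polynomial_function (\<lambda>x. \<Sum>j\<le>i. coeff (P x) j * coeff (Q x) (i - j))" for i
    by (intro real_polynomial_function_sum) auto
  with PQ show ?case by (intro exI[of _ "\<lambda>x. P x * Q x"]) (auto simp: coeff_mult)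
qed

text \<open>The Taylor expansion at 0 up to degree three, its parts given by multilinear forms that
  need not be symmetric. In this shape sums and products have explicit jets, so a trilinear form
  arises by induction on the polynomial, without derivatives.\<close>

definition cubic_jet :: "('a::euclidean_space \<Rightarrow> real) \<Rightarrow> real \<Rightarrow> ('a \<Rightarrow> real) \<Rightarrow> ('a \<Rightarrow> 'a \<Rightarrow> real) \<Rightarrow>
    ('a \<Rightarrow> 'a \<Rightarrow> 'a \<Rightarrow> real) \<Rightarrow> bool" where
  "cubic_jet f c0 c1 c2 c3 \<longleftrightarrow> linear c1 \<and> bilinear c2 \<and>
    (\<forall>y z. linear (\<lambda>x. c3 x y z)) \<and> (\<forall>x z. linear (\<lambda>y. c3 x y z)) \<and> (\<forall>x y. linear (\<lambda>z. c3 x y z)) \<and>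
    (\<forall>x. \<exists>q. (\<forall>t. f (t *\<^sub>R x) = poly q t) \<and> coeff q 0 = c0 \<and> coeff q 1 = c1 x \<and>
      coeff q 2 = c2 x x \<and> coeff q 3 = c3 x x x)"

lemma cubic_jetD:
  assumes "cubic_jet f c0 c1 c2 c3"
  shows "linear c1" "bilinear c2" "linear (\<lambda>x. c3 x y z)" "linear (\<lambda>y. c3 x y z)" "linear (\<lambda>z. c3 x y z)"
  using assms by (simp_all add: cubic_jet_def)

lemma cubic_jet_poly:
  assumes "cubic_jet f c0 c1 c2 c3"
  obtains q where "\<And>t. f (t *\<^sub>R x) = poly q t" "coeff q 0 = c0" "coeff q 1 = c1 x"
    "coeff q 2 = c2 x x" "coeff q 3 = c3 x x x"
proof -
  have "\<exists>q. (\<forall>t. f (t *\<^sub>R x) = poly q t) \<and> coeff q 0 = c0 \<and> coeff q 1 = c1 x \<and>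
      coeff q 2 = c2 x x \<and> coeff q 3 = c3 x x x"
    using assms by (simp only: cubic_jet_def)
  then show ?thesis using that by blast
qed

lemma cubic_jetI:
  assumes "linear c1" "bilinear c2" "\<And>y z. linear (\<lambda>x. c3 x y z)" "\<And>x z. linear (\<lambda>y. c3 x y z)"
    "\<And>x y. linear (\<lambda>z. c3 x y z)"
    and "\<And>x. \<exists>q. (\<forall>t. f (t *\<^sub>R x) = poly q t) \<and> coeff q 0 = c0 \<and> coeff q 1 = c1 x \<and>
      coeff q 2 = c2 x x \<and> coeff q 3 = c3 x x x"
  shows "cubic_jet f c0 c1 c2 c3"
  unfolding cubic_jet_def using assms by blast

lemma cubic_jet_add:
  assumes c: "cubic_jet f c0 c1 c2 c3" and d: "cubic_jet g d0 d1 d2 d3"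
  shows "cubic_jet (\<lambda>x. f x + g x) (c0 + d0) (\<lambda>x. c1 x + d1 x) (\<lambda>x y. c2 x y + d2 x y)
    (\<lambda>x y z. c3 x y z + d3 x y z)"
proof (rule cubic_jetI)
  fix x
  obtain p where p: "\<And>t. f (t *\<^sub>R x) = poly p t" "coeff p 0 = c0" "coeff p 1 = c1 x" "coeff p 2 = c2 x x"
    "coeff p 3 = c3 x x x" using cubic_jet_poly[OF c, of x] by blast
  obtain q where q: "\<And>t. g (t *\<^sub>R x) = poly q t" "coeff q 0 = d0" "coeff q 1 = d1 x" "coeff q 2 = d2 x x"
    "coeff q 3 = d3 x x x" using cubic_jet_poly[OF d, of x] by blast
  show "\<exists>q. (\<forall>t. f (t *\<^sub>R x) + g (t *\<^sub>R x) = poly q t) \<and> coeff q 0 = c0 + d0 \<and> coeff q 1 = c1 x + d1 x \<and>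
      coeff q 2 = c2 x x + d2 x x \<and> coeff q 3 = c3 x x x + d3 x x x"
    using p q by (intro exI[of _ "p + q"]) simp
qed (use cubic_jetD[OF c] cubic_jetD[OF d] in \<open>simp_all add: linear_compose_add bilinear_def\<close>)

lemma cubic_jet_mult:
  assumes c: "cubic_jet f c0 c1 c2 c3" and d: "cubic_jet g d0 d1 d2 d3"
  shows "cubic_jet (\<lambda>x. f x * g x) (c0 * d0) (\<lambda>x. c0 * d1 x + c1 x * d0)
    (\<lambda>x y. c0 * d2 x y + c1 x * d1 y + c2 x y * d0)
    (\<lambda>x y z. c0 * d3 x y z + c1 x * d2 y z + c2 x y * d1 z + c3 x y z * d0)"
proof (rule cubic_jetI)
  fix x
  obtain p where p: "\<And>t. f (t *\<^sub>R x) = poly p t" "coeff p 0 = c0" "coeff p 1 = c1 x" "coeff p 2 = c2 x x"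
    "coeff p 3 = c3 x x x" using cubic_jet_poly[OF c, of x] by blast
  obtain q where q: "\<And>t. g (t *\<^sub>R x) = poly q t" "coeff q 0 = d0" "coeff q 1 = d1 x" "coeff q 2 = d2 x x"
    "coeff q 3 = d3 x x x" using cubic_jet_poly[OF d, of x] by blast
  show "\<exists>q. (\<forall>t. f (t *\<^sub>R x) * g (t *\<^sub>R x) = poly q t) \<and> coeff q 0 = c0 * d0 \<and>
      coeff q 1 = c0 * d1 x + c1 x * d0 \<and> coeff q 2 = c0 * d2 x x + c1 x * d1 x + c2 x x * d0 \<and>
      coeff q 3 = c0 * d3 x x x + c1 x * d2 x x + c2 x x * d1 x + c3 x x x * d0"
    using p q by (intro exI[of _ "p * q"])
      (simp add: coeff_mult numeral_2_eq_2 numeral_3_eq_3 atMost_Suc algebra_simps)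
next
  note cs = cubic_jetD[OF c] and ds = cubic_jetD[OF d]
  note rules = linear_add[OF cs(1)] linear_scale[OF cs(1)] bilinear_ladd[OF cs(2)] bilinear_radd[OF
      cs(2)]
    bilinear_lmul[OF cs(2)] bilinear_rmul[OF cs(2)] linear_add[OF cs(3)] linear_scale[OF cs(3)]
    linear_add[OF cs(4)] linear_scale[OF cs(4)] linear_add[OF cs(5)] linear_scale[OF cs(5)]
    linear_add[OF ds(1)] linear_scale[OF ds(1)] bilinear_ladd[OF ds(2)] bilinear_radd[OF ds(2)]
    bilinear_lmul[OF ds(2)] bilinear_rmul[OF ds(2)] linear_add[OF ds(3)] linear_scale[OF ds(3)]
    linear_add[OF ds(4)] linear_scale[OF ds(4)] linear_add[OF ds(5)] linear_scale[OF ds(5)]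
  show "linear (\<lambda>x. c0 * d1 x + c1 x * d0)"
    by (rule linearI) (simp_all add: rules algebra_simps)
  show "bilinear (\<lambda>x y. c0 * d2 x y + c1 x * d1 y + c2 x y * d0)"
    unfolding bilinear_def by (intro conjI allI linearI) (simp_all add: rules algebra_simps)
  fix x y z
  show "linear (\<lambda>x. c0 * d3 x y z + c1 x * d2 y z + c2 x y * d1 z + c3 x y z * d0)"
    by (rule linearI) (simp_all add: rules algebra_simps)
  show "linear (\<lambda>y. c0 * d3 x y z + c1 x * d2 y z + c2 x y * d1 z + c3 x y z * d0)"
    by (rule linearI) (simp_all add: rules algebra_simps)
  show "linear (\<lambda>z. c0 * d3 x y z + c1 x * d2 y z + c2 x y * d1 z + c3 x y z * d0)"
    by (rule linearI) (simp_all add: rules algebra_simps)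
qed

lemma cubic_jet_exists:
  fixes f :: "'a::euclidean_space \<Rightarrow> real"
  assumes "real_polynomial_function f"
  shows "\<exists>c0 c1 c2 c3. cubic_jet f c0 c1 c2 c3"
  using assms
proof induction
  case (linear f)
  note f = bounded_linear.linear[OF linear]
  have "cubic_jet f 0 f (\<lambda>x y. 0) (\<lambda>x y z. 0)"
  proof (rule cubic_jetI)
    show "\<exists>q. (\<forall>t. f (t *\<^sub>R x) = poly q t) \<and> coeff q 0 = 0 \<and> coeff q 1 = f x \<and> coeff q 2 = 0 \<and>
        coeff q 3 = 0" for x
      by (rule exI[of _ "[:0, f x:]"])
        (simp add: linear_scale[OF f] coeff_pCons numeral_2_eq_2 numeral_3_eq_3)
  qed (use f in \<open>simp_all add: bilinear_def linear_zero\<close>)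
  then show ?case by blast
next
  case (const c)
  have "cubic_jet (\<lambda>x. c) c (\<lambda>x. 0) (\<lambda>x y. 0) (\<lambda>x y z. 0)"
  proof (rule cubic_jetI)
    show "\<exists>q. (\<forall>t. c = poly q t) \<and> coeff q 0 = c \<and> coeff q 1 = 0 \<and> coeff q 2 = 0 \<and> coeff q 3 = 0"
      by (rule exI[of _ "[:c:]"]) (simp add: coeff_pCons numeral_2_eq_2 numeral_3_eq_3)
  qed (simp_all add: bilinear_def linear_zero)
  then show ?case by blast
next
  case (add f g)
  then show ?case using cubic_jet_add by blast
next
  case (mult f g)
  then show ?case using cubic_jet_mult by blast
qed

lemma metrised_algebra_of_trilinear:
  fixes S :: "'a::euclidean_space \<Rightarrow> 'a \<Rightarrow> 'a \<Rightarrow> real"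
  assumes lin: "\<And>y z. linear (\<lambda>x. S x y z)"
      and sym: "\<And>x y z. S x y z = S y x z" "\<And>x y z. S x y z = S x z y"
  shows "\<exists>m. metrised_algebra m \<and> (\<forall>x y z. m x y \<bullet> z = S x y z)"
proof -
  define m where "m = (\<lambda>x y. \<Sum>b\<in>Basis. S x y b *\<^sub>R b)"
  have lin3: "linear (\<lambda>z. S x y z)" for x y
  proof -
    have "S x y z = S z y x" for z
      using sym(2)[of x y z] sym(1)[of x z y] sym(2)[of z x y] by simp
    then show ?thesis using lin[of y x] by simp
  qed
  have m: "m x y \<bullet> z = S x y z" for x y z
  proof -
    have "S x y z = S x y (\<Sum>b\<in>Basis. (z \<bullet> b) *\<^sub>R b)" by (simp add: euclidean_representation)
    also have "\<dots> = (\<Sum>b\<in>Basis. (z \<bullet> b) * S x y b)"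
      by (simp add: linear_sum[OF lin3] linear_scale[OF lin3])
    also have "\<dots> = m x y \<bullet> z" by (simp add: m_def inner_sum_left inner_commute[of z] mult.commute)
    finally show ?thesis by simp
  qed
  have "metrised_algebra m"
  proof
    fix x y z and c :: real
    have "(m (x + y) z - (m x z + m y z)) \<bullet> w = 0" for w
      by (simp add: inner_diff_left inner_add_left m linear_add[OF lin])
    from this[of "m (x + y) z - (m x z + m y z)"] show "m (x + y) z = m x z + m y z" by simp
    have "(m (c *\<^sub>R x) y - c *\<^sub>R m x y) \<bullet> w = 0" for w
      by (simp add: inner_diff_left m linear_scale[OF lin])
    from this[of "m (c *\<^sub>R x) y - c *\<^sub>R m x y"] show "m (c *\<^sub>R x) y = c *\<^sub>R m x y" by simp
    have "(m x y - m y x) \<bullet> w = 0" for w using sym(1)[of x y w] by (simp add: inner_diff_left m)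
    from this[of "m x y - m y x"] show "m x y = m y x" by simp
    show "m x y \<bullet> z = x \<bullet> m y z"
      using sym(1)[of x y z] sym(2)[of y x z] by (simp add: inner_commute[of x] m)
  qed
  then show ?thesis using m by blast
qed

lemma homogeneous_cubic_metrised_algebra:
  fixes f :: "real^'n \<Rightarrow> real"
  assumes "homogeneous_polynomial 3 f"
  shows "\<exists>m. metrised_algebra m \<and> (\<forall>x. m x x \<bullet> x = 6 * f x)"
proof -
  have pf: "real_polynomial_function f" and hom: "\<And>t x. f (t *\<^sub>R x) = t ^ 3 * f x"
    using assms by (auto simp: homogeneous_polynomial_def)
  obtain c0 c1 c2 T where jet: "cubic_jet f c0 c1 c2 T" using cubic_jet_exists[OF pf] by blast
  note T = cubic_jetD(3-5)[OF jet]
  have fT: "f x = T x x x" for x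
  proof -
    obtain q where q: "\<And>t. f (t *\<^sub>R x) = poly q t" "coeff q 3 = T x x x"
      using cubic_jet_poly[OF jet, of x] by blast
    have "poly (q - monom (f x) 3) t = 0" for t
      using q(1)[of t] hom[of t x] by (simp add: poly_monom mult.commute)
    then have "q - monom (f x) 3 = 0" using poly_all_0_iff_0 by blast
    then have "q = monom (f x) 3" by simp
    then show ?thesis using q(2) by simp
  qed
  \<comment> \<open>Summing over the six permutations without dividing produces the factor 6 between
    the cubic form and the algebra.\<close>
  define S where "S = (\<lambda>x y z. T x y z + T x z y + T y x z + T y z x + T z x y + T z y x)"
  have "linear (\<lambda>x. S x y z)" for y z
    unfolding S_def by (intro linear_compose_add T)
  moreover have "S x y z = S y x z" "S x y z = S x z y" for x y z by (simp_all add: S_def)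
  ultimately obtain m where "metrised_algebra m" "\<And>x y z. m x y \<bullet> z = S x y z"
    using metrised_algebra_of_trilinear[of S] by blast
  moreover have "S x x x = 6 * f x" for x by (simp add: S_def fT)
  ultimately show ?thesis by auto
qed

text \<open>The degrees of the factors add up to \<open>n\<close>, and so do their orders at 0. As
  the order never exceeds the degree, they agree for each factor, which leaves a single
  coefficient.\<close>

lemma monom_factors:
  fixes q r :: "real poly"
  assumes "q * r = monom c n" "c \<noteq> 0"
  obtains k l where "k + l = n" "\<And>i. i \<noteq> k \<Longrightarrow> coeff q i = 0" "\<And>i. i \<noteq> l \<Longrightarrow> coeff r i = 0"
proof -
  have nz: "q \<noteq> 0" "r \<noteq> 0" "q * r \<noteq> 0" using assms by auto
  have "degree q + degree r = n" using degree_mult_eq[OF nz(1,2)] assms by (simp add: degree_monom_eq)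
  moreover have "order 0 q + order 0 r = n" using order_mult[OF nz(3), of 0] assms by simp
  moreover have "order 0 q \<le> degree q" "order 0 r \<le> degree r" using nz by (simp_all add: order_degree)
  ultimately have ord: "order 0 q = degree q" "order 0 r = degree r" by linarith+
  have "coeff p i = 0" if "p \<noteq> 0" "order 0 p = degree p" "i \<noteq> degree p" for p :: "real poly" and i
  proof (cases "i < degree p")
    case True
    have "monom 1 (degree p) dvd p" using that by (simp add: monom_1_dvd_iff)
    then show ?thesis using True by (simp add: monom_1_dvd_iff')
  next
    case False
    then show ?thesis using that(3) by (simp add: coeff_eq_0)
  qed
  then show ?thesis using that[OF \<open>degree q + degree r = n\<close>] nz ord by blast
qed

text \<open>Along each ray on which the product is nonzero both factors are monomials, but their
  degrees might vary with the ray. If a coefficient of another degree were nonzero somewhere, there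
  would be one ray on which it, the coefficient of degree \<open>k\<close> and the product are all
  nonzero, contradicting \<open>monom_factors\<close>.\<close>

lemma factors_of_homogeneous_polynomial:
  assumes V: "subspace V" and g: "real_polynomial_function g" and h: "real_polynomial_function h"
    and hom: "\<And>x t. x \<in> V \<Longrightarrow> g (t *\<^sub>R x) * h (t *\<^sub>R x) = t ^ n * (g x * h x)"
    and nz: "x0 \<in> V" "g x0 * h x0 \<noteq> 0"
  obtains k l where "k + l = n" "\<And>x t. x \<in> V \<Longrightarrow> g (t *\<^sub>R x) = t ^ k * g x"
    "\<And>x t. x \<in> V \<Longrightarrow> h (t *\<^sub>R x) = t ^ l * h x"
proof -
  obtain Q where Q: "\<And>x t. g (t *\<^sub>R x) = poly (Q x) t" "\<And>i. real_polynomial_function (\<lambda>x. coeff (Q x) i)"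
    using real_polynomial_function_ray[OF g] by blast
  obtain R where R: "\<And>x t. h (t *\<^sub>R x) = poly (R x) t" "\<And>i. real_polynomial_function (\<lambda>x. coeff (R x) i)"
    using real_polynomial_function_ray[OF h] by blast
  have gh: "real_polynomial_function (\<lambda>x. g x * h x)" using g h by auto
  have prod: "Q x * R x = monom (g x * h x) n" if "x \<in> V" for x
  proof -
    have "poly (Q x * R x - monom (g x * h x) n) t = 0" for t
      using hom[OF that, of t] by (simp add: Q(1) R(1) poly_monom mult.commute)
    then have "Q x * R x - monom (g x * h x) n = 0" using poly_all_0_iff_0 by blast
    then show ?thesis by simp
  qed
  obtain k l where kl: "k + l = n" "\<And>i. i \<noteq> k \<Longrightarrow> coeff (Q x0) i = 0" "\<And>i. i \<noteq> l \<Longrightarrow> coeff (R x0) i = 0"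
    using monom_factors[OF prod[OF nz(1)] nz(2)] by blast
  have "poly (Q x0) 1 \<noteq> 0" "poly (R x0) 1 \<noteq> 0" using nz(2) Q(1)[of 1 x0] R(1)[of 1 x0] by auto
  then have "Q x0 \<noteq> 0" "R x0 \<noteq> 0" by auto
  then have k0: "coeff (Q x0) k \<noteq> 0" and l0: "coeff (R x0) l \<noteq> 0"
    using kl(2,3) by (metis leading_coeff_neq_0)+
  have only: "coeff (P x) i = 0"
    if P: "\<And>i. real_polynomial_function (\<lambda>x. coeff (P x) i)" "coeff (P x0) k \<noteq> 0"
      and single: "\<And>z. z \<in> V \<Longrightarrow> g z * h z \<noteq> 0 \<Longrightarrow> \<exists>k'. \<forall>j. j \<noteq> k' \<longrightarrow> coeff (P z) j = 0"
      and x: "x \<in> V" and i: "i \<noteq> k" for P k x i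
  proof (rule ccontr)
    assume "coeff (P x) i \<noteq> 0"
    then obtain y where y: "y \<in> V" "coeff (P y) i \<noteq> 0" "g y * h y \<noteq> 0"
      using real_polynomial_functions_common_nonzero[OF P(1)[of i] gh V x nz(1)] nz(2) by blast
    have "real_polynomial_function (\<lambda>x. coeff (P x) i * (g x * h x))" using P(1) gh by auto
    moreover have "coeff (P y) i * (g y * h y) \<noteq> 0" using y by simp
    ultimately obtain z where z: "z \<in> V" "coeff (P z) i * (g z * h z) \<noteq> 0" "coeff (P z) k \<noteq> 0"
      using real_polynomial_functions_common_nonzero[OF _ P(1)[of k] V y(1) nz(1)] P(2) by blast
    then have "g z * h z \<noteq> 0" "coeff (P z) i \<noteq> 0" by auto
    then show False using single[OF z(1)] z(3) i by metis
  qed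
  have Qz: "coeff (Q x) i = 0" if "x \<in> V" "i \<noteq> k" for x i
    using only[of Q k x i] Q(2) k0 monom_factors[OF prod] that by metis
  have Rz: "coeff (R x) i = 0" if "x \<in> V" "i \<noteq> l" for x i
    using only[of R l x i] R(2) l0 monom_factors[OF prod] that by metis
  have mono: "q = monom (poly q 1) j" if "\<And>i. i \<noteq> j \<Longrightarrow> coeff q i = 0" for q :: "real poly" and j
  proof -
    have "q = monom (coeff q j) j" using that by (intro poly_eqI) (simp add: coeff_monom)
    moreover from this have "poly q 1 = coeff q j" by (metis poly_monom power_one mult.right_neutral)
    ultimately show ?thesis by simp
  qed
  have "g (t *\<^sub>R x) = t ^ k * g x" if "x \<in> V" for x t
    using mono[of k "Q x"] Qz[OF that] Q(1)[of t x] Q(1)[of 1 x]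
      by (metis mult.commute poly_monom scaleR_one)
  moreover have "h (t *\<^sub>R x) = t ^ l * h x" if "x \<in> V" for x t
    using mono[of l "R x"] Rz[OF that] R(1)[of t x] R(1)[of 1 x]
      by (metis mult.commute poly_monom scaleR_one)
  ultimately show ?thesis using that kl(1) by blast
qed

text \<open>On \<open>V\<close> the function agrees with the linear part of its jet;
  \<open>a\<close> is the normalised projection to \<open>V\<close> of the vector representing that
  part.\<close>

lemma homogeneous_linear_on_subspace:
  fixes g :: "'a::euclidean_space \<Rightarrow> real"
  assumes V: "subspace V" and g: "real_polynomial_function g" "\<And>x t. x \<in> V \<Longrightarrow> g (t *\<^sub>R x) = t * g x"
    and nz: "x0 \<in> V" "g x0 \<noteq> 0"
  obtains a where "a \<in> V" "norm a = 1" "\<And>x. x \<in> V \<Longrightarrow> a \<bullet> x = 0 \<Longrightarrow> g x = 0"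
proof -
  obtain c0 c1 c2 c3 where jet: "cubic_jet g c0 c1 c2 c3" using cubic_jet_exists[OF g(1)] by blast
  have gc: "g x = c1 x" if "x \<in> V" for x
  proof -
    obtain q where q: "\<And>t. g (t *\<^sub>R x) = poly q t" "coeff q 1 = c1 x"
      using cubic_jet_poly[OF jet, of x] by blast
    have "poly (q - monom (g x) 1) t = 0" for t
      using q(1)[of t] g(2)[OF that, of t] by (simp add: poly_monom mult.commute)
    then have "q - monom (g x) 1 = 0" using poly_all_0_iff_0 by blast
    then have "q = monom (g x) 1" by simp
    then show ?thesis using q(2) by simp
  qed
  have lin: "linear c1" using cubic_jetD(1)[OF jet] .
  define r where "r = (\<Sum>b\<in>Basis. c1 b *\<^sub>R b)"
  have r: "c1 x = r \<bullet> x" for x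
  proof -
    have "c1 x = c1 (\<Sum>b\<in>Basis. (x \<bullet> b) *\<^sub>R b)" by (simp add: euclidean_representation)
    also have "\<dots> = r \<bullet> x"
      by (simp add: linear_sum[OF lin] linear_scale[OF lin] r_def inner_sum_left inner_commute[of x]
        mult.commute)
    finally show ?thesis .
  qed
  obtain s u where su: "s \<in> span V" "\<And>w. w \<in> span V \<Longrightarrow> orthogonal u w" "r = s + u"
    using orthogonal_subspace_decomp_exists[of V r] by blast
  have V': "span V = V" using V by (simp add: span_eq_iff)
  have gs: "g x = s \<bullet> x" if "x \<in> V" for x
    using gc[OF that] r[of x] su(2)[of x] that by (simp add: V' su(3) inner_add_left orthogonal_def)
  then have "s \<noteq> 0" using nz by auto
  show ?thesis
  proof (rule that[of "(1 / norm s) *\<^sub>R s"])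
    show "(1 / norm s) *\<^sub>R s \<in> V" using su(1) V V' by (simp add: subspace_scale)
    show "norm ((1 / norm s) *\<^sub>R s) = 1" using \<open>s \<noteq> 0\<close> by simp
    show "g x = 0" if "x \<in> V" "((1 / norm s) *\<^sub>R s) \<bullet> x = 0" for x
      using that gs \<open>s \<noteq> 0\<close> by simp
  qed
qed

text \<open>The factors are homogeneous of degrees adding up to 3, and neither is constant, so one
  of them has degree 1.\<close>

lemma reducible_cubic_vanishes_on_hyperplane:
  fixes p :: "real^'n \<Rightarrow> real"
  assumes V: "subspace V" and hom: "\<And>x t. x \<in> V \<Longrightarrow> p (t *\<^sub>R x) = t ^ 3 * p x"
    and nz: "\<exists>x\<in>V. p x \<noteq> 0" and red: "reducible_on V p"
  obtains a where "a \<in> V" "norm a = 1" "\<And>y. y \<in> V \<Longrightarrow> a \<bullet> y = 0 \<Longrightarrow> p y = 0"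
proof -
  obtain g h where gh: "real_polynomial_function g" "real_polynomial_function h"
    and nc: "\<not> g constant_on V" "\<not> h constant_on V" and p: "\<And>x. x \<in> V \<Longrightarrow> p x = g x * h x"
    using red unfolding reducible_on_def by blast
  obtain x0 where x0: "x0 \<in> V" "g x0 * h x0 \<noteq> 0" using nz p by auto
  have "g (t *\<^sub>R x) * h (t *\<^sub>R x) = t ^ 3 * (g x * h x)" if "x \<in> V" for x t
    using hom[OF that, of t] p[OF that] p[of "t *\<^sub>R x"] V that by (simp add: subspace_scale)
  then obtain k l where kl: "k + l = 3" and g: "\<And>x t. x \<in> V \<Longrightarrow> g (t *\<^sub>R x) = t ^ k * g x"
    and h: "\<And>x t. x \<in> V \<Longrightarrow> h (t *\<^sub>R x) = t ^ l * h x"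
    using factors_of_homogeneous_polynomial[OF V gh _ x0] by blast
  have "k \<noteq> 0"
  proof
    assume "k = 0"
    then have "g x = g 0" if "x \<in> V" for x using g[OF that, of 0] by simp
    then show False using nc(1) unfolding constant_on_def by blast
  qed
  moreover have "l \<noteq> 0"
  proof
    assume "l = 0"
    then have "h x = h 0" if "x \<in> V" for x using h[OF that, of 0] by simp
    then show False using nc(2) unfolding constant_on_def by blast
  qed
  ultimately consider "k = 1" | "l = 1" using kl by linarith
  then show ?thesis
  proof cases
    case 1
    obtain a where "a \<in> V" "norm a = 1" "\<And>x. x \<in> V \<Longrightarrow> a \<bullet> x = 0 \<Longrightarrow> g x = 0"
      using homogeneous_linear_on_subspace[OF V gh(1) _ x0(1)] g x0(2) 1 by auto
    then show ?thesis using that p by simp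
  next
    case 2
    obtain a where "a \<in> V" "norm a = 1" "\<And>x. x \<in> V \<Longrightarrow> a \<bullet> x = 0 \<Longrightarrow> h x = 0"
      using homogeneous_linear_on_subspace[OF V gh(2) _ x0(1)] h x0(2) 2 by auto
    then show ?thesis using that p by simp
  qed
qed

subsection \<open>The algebra of a radial eigencubic\<close>

text \<open>The gradient of \<open>f\<close> is half of \<open>m x x\<close> and its Hessian is
  multiplication by \<open>x\<close>; two gradients account for the factor 1/4.\<close>

lemma L_op_metrised_algebra:
  fixes f :: "real^'n \<Rightarrow> real"
  assumes "metrised_algebra m" and f: "\<And>x. m x x \<bullet> x = 6 * f x"
  shows "L_op f x = 1 / 4 * ((m x x \<bullet> m x x) * metrised_algebra.tr m x
    - metrised_algebra.F m x (m x x) (m x x))"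
proof -
  interpret metrised_algebra m by fact
  have bil: "bounded_bilinear m"
    unfolding bilinear_conv_bounded_bilinear[symmetric] bilinear_def
    by (intro conjI allI linearI) (simp_all add: star_expand)
  have dm: "((\<lambda>x. m x x) has_derivative (\<lambda>h. 2 *\<^sub>R m x h)) (at x)" for x
  proof -
    have "((\<lambda>x. m x x) has_derivative (\<lambda>h. m x h + m h x)) (at x)"
      by (rule bounded_bilinear.FDERIV[OF bil]) (rule has_derivative_ident)+
    then show ?thesis by (simp add: commute[of _ x] scaleR_2)
  qed
  have f_eq: "f = (\<lambda>x. (1 / 6) * (m x x \<bullet> x))" using f by auto
  have p1: "partial_deriv i f x = (1 / 2) * (m x x \<bullet> axis i 1)" for i x
  proof -
    have "((\<lambda>x. (1 / 6) * (m x x \<bullet> x)) has_derivative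
        (\<lambda>h. (1 / 6) * (m x x \<bullet> h + (2 *\<^sub>R m x h) \<bullet> x))) (at x)"
      by (intro derivative_intros has_derivative_inner dm)
    moreover have "(1 / 6) * (m x x \<bullet> h + (2 *\<^sub>R m x h) \<bullet> x) = (1 / 2) * (m x x \<bullet> h)" for h
      using F_swap23[of x h x] by (simp add: F_def)
    ultimately have "(f has_derivative (\<lambda>h. (1 / 2) * (m x x \<bullet> h))) (at x)" by (simp add: f_eq)
    from frechet_derivative_at[OF this, symmetric] show ?thesis by (simp add: partial_deriv_def)
  qed
  have p2: "partial_deriv j (partial_deriv i f) x = F x (axis j 1) (axis i 1)" for i j
  proof -
    have "((\<lambda>x. (1 / 2) * (m x x \<bullet> axis i 1)) has_derivative
        (\<lambda>h. (1 / 2) * ((2 *\<^sub>R m x h) \<bullet> axis i 1))) (at x)"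
      by (intro has_derivative_mult_right has_derivative_inner_left dm)
    moreover have "partial_deriv i f = (\<lambda>x. (1 / 2) * (m x x \<bullet> axis i 1))" using p1 by auto
    ultimately have "(partial_deriv i f has_derivative (\<lambda>h. F x h (axis i 1))) (at x)"
      by (simp add: F_def)
    from frechet_derivative_at[OF this, symmetric] show ?thesis by (simp add: partial_deriv_def)
  qed
  have tr: "tr x = (\<Sum>i\<in>UNIV. F x (axis i 1) (axis i 1))"
  proof -
    have B: "(Basis :: (real^'n) set) = range (\<lambda>i. axis i 1)" by (auto simp: Basis_vec_def)
    have "inj (\<lambda>i::'n. axis i (1::real))" by (auto simp: inj_def axis_eq_axis)
    then show ?thesis unfolding tr_def B by (simp add: sum.reindex)
  qed
  let ?X = "m x x"
  have sq: "(\<Sum>i\<in>UNIV. ((1 / 2) * (?X \<bullet> axis i 1))\<^sup>2) = 1 / 4 * (?X \<bullet> ?X)"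
  proof -
    have "?X \<bullet> ?X = (\<Sum>i\<in>UNIV. (?X $ i)\<^sup>2)" by (simp add: inner_vec_def power2_eq_square)
    then show ?thesis by (simp add: inner_axis power_divide sum_divide_distrib)
  qed
  have "F x ?X ?X = (\<Sum>i\<in>UNIV. (?X \<bullet> axis i 1) * F x ?X (axis i 1))"
    by (simp add: F_def inner_axis inner_vec_def[of _ ?X] mult.commute)
  also have "\<dots> = (\<Sum>i\<in>UNIV. (?X \<bullet> axis i 1) * (\<Sum>j\<in>UNIV. (?X \<bullet> axis j 1) * F x (axis j 1) (axis i 1)))"
  proof -
    have "F x ?X (axis i 1) = (\<Sum>j\<in>UNIV. (?X \<bullet> axis j 1) * F x (axis j 1) (axis i 1))" for i
    proof -
      have "F x ?X (axis i 1) = m x (axis i 1) \<bullet> ?X" using F_swap23[of x ?X "axis i 1"]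
          by (simp add: F_def)
      also have "\<dots> = (\<Sum>j\<in>UNIV. (?X \<bullet> axis j 1) * F x (axis i 1) (axis j 1))"
        by (simp add: F_def inner_axis inner_vec_def[of _ ?X] mult.commute)
      finally show ?thesis by (simp add: F_swap23[of x "axis i 1"])
    qed
    then show ?thesis by simp
  qed
  finally have FX: "F x ?X ?X = (\<Sum>i\<in>UNIV. \<Sum>j\<in>UNIV. (?X \<bullet> axis i 1) * (?X \<bullet> axis j 1) * F x (axis j
      1) (axis i 1))"
    by (simp add: sum_distrib_left mult.assoc)
  have "(\<Sum>i\<in>UNIV. \<Sum>j\<in>UNIV. (1 / 2 * (?X \<bullet> axis i 1)) * (1 / 2 * (?X \<bullet> axis j 1)) * F x (axis j 1)
      (axis i 1))
      = 1 / 4 * F x ?X ?X"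
    unfolding FX sum_distrib_left by (intro sum.cong refl) simp
  then show ?thesis
    unfolding L_op_def p1 p2 sq tr[symmetric] by (simp add: algebra_simps)
qed

lemma metrised_algebra_scale:
  assumes "metrised_algebra m"
  shows "metrised_algebra (\<lambda>x y. c *\<^sub>R m x y)"
proof -
  interpret metrised_algebra m by fact
  show ?thesis
    by unfold_locales (simp_all add: star_expand scaleR_add_right commute assoc mult.commute)
qed

text \<open>The maximum property enters squared, which makes both sides polynomials along
  \<open>e + s *\<^sub>R y\<close>. The first order condition yields the multiplication rule for
  \<open>e\<close>, the second order condition the bound on its eigenvalues.\<close>

lemma (in metrised_algebra) maximum_conditions:
  assumes e: "norm e = 1" "F e e e = 6" and mx: "\<And>x. (F x x x)^2 \<le> 36 * (x \<bullet> x)^3"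
  shows "e \<star> e = 6 *\<^sub>R e" "\<And>y. y \<bullet> e = 0 \<Longrightarrow> F e y y \<le> 3 * (y \<bullet> y)"
proof -
  have ee: "e \<bullet> e = 1" using e(1) by (simp add: norm_eq_1)
  have *: "F e e y = 0 \<and> F e y y \<le> 3 * (y \<bullet> y)" if y: "y \<bullet> e = 0" for y
  proof -
    define A \<phi> \<psi> N where "A = F e e y" and "\<phi> = F e y y" and "\<psi> = F y y y" and "N = y \<bullet> y"
    have main: "0 \<le> (- 36 * A) * s + (108 * N - 9 * A^2 - 36 * \<phi>) * s^2 + (- 12 * \<psi> - 18 * A * \<phi>) * s^3
      + (108 * N^2 - 6 * A * \<psi> - 9 * \<phi>^2) * s^4 + (- 6 * \<phi> * \<psi>) * s^5 + (36 * N^3 - \<psi>^2) * s^6" for s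
    proof -
      let ?x = "e + s *\<^sub>R y"
      have "F ?x ?x ?x = 6 + 3 * s * A + 3 * s^2 * \<phi> + s^3 * \<psi>"
        unfolding A_def \<phi>_def \<psi>_def
        by (simp add: F_expand e(2) F_swap12[of y e] F_swap23[of e y e] F_swap23[of y y e]
          algebra_simps power_numeral_reduce)
      moreover have "?x \<bullet> ?x = 1 + s^2 * N"
        using y by (simp add: N_def inner_add_left inner_add_right ee inner_commute[of e y]
          power2_eq_square)
      ultimately have "(6 + 3 * s * A + 3 * s^2 * \<phi> + s^3 * \<psi>)^2 \<le> 36 * (1 + s^2 * N)^3"
        using mx[of ?x] by simp
      then show ?thesis by (simp add: algebra_simps power_numeral_reduce)
    qed
    have "A = 0" "0 \<le> 108 * N - 9 * A^2 - 36 * \<phi>" using nonneg_near_zero_coeffs[OF main] by simp_all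
    then show ?thesis by (simp add: A_def \<phi>_def N_def)
  qed
  let ?v = "e \<star> e - 6 *\<^sub>R e"
  have ve: "?v \<bullet> e = 0" using e(2) ee by (simp add: inner_diff_left F_def)
  have "F e e ?v = 0" using *[OF ve] by blast
  moreover have "e \<bullet> ?v = 0" using ve by (simp add: inner_commute)
  ultimately have "?v \<bullet> ?v = 0" by (simp add: F_def inner_diff_left)
  then show "e \<star> e = 6 *\<^sub>R e" by simp
  show "F e y y \<le> 3 * (y \<bullet> y)" if "y \<bullet> e = 0" for y using *[OF that] by blast
qed

lemma radial_eigencubic_normalised:
  fixes f :: "real^'n \<Rightarrow> real"
  assumes "radial_eigencubic f"
  obtains c m e where "c \<noteq> 0" "harmonic_hsiang m e" "\<And>x. m x x \<bullet> x = 6 * (c * f x)"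
proof -
  have hom: "homogeneous_polynomial 3 f" and nz: "\<exists>x. f x \<noteq> 0"
    using assms by (auto simp: radial_eigencubic_def)
  obtain l where l: "l \<noteq> 0" "\<And>x. L_op f x = l * (norm x)\<^sup>2 * f x"
    using assms by (auto simp: radial_eigencubic_def)
  have f_hom: "f (t *\<^sub>R x) = t ^ 3 * f x" for t x using hom by (simp add: homogeneous_polynomial_def)
  obtain m0 where m0: "metrised_algebra m0" "\<And>x. m0 x x \<bullet> x = 6 * f x"
    using homogeneous_cubic_metrised_algebra[OF hom] by blast
  have "continuous_on (sphere 0 1) f"
    using hom by (simp add: homogeneous_polynomial_def real_polynomial_function_eq
      continuous_on_polymonial_function)
  moreover have "sphere (0 :: real^'n) 1 \<noteq> {}" by simp
  ultimately obtain e where e: "norm e = 1" "\<And>x. norm x = 1 \<Longrightarrow> f x \<le> f e"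
    using continuous_attains_sup[of "sphere 0 1" f] by auto
  have unit: "f x = norm x ^ 3 * f ((1 / norm x) *\<^sub>R x)" if "x \<noteq> 0" for x
    using f_hom[of "norm x" "(1 / norm x) *\<^sub>R x"] that by simp
  have odd: "f (- x) = - f x" for x using f_hom[of "- 1" x] by simp
  \<comment> \<open>As \<open>f\<close> is odd, its maximum on the sphere also bounds its absolute
    value.\<close>
  have bound: "\<bar>f x\<bar> \<le> norm x ^ 3 * f e" for x
  proof (cases "x = 0")
    case True
    then show ?thesis using f_hom[of 0 0] by simp
  next
    case False
    let ?u = "(1 / norm x) *\<^sub>R x"
    have "norm ?u = 1" using False by simp
    then have "f ?u \<le> f e" "f (- ?u) \<le> f e" by (auto intro!: e(2) simp del: norm_scaleR)
    then have "\<bar>f ?u\<bar> \<le> f e" using odd[of ?u] by linarith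
    then show ?thesis unfolding unit[OF False] by (simp add: abs_mult mult_left_mono)
  qed
  have "f e > 0"
  proof -
    obtain x where "f x \<noteq> 0" using nz by blast
    then have "0 < norm x ^ 3 * f e" using bound[of x] by linarith
    then show ?thesis by (simp add: zero_less_mult_iff)
  qed
  define c where "c = 1 / f e"
  have c: "c > 0" "c * f e = 1" using \<open>f e > 0\<close> by (simp_all add: c_def)
  define m where "m = (\<lambda>x y. c *\<^sub>R m0 x y)"
  interpret m0: metrised_algebra m0 by fact
  interpret metrised_algebra m unfolding m_def by (rule metrised_algebra_scale[OF m0(1)])
  have m: "m x y = c *\<^sub>R m0 x y" for x y by (simp add: m_def)
  have Fm: "F x y z = c * m0.F x y z" for x y z by (simp add: F_def m0.F_def m)
  have trm: "tr x = c * m0.tr x" for x by (simp add: tr_def m0.tr_def Fm sum_distrib_left)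
  have mf: "m x x \<bullet> x = 6 * (c * f x)" for x using m0(2)[of x] by (simp add: m)
  \<comment> \<open>The left side of the identity is cubic in the product and the right side linear,
    hence \<open>c^2\<close>; and 18 comes from the factor 1/4 in
    \<open>L_op_metrised_algebra\<close> together with \<open>12 * 6\<close>.\<close>
  define \<tau> where "\<tau> = c^2 * l / 18"
  have "hsiang_algebra m \<tau>"
  proof
    fix x
    have "(m0 x x \<bullet> m0 x x) * m0.tr x - m0.F x (m0 x x) (m0 x x) = 4 * (l * (x \<bullet> x) * f x)"
      using L_op_metrised_algebra[OF m0, of x] l(2)[of x] by (simp add: power2_norm_eq_inner)
    then have "c^3 * ((m0 x x \<bullet> m0 x x) * m0.tr x - m0.F x (m0 x x) (m0 x x))
        = c^3 * (4 * (l * (x \<bullet> x) * f x))"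
      by simp
    moreover have "m0.F x x x = 6 * f x" using m0(2) by (simp add: m0.F_def)
    ultimately show "(m x x \<bullet> m x x) * tr x - F x (m x x) (m x x) = 12 * \<tau> * (x \<bullet> x) * F x x x"
      by (simp add: trm Fm m m0.F_expand \<tau>_def algebra_simps power2_eq_square power3_eq_cube)
  qed
  then interpret hsiang_algebra m \<tau> .
  have Feee: "F e e e = 6" using mf[of e] c(2) by (simp add: F_def)
  have "(F x x x)^2 \<le> 36 * (x \<bullet> x)^3" for x
  proof -
    have "\<bar>c * f x\<bar> \<le> norm x ^ 3"
    proof -
      have "\<bar>c * f x\<bar> \<le> c * (norm x ^ 3 * f e)" using bound[of x] c(1) by (simp add: abs_mult)
      also have "\<dots> = norm x ^ 3 * (c * f e)" by simp
      finally show ?thesis using c(2) by simp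
    qed
    then have "(c * f x)^2 \<le> (norm x ^ 3)^2" using abs_le_square_iff[of "c * f x" "norm x ^ 3"] by simp
    also have "\<dots> = ((norm x)^2)^3" by (simp flip: power_mult)
    finally have "(c * f x)^2 \<le> (x \<bullet> x)^3" by (simp add: power2_norm_eq_inner)
    then show ?thesis using mf[of x] by (simp add: F_def power_mult_distrib)
  qed
  note mc = maximum_conditions[OF e(1) Feee this]
  interpret hsiang_idempotent m \<tau> e by unfold_locales (use e(1) mc(1) in auto)
  have "\<tau> \<noteq> 0" using c(1) l(1) by (simp add: \<tau>_def)
  then have "\<tau> = - 3" using tau_eq mc(2) by blast
  then have "harmonic_hsiang m e"
    using hsiang_idempotent_axioms by (simp add: harmonic_hsiang_def)
  then show ?thesis using that[of c m e] c(1) mf by simp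
qed

subsection \<open>Clifford cubics in coordinates\<close>

text \<open>Symmetry and the Clifford relations, written for entries, so that the matrices of
  existentially quantified size are met only in the two translation lemmas.\<close>

definition clifford_coefficients :: "nat \<Rightarrow> nat \<Rightarrow> (nat \<Rightarrow> nat \<Rightarrow> nat \<Rightarrow> real) \<Rightarrow> bool" where
  "clifford_coefficients n q a \<longleftrightarrow>
     (\<forall>i\<le>q. \<forall>j<n. \<forall>k<n. a i j k = a i k j) \<and>
     (\<forall>i\<le>q. \<forall>i'\<le>q. \<forall>j<n. \<forall>k<n.
        (\<Sum>l<n. a i j l * a i' l k) + (\<Sum>l<n. a i' j l * a i l k) = (if i = i' \<and> j = k then 2 else 0))"

text \<open>The vectors \<open>w\<close> are the rows of the orthogonal matrix, and \<open>a i\<close> holds the entries of \<open>A i\<close>.\<close>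

definition clifford_coordinates ::
    "(real^'n \<Rightarrow> real) \<Rightarrow> nat \<Rightarrow> nat \<Rightarrow> (nat \<Rightarrow> nat \<Rightarrow> nat \<Rightarrow> real) \<Rightarrow> (nat \<Rightarrow> real^'n) \<Rightarrow> real \<Rightarrow> bool" where
  "clifford_coordinates f m q a w c \<longleftrightarrow>
     m \<ge> 1 \<and> c \<noteq> 0 \<and> q + 1 + 2 * m = CARD('n) \<and>
     (\<forall>i<q + 1 + 2 * m. \<forall>j<q + 1 + 2 * m. w i \<bullet> w j = (if i = j then 1 else 0)) \<and>
     clifford_coefficients (2 * m) q a \<and> (q = 0 \<longrightarrow> (\<Sum>j<2 * m. a 0 j j) = 0) \<and>
     (\<forall>x. f x = c * (\<Sum>i\<le>q. (w i \<bullet> x) *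
        (\<Sum>j<2 * m. \<Sum>k<2 * m. a i j k * (w (q + 1 + j) \<bullet> x) * (w (q + 1 + k) \<bullet> x))))"

lemma mat_mult_entry:
  assumes "A \<in> carrier_mat n n" "B \<in> carrier_mat n n" "j < n" "k < n"
  shows "(A * B) $$ (j, k) = (\<Sum>l<n. A $$ (j, l) * B $$ (l, k))"
  using assms by (simp add: Matrix.scalar_prod_def lessThan_atLeast0)

lemma quadratic_form_entry:
  fixes A :: "real mat"
  assumes "A \<in> carrier_mat n n"
  shows "Matrix.scalar_prod (Matrix.vec n y) (A *\<^sub>v Matrix.vec n y)
      = (\<Sum>j<n. \<Sum>k<n. A $$ (j, k) * y j * y k)"
proof -
  have "Matrix.scalar_prod (Matrix.vec n y) (A *\<^sub>v Matrix.vec n y)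
      = (\<Sum>j<n. \<Sum>k<n. y j * (A $$ (j, k) * y k))"
    using assms by (simp add: Matrix.scalar_prod_def lessThan_atLeast0 mult_mat_vec_def sum_distrib_left)
  also have "\<dots> = (\<Sum>j<n. \<Sum>k<n. A $$ (j, k) * y j * y k)" by (intro sum.cong refl) simp
  finally show ?thesis .
qed

lemma clifford_coordinates_if_clifford_type:
  fixes f :: "real^'n \<Rightarrow> real"
  assumes "clifford_type f"
  shows "\<exists>m q a w c. clifford_coordinates f m q a w c"
proof -
  obtain m q A and b :: "nat \<Rightarrow> 'n" where A: "symmetric_clifford_system m q A"
    and b: "bij_betw b {..<q + 1 + 2 * m} UNIV"
    and cong: "congruent_cubics f (\<lambda>x. clifford_cubic q A (Matrix.vec (q + 1) (\<lambda>i. x $ b i))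
      (Matrix.vec (2 * m) (\<lambda>i. x $ b (q + 1 + i))))"
    using assms unfolding clifford_type_def by blast
  obtain U :: "real^'n^'n" and c where U: "orthogonal_matrix U" and c: "c \<noteq> 0"
    and f: "\<And>x. f x = c * clifford_cubic q A (Matrix.vec (q + 1) (\<lambda>i. (U *v x) $ b i))
      (Matrix.vec (2 * m) (\<lambda>i. (U *v x) $ b (q + 1 + i)))"
    using cong unfolding congruent_cubics_def by blast
  define a where "a = (\<lambda>i j k. A i $$ (j, k))"
  define w where "w = (\<lambda>i. row (b i) U)"
  have Uw: "(U *v x) $ b i = w i \<bullet> x" for x i
    by (simp add: w_def matrix_vector_mult_def row_def inner_vec_def)
  have carrier: "A i \<in> carrier_mat (2 * m) (2 * m)" if "i \<le> q" for i
    using A that by (simp add: symmetric_clifford_system_def)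
  have sym: "a i j k = a i k j" if "i \<le> q" "j < 2 * m" "k < 2 * m" for i j k
  proof -
    have "transpose_mat (A i) = A i" using A that by (simp add: symmetric_clifford_system_def)
    then have "A i $$ (j, k) = transpose_mat (A i) $$ (j, k)" by simp
    then show ?thesis using carrier[OF that(1)] that by (simp add: a_def)
  qed
  have cl: "(\<Sum>l<2 * m. a i j l * a i' l k) + (\<Sum>l<2 * m. a i' j l * a i l k) = (if i = i' \<and> j
      = k then 2 else 0)"
    if "i \<le> q" "i' \<le> q" "j < 2 * m" "k < 2 * m" for i i' j k
  proof -
    have "A i * A i' + A i' * A i = (if i = i' then 2 else 0) \<cdot>\<^sub>m 1\<^sub>m (2 * m)"
      using A that by (simp add: symmetric_clifford_system_def)
    then have "(A i * A i' + A i' * A i) $$ (j, k) = ((if i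
        = i' then 2 else 0) \<cdot>\<^sub>m 1\<^sub>m (2 * m)) $$ (j, k)"
      by simp
    moreover have "(A i * A i' + A i' * A i) $$ (j, k) = (A i * A i') $$ (j, k) + (A i' * A i) $$ (j, k)"
      using carrier[OF that(1)] carrier[OF that(2)] that by simp
    ultimately show ?thesis
      using mat_mult_entry[OF carrier[OF that(1)] carrier[OF that(2)] that(3,4)]
        mat_mult_entry[OF carrier[OF that(2)] carrier[OF that(1)] that(3,4)] that by (simp add: a_def)
  qed
  have "w i \<bullet> w j = (if i = j then 1 else 0)" if "i < q + 1 + 2 * m" "j < q + 1 + 2 * m" for i j
  proof -
    have "b i = b j \<longleftrightarrow> i = j" using b that by (auto simp: bij_betw_def inj_on_def)
    then show ?thesis using U by (auto simp: orthogonal_matrix_orthonormal_rows w_def norm_eq_1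
        orthogonal_def)
  qed
  moreover have "q + 1 + 2 * m = CARD('n)" using bij_betw_same_card[OF b] by simp
  moreover have "f x = c * (\<Sum>i\<le>q. (w i \<bullet> x) *
        (\<Sum>j<2 * m. \<Sum>k<2 * m. a i j k * (w (q + 1 + j) \<bullet> x) * (w (q + 1 + k) \<bullet> x)))" for x
    unfolding f clifford_cubic_def Uw
    by (intro arg_cong[of _ _ "(*) c"] sum.cong refl) (simp add: quadratic_form_entry[OF carrier] a_def)
  moreover have "q = 0 \<longrightarrow> (\<Sum>j<2 * m. a 0 j j) = 0" "m \<ge> 1"
    using A by (auto simp: symmetric_clifford_system_def a_def)
  ultimately have "clifford_coordinates f m q a w c"
    using c sym cl unfolding clifford_coordinates_def clifford_coefficients_def by blast
  then show ?thesis by blast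
qed

lemma clifford_type_if_clifford_coordinates:
  fixes f :: "real^'n \<Rightarrow> real"
  assumes "clifford_coordinates f m q a w c"
  shows "clifford_type f"
proof -
  have m: "m \<ge> 1" and c: "c \<noteq> 0" and card: "q + 1 + 2 * m = CARD('n)"
    and on: "\<And>i j. i < q + 1 + 2 * m \<Longrightarrow> j < q + 1 + 2 * m \<Longrightarrow> w i \<bullet> w j = (if i = j then 1 else 0)"
    and sym: "\<And>i j k. i \<le> q \<Longrightarrow> j < 2 * m \<Longrightarrow> k < 2 * m \<Longrightarrow> a i j k = a i k j"
    and cl: "\<And>i i' j k. i \<le> q \<Longrightarrow> i' \<le> q \<Longrightarrow> j < 2 * m \<Longrightarrow> k < 2 * m \<Longrightarrow>
       (\<Sum>l<2 * m. a i j l * a i' l k) + (\<Sum>l<2 * m. a i' j l * a i l k) = (if i = i' \<and> j = k then 2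
           else 0)"
    and tr: "q = 0 \<Longrightarrow> (\<Sum>j<2 * m. a 0 j j) = 0"
    and f: "\<And>x. f x = c * (\<Sum>i\<le>q. (w i \<bullet> x) *
        (\<Sum>j<2 * m. \<Sum>k<2 * m. a i j k * (w (q + 1 + j) \<bullet> x) * (w (q + 1 + k) \<bullet> x)))"
    using assms unfolding clifford_coordinates_def clifford_coefficients_def by blast+
  define A where "A = (\<lambda>i. Matrix.mat (2 * m) (2 * m) (\<lambda>(j, k). a i j k))"
  have carrier: "A i \<in> carrier_mat (2 * m) (2 * m)" for i by (simp add: A_def)
  have entry: "A i $$ (j, k) = a i j k" if "j < 2 * m" "k < 2 * m" for i j k using that
      by (simp add: A_def)
  obtain b :: "nat \<Rightarrow> 'n" where b: "bij_betw b {..<q + 1 + 2 * m} UNIV"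
    using ex_bij_betw_nat_finite[of "UNIV :: 'n set"] card by (auto simp: lessThan_atLeast0)
  define b' where "b' = inv_into {..<q + 1 + 2 * m} b"
  have b'b: "b' (b i) = i" if "i < q + 1 + 2 * m" for i
    using b that by (simp add: b'_def bij_betw_def inv_into_f_f)
  have bb': "b (b' k) = k" "b' k < q + 1 + 2 * m" for k
  proof -
    have k: "k \<in> b ` {..<q + 1 + 2 * m}" using b by (simp add: bij_betw_def)
    show "b (b' k) = k" unfolding b'_def by (rule f_inv_into_f[OF k])
    show "b' k < q + 1 + 2 * m" using inv_into_into[OF k] by (simp add: b'_def)
  qed
  define U :: "real^'n^'n" where "U = (\<chi> k. w (b' k))"
  have row: "row k U = w (b' k)" for k by (simp add: row_def U_def)
  have Uw: "(U *v x) $ b i = w i \<bullet> x" if "i < q + 1 + 2 * m" for x i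
    using b'b[OF that] by (simp add: U_def matrix_vector_mult_def inner_vec_def)
  have "orthogonal_matrix U"
    unfolding orthogonal_matrix_orthonormal_rows row
  proof (intro conjI allI impI)
    show "norm (w (b' i)) = 1" for i using on[OF bb'(2) bb'(2)] by (simp add: norm_eq_1)
    show "orthogonal (w (b' i)) (w (b' j))" if "i \<noteq> j" for i j
      using on[OF bb'(2) bb'(2), of i j] that bb'(1) by (metis orthogonal_def)
  qed
  moreover have "f x = c * clifford_cubic q A (Matrix.vec (q + 1) (\<lambda>i. (U *v x) $ b i))
      (Matrix.vec (2 * m) (\<lambda>i. (U *v x) $ b (q + 1 + i)))" for x
    unfolding f clifford_cubic_def quadratic_form_entry[OF carrier]
    by (intro arg_cong[of _ _ "(*) c"] sum.cong refl) (simp add: entry Uw)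
  ultimately have "congruent_cubics f (\<lambda>x. clifford_cubic q A (Matrix.vec (q + 1) (\<lambda>i. x $ b i))
      (Matrix.vec (2 * m) (\<lambda>i. x $ b (q + 1 + i))))"
    unfolding congruent_cubics_def using c by blast
  moreover have "symmetric_clifford_system m q A"
    unfolding symmetric_clifford_system_def
  proof (intro conjI allI impI)
    show "m \<ge> 1" by (rule m)
    show "A i \<in> carrier_mat (2 * m) (2 * m)" for i by (rule carrier)
    show "transpose_mat (A i) = A i" if "i \<le> q" for i
      using sym[OF that] carrier[of i] by (intro eq_matI) (auto simp: entry)
    show "A i * A j + A j * A i = (if i = j then 2 else 0) \<cdot>\<^sub>m 1\<^sub>m (2 * m)" if "i \<le> q" "j \<le> q" for i j
    proof (rule eq_matI)
      fix k l assume "k < dim_row ((if i = j then 2 else 0) \<cdot>\<^sub>m 1\<^sub>m (2 * m) :: real mat)"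
        "l < dim_col ((if i = j then 2 else 0) \<cdot>\<^sub>m 1\<^sub>m (2 * m) :: real mat)"
      then have kl: "k < 2 * m" "l < 2 * m" by auto
      have "(A i * A j + A j * A i) $$ (k, l) = (A i * A j) $$ (k, l) + (A j * A i) $$ (k, l)"
        using kl carrier[of i] carrier[of j] by simp
      then show "(A i * A j + A j * A i) $$ (k, l) = ((if i
          = j then 2 else 0) \<cdot>\<^sub>m 1\<^sub>m (2 * m)) $$ (k, l)"
        using cl[OF that kl] kl mat_mult_entry[OF carrier[of i] carrier[of j] kl]
          mat_mult_entry[OF carrier[of j] carrier[of i] kl] by (simp add: entry)
    qed (use carrier[of i] carrier[of j] in auto)
    show "(\<Sum>j<2 * m. A 0 $$ (j, j)) = 0" if "q = 0" using tr[OF that] by (simp add: entry)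
  qed
  ultimately show ?thesis unfolding clifford_type_def using b by blast
qed

text \<open>For A_z, the sum of the z_i A_i, this says |A_z y|^2 = |z|^2 |y|^2. The double sum over
  \<open>i\<close> and \<open>i'\<close> is symmetrised, since the relations control only
  \<open>M i i' + M i' i\<close>.\<close>

lemma clifford_coefficients_norm:
  assumes "clifford_coefficients n q a"
  shows "(\<Sum>k<n. (\<Sum>i\<le>q. \<Sum>j<n. z i * y j * a i j k)^2) = (\<Sum>i\<le>q. (z i)^2) * (\<Sum>j<n. (y j)^2)"
proof -
  define M where "M = (\<lambda>i i'. \<Sum>k<n. (\<Sum>j<n. y j * a i j k) * (\<Sum>j<n. y j * a i' j k))"
  have M: "M i i' + M i' i = (if i = i' then 2 * (\<Sum>j<n. (y j)^2) else 0)" if i: "i \<le> q" "i' \<le> q" for i i'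
  proof -
    have e: "M i i' = (\<Sum>j<n. \<Sum>j'<n. y j * y j' * (\<Sum>k<n. a i j k * a i' k j'))"
        if i: "i \<le> q" "i' \<le> q" for i i'
    proof -
      have "M i i' = (\<Sum>k<n. \<Sum>j<n. \<Sum>j'<n. (y j * a i j k) * (y j' * a i' j' k))"
        by (simp add: M_def sum_product)
      also have "\<dots> = (\<Sum>j<n. \<Sum>k<n. \<Sum>j'<n. (y j * a i j k) * (y j' * a i' j' k))" by (rule sum.swap)
      also have "\<dots> = (\<Sum>j<n. \<Sum>j'<n. \<Sum>k<n. (y j * a i j k) * (y j' * a i' j' k))"
        by (intro sum.cong refl sum.swap)
      also have "\<dots> = (\<Sum>j<n. \<Sum>j'<n. y j * y j' * (\<Sum>k<n. a i j k * a i' k j'))"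
      proof (intro sum.cong refl)
        fix j j' assume "j \<in> {..<n}" "j' \<in> {..<n}"
        then have "a i' j' k = a i' k j'" if "k < n" for k
          using assms i that by (simp add: clifford_coefficients_def)
        then show "(\<Sum>k<n. (y j * a i j k) * (y j' * a i' j' k))
            = y j * y j' * (\<Sum>k<n. a i j k * a i' k j')"
          by (simp add: sum_distrib_left mult.assoc mult.left_commute)
      qed
      finally show ?thesis .
    qed
    have "M i i' + M i' i = (\<Sum>j<n. \<Sum>j'<n. y j * y j' *
        ((\<Sum>k<n. a i j k * a i' k j') + (\<Sum>k<n. a i' j k * a i k j')))"
      by (simp add: e i sum.distrib distrib_left)
    also have "\<dots> = (\<Sum>j<n. \<Sum>j'<n. y j * y j' * (if i = i' \<and> j = j' then 2 else 0))"
    proof (intro sum.cong refl)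
      fix j j' assume "j \<in> {..<n}" "j' \<in> {..<n}"
      then have "(\<Sum>k<n. a i j k * a i' k j') + (\<Sum>k<n. a i' j k * a i k j') = (if i = i' \<and> j
          = j' then 2 else 0)"
        using assms i unfolding clifford_coefficients_def by blast
      then show "y j * y j' * ((\<Sum>k<n. a i j k * a i' k j') + (\<Sum>k<n. a i' j k * a i k j'))
        = y j * y j' * (if i = i' \<and> j = j' then 2 else 0)" by (simp only:)
    qed
    also have "\<dots> = (if i = i' then 2 * (\<Sum>j<n. (y j)^2) else 0)"
    proof (cases "i = i'")
      case True
      then have "(\<Sum>j<n. \<Sum>j'<n. y j * y j' * (if i = i' \<and> j = j' then 2 else 0))
        = (\<Sum>j<n. \<Sum>j'<n. if j = j' then y j * y j' * 2 else 0)"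
        by (intro sum.cong refl) auto
      also have "\<dots> = (\<Sum>j<n. y j * y j * 2)" by (simp add: sum.delta)
      finally show ?thesis using True by (simp add: sum_distrib_left power2_eq_square mult.commute)
    qed simp
    finally show ?thesis .
  qed
  have "(\<Sum>k<n. (\<Sum>i\<le>q. \<Sum>j<n. z i * y j * a i j k)^2) = (\<Sum>i\<le>q. \<Sum>i'\<le>q. z i * z i' * M i i')" (is "?L = _")
  proof -
    have "(\<Sum>i\<le>q. \<Sum>j<n. z i * y j * a i j k)^2 = (\<Sum>i\<le>q. \<Sum>i'\<le>q. z i * z i' * ((\<Sum>j<n. y j * a i j k) *
        (\<Sum>j<n. y j * a i' j k)))" for k
    proof -
      have "(\<Sum>i\<le>q. \<Sum>j<n. z i * y j * a i j k) = (\<Sum>i\<le>q. z i * (\<Sum>j<n. y j * a i j k))"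
        by (simp add: sum_distrib_left mult.assoc)
      then show ?thesis by (simp add: power2_eq_square sum_product mult.assoc mult.left_commute)
    qed
    then have "?L = (\<Sum>k<n. \<Sum>i\<le>q. \<Sum>i'\<le>q. z i * z i' * ((\<Sum>j<n. y j * a i j k) * (\<Sum>j<n. y j * a i' j
        k)))" by simp
    also have "\<dots> = (\<Sum>i\<le>q. \<Sum>k<n. \<Sum>i'\<le>q. z i * z i' * ((\<Sum>j<n. y j * a i j k) * (\<Sum>j<n. y j * a i' j
        k)))" by (rule sum.swap)
    also have "\<dots> = (\<Sum>i\<le>q. \<Sum>i'\<le>q. \<Sum>k<n. z i * z i' * ((\<Sum>j<n. y j * a i j k) * (\<Sum>j<n. y j * a i' j k)))"
      by (intro sum.cong refl sum.swap)
    finally show ?thesis by (simp add: M_def sum_distrib_left)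
  qed
  moreover have "(\<Sum>i\<le>q. \<Sum>i'\<le>q. z i * z i' * M i i') = (\<Sum>i\<le>q. \<Sum>i'\<le>q. z i * z i' * M i' i)"
    by (subst sum.swap) (simp add: mult.commute)
  ultimately have "2 * ?L = (\<Sum>i\<le>q. \<Sum>i'\<le>q. z i * z i' * (M i i' + M i' i))"
    by (simp add: sum.distrib distrib_left)
  also have "\<dots> = (\<Sum>i\<le>q. \<Sum>i'\<le>q. if i = i' then z i * z i' * (2 * (\<Sum>j<n. (y j)^2)) else 0)"
    by (intro sum.cong refl) (simp add: M)
  also have "\<dots> = (\<Sum>i\<le>q. z i * z i * (2 * (\<Sum>j<n. (y j)^2)))" by simp
  also have "\<dots> = (\<Sum>i\<le>q. z i * z i) * (2 * (\<Sum>j<n. (y j)^2))" by (simp only: sum_distrib_right)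
  also have "\<dots> = 2 * ((\<Sum>i\<le>q. (z i)^2) * (\<Sum>j<n. (y j)^2))" by (simp add: power2_eq_square)
  finally show ?thesis by simp
qed

lemma orthonormal_enumeration:
  assumes h: "bij_betw h {..<n} B" and B: "pairwise orthogonal B" "\<And>b. b \<in> B \<Longrightarrow> norm b = 1"
    and ij: "i < n" "j < n"
  shows "h i \<bullet> h j = (if i = j then 1 else 0)"
proof -
  have in_B: "h i \<in> B" "h j \<in> B" using h ij by (auto simp: bij_betw_def)
  moreover have "h i = h j \<longleftrightarrow> i = j" using h ij by (auto simp: bij_betw_def inj_on_def)
  ultimately show ?thesis using B by (auto simp: pairwise_def orthogonal_def norm_eq_1)
qed

lemma parseval_span:
  fixes x y :: "'a::euclidean_space"
  assumes B: "pairwise orthogonal B" "\<And>b. b \<in> B \<Longrightarrow> norm b = 1" "finite B" and x: "x \<in> span B"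
  shows "(\<Sum>b\<in>B. (x \<bullet> b) * (b \<bullet> y)) = x \<bullet> y"
proof -
  have "x \<bullet> y = (\<Sum>b\<in>B. (x \<bullet> b) *\<^sub>R b) \<bullet> y" using orthonormal_basis_expand[OF B(1,2) x B(3)] by simp
  then show ?thesis by (simp add: inner_sum_left)
qed

section \<open>Consequences of a splitting of Clifford type\<close>

context metrised_algebra
begin

lemma F_sum1: "F (\<Sum>i\<in>I. c i *\<^sub>R u i) y z = (\<Sum>i\<in>I. c i * F (u i) y z)"
proof -
  have lin: "linear (\<lambda>x. F x y z)" by (rule linearI) (simp_all add: F_expand)
  show ?thesis using linear_sum[OF lin, of "\<lambda>i. c i *\<^sub>R u i" I] by (simp add: F_expand)
qed

lemma F_sum2: "F x (\<Sum>i\<in>I. c i *\<^sub>R u i) z = (\<Sum>i\<in>I. c i * F x (u i) z)"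
  using F_sum1[of c u I x z] by (simp add: F_swap12[of _ x])

lemma F_sum3: "F x y (\<Sum>i\<in>I. c i *\<^sub>R u i) = (\<Sum>i\<in>I. c i * F x y (u i))"
  using F_sum2[of x c u I y] by (simp add: F_swap23[of x _ y])

context
  fixes Z Y k assumes split: "clifford_split Z Y k"
begin

lemma split_facts:
  "subspace Z" "subspace Y" "k > 0" "\<And>z y. z \<in> Z \<Longrightarrow> y \<in> Y \<Longrightarrow> z \<bullet> y = 0"
  "\<And>x. \<exists>z\<in>Z. \<exists>y\<in>Y. x = z + y" "\<And>z z'. z \<in> Z \<Longrightarrow> z' \<in> Z \<Longrightarrow> z \<star> z' = 0"
  "\<And>x y z. x \<in> Y \<Longrightarrow> y \<in> Y \<Longrightarrow> z \<in> Y \<Longrightarrow> F x y z = 0"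
  "\<And>z y. z \<in> Z \<Longrightarrow> y \<in> Y \<Longrightarrow> (z \<star> y) \<bullet> (z \<star> y) = k * (z \<bullet> z) * (y \<bullet> y)"
  using split unfolding clifford_split_def by blast+

lemma split_Y_I:
  assumes "\<And>z. z \<in> Z \<Longrightarrow> z \<bullet> u = 0"
  shows "u \<in> Y"
proof -
  obtain z y where zy: "z \<in> Z" "y \<in> Y" "u = z + y" using split_facts(5) by blast
  have "z \<bullet> z = 0" using assms[OF zy(1)] split_facts(4)[OF zy(1,2)] unfolding zy(3)
      by (simp add: inner_add_right)
  then show ?thesis using zy by simp
qed

lemma split_Z_I:
  assumes "\<And>y. y \<in> Y \<Longrightarrow> u \<bullet> y = 0"
  shows "u \<in> Z"
proof -
  obtain z y where zy: "z \<in> Z" "y \<in> Y" "u = z + y" using split_facts(5) by blast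
  have "y \<bullet> y = 0" using assms[OF zy(2)] split_facts(4)[OF zy(1,2)] unfolding zy(3)
      by (simp add: inner_add_left)
  then show ?thesis using zy by simp
qed

lemma split_star_Y: "z \<in> Z \<Longrightarrow> z \<star> u \<in> Y"
  by (rule split_Y_I) (simp add: inner_star F_def split_facts(6))

lemma split_star_Z: "x \<in> Y \<Longrightarrow> y \<in> Y \<Longrightarrow> x \<star> y \<in> Z"
  by (rule split_Z_I) (simp add: split_facts(7) flip: F_def)

lemma split_polar:
  assumes z: "z \<in> Z" "z' \<in> Z" and y: "y \<in> Y" "y' \<in> Y"
  shows "(z \<star> y) \<bullet> (z' \<star> y') + (z' \<star> y) \<bullet> (z \<star> y') = 2 * k * (z \<bullet> z') * (y \<bullet> y')"
proof -
  have p: "(z \<star> v) \<bullet> (z' \<star> v) = k * (z \<bullet> z') * (v \<bullet> v)" if "v \<in> Y" for v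
  proof -
    have "z + z' \<in> Z" using z split_facts(1) by (simp add: subspace_add)
    from split_facts(8)[OF this that] split_facts(8)[OF z(1) that] split_facts(8)[OF z(2) that] show
        ?thesis
      by (simp add: star_expand inner_add_left inner_add_right inner_commute[of "z' \<star> v" "z \<star> v"]
          inner_commute[of z' z] algebra_simps)
  qed
  have "y + y' \<in> Y" using y split_facts(2) by (simp add: subspace_add)
  from p[OF this] p[OF y(1)] p[OF y(2)] show ?thesis
    by (simp add: star_expand inner_add_left inner_add_right inner_commute[of "z \<star> y'" "z' \<star> y"]
        inner_commute[of y' y] algebra_simps)
qed

lemma F_split: "z \<in> Z \<Longrightarrow> y \<in> Y \<Longrightarrow> F (z + y) (z + y) (z + y) = 3 * F z y y"
proof -
  assume zy: "z \<in> Z" "y \<in> Y"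
  have "F z z u = 0" for u using split_facts(6)[OF zy(1,1)] by (simp add: F_def)
  moreover have "F y y y = 0" using split_facts(7) zy by blast
  ultimately show ?thesis by (simp add: F_expand F_swap12[of y z] F_swap23[of _ y z])
qed

text \<open>Products within \<open>Z\<close> vanish, so the whole trace of multiplication by
  \<open>z\<close> comes from \<open>Y\<close>.\<close>

lemma split_trace:
  assumes B: "B \<subseteq> Y" "pairwise orthogonal B" "\<And>b. b \<in> B \<Longrightarrow> norm b = 1" "finite B" "span B = Y"
    and z: "z \<in> Z" "tr z = 0"
  shows "(\<Sum>b\<in>B. F z b b) = 0"
proof -
  obtain B1 where B1: "B1 \<subseteq> Z" "pairwise orthogonal B1" "\<And>x. x \<in> B1 \<Longrightarrow> norm x = 1"
    "independent B1" "card B1 = dim Z" "span B1 = Z"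
        using orthonormal_basis_subspace[OF split_facts(1)] by metis
  have fin: "finite B1" using B1(4) by (simp add: independent_imp_finite)
  note un = orthonormal_basis_Un[OF B1(1-3) fin B1(6) B split_facts(4,5)]
  have "tr z = (\<Sum>b\<in>B1 \<union> B. F z b b)"
    using un(2,3) B1(3) B(3,4) fin by (intro tr_orthonormal_basis) auto
  also have "\<dots> = (\<Sum>b\<in>B1. F z b b) + (\<Sum>b\<in>B. F z b b)"
    using un(1) fin B(4) by (intro sum.union_disjoint) auto
  also have "(\<Sum>b\<in>B1. F z b b) = 0"
    using B1(1) split_facts(6)[OF z(1)] by (intro sum.neutral) (auto simp: F_def)
  finally show ?thesis using z(2) by simp
qed

text \<open>Multiplication by the unit vector \<open>z\<close> has only the eigenvalues
  \<open>sqrt k\<close> and \<open>- sqrt k\<close> on \<open>Y\<close>. Trace zero makes their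
  multiplicities equal, which is why \<open>Y\<close> has the even dimension of a Clifford
  system.\<close>

lemma split_eigenbasis:
  assumes z: "z \<in> Z" "norm z = 1" "tr z = 0"
  obtains B where "B \<subseteq> Y" "pairwise orthogonal B" "\<And>b. b \<in> B \<Longrightarrow> norm b = 1" "finite B" "span B = Y"
    "even (card B)"
proof -
  have "(z \<star> x) \<bullet> y = x \<bullet> (z \<star> y)" for x y using assoc[of x z y] by (simp only: commute[of x z])
  then obtain B where B: "B \<subseteq> Y" "pairwise orthogonal B" "\<forall>b\<in>B. norm b = 1" "finite B" "span B = Y"
    and ev: "\<forall>b\<in>B. \<exists>c. z \<star> b = c *\<^sub>R b"
    using self_adjoint_eigenbasis[OF linear_star[of z] split_facts(2)] split_star_Y[OF z(1)] by blast
  have zz: "z \<bullet> z = 1" using z(2) by (simp add: norm_eq_1)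
  have F: "F z b b = sqrt k \<or> F z b b = - sqrt k" if b: "b \<in> B" for b
  proof -
    obtain c where c: "z \<star> b = c *\<^sub>R b" using ev b by blast
    have bb: "b \<bullet> b = 1" using B(3) b by (simp add: norm_eq_1)
    have "c * c = k" using split_facts(8)[OF z(1), of b] b B(1) by (auto simp: c bb zz)
    then have "c^2 = (sqrt k)^2" using split_facts(3) by (simp add: power2_eq_square)
    then have "c = sqrt k \<or> c = - sqrt k" unfolding power2_eq_iff .
    then show ?thesis by (simp add: F_def c bb)
  qed
  define P where "P = {b \<in> B. F z b b = sqrt k}"
  have k: "sqrt k > 0" using split_facts(3) by simp
  have fin: "finite P" "P \<subseteq> B" using B(4) by (auto simp: P_def)
  have "0 = (\<Sum>b\<in>B. F z b b)" using split_trace[OF B(1,2) _ B(4,5) z(1,3)] B(3) by simp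
  also have "\<dots> = (\<Sum>b\<in>P. F z b b) + (\<Sum>b\<in>B - P. F z b b)"
    using sum.subset_diff[OF fin(2) B(4), of "\<lambda>b. F z b b"] by simp
  also have "(\<Sum>b\<in>P. F z b b) = (\<Sum>b\<in>P. sqrt k)" by (simp add: P_def)
  also have "(\<Sum>b\<in>B - P. F z b b) = (\<Sum>b\<in>B - P. - sqrt k)" using F by (intro sum.cong) (auto simp: P_def)
  finally have "sqrt k * (real (card P) - real (card (B - P))) = 0" by (auto simp: algebra_simps)
  then have "card P = card (B - P)" using k by simp
  moreover have "card B = card P + card (B - P)"
    using card_Diff_subset[OF fin] card_mono[OF B(4) fin(2)] by simp
  ultimately have "even (card B)" by simp
  then show ?thesis using that[OF B(1,2) _ B(4,5)] B(3) by blast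
qed

text \<open>The \<open>Z\<close>-component of an eigenvector for the eigenvalue \<open>- 3\<close> turns out to be parallel to that of \<open>e\<close>.\<close>

lemma split_idempotent:
  assumes e: "norm e = 1" "e \<star> e = 6 *\<^sub>R e"
  obtains z where "\<And>h. e \<star> h = (- 3) *\<^sub>R h \<Longrightarrow> F h h h = 9 * (z \<bullet> h) * F z h h"
    "\<exists>h. e \<star> h = (- 3) *\<^sub>R h \<and> F h h h \<noteq> 0"
proof -
  obtain z y where zy: "z \<in> Z" "y \<in> Y" and e_zy: "e = z + y" using split_facts(5) by blast
  have zY: "z \<star> y \<in> Y" and yZ: "y \<star> y \<in> Z" using split_star_Y[OF zy(1)] split_star_Z[OF zy(2,2)] by auto
  have zero: "u = 0" if "u \<in> Z" "u \<in> Y" for u using split_facts(4)[OF that] by simp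
  \<comment> \<open>Here \<open>z \<star> y\<close> lies in \<open>Y\<close> and
    \<open>y \<star> y\<close> in \<open>Z\<close>, so the equation separates into two.\<close>
  have "2 *\<^sub>R (z \<star> y) + y \<star> y = 6 *\<^sub>R z + 6 *\<^sub>R y"
    using e(2) split_facts(6)[OF zy(1,1)] unfolding e_zy
    by (simp add: star_expand commute[of y z] scaleR_2 scaleR_add_right add.assoc)
  then have eq: "2 *\<^sub>R (z \<star> y) - 6 *\<^sub>R y = 6 *\<^sub>R z - y \<star> y" by (simp add: algebra_simps)
  have "2 *\<^sub>R (z \<star> y) - 6 *\<^sub>R y \<in> Y" using zY zy split_facts(2)
      by (simp add: subspace_diff subspace_scale)
  moreover have "6 *\<^sub>R z - y \<star> y \<in> Z" using yZ zy split_facts(1)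
      by (simp add: subspace_diff subspace_scale)
  ultimately have "2 *\<^sub>R (z \<star> y) - 6 *\<^sub>R y = 0" "6 *\<^sub>R z - y \<star> y = 0" using eq zero by metis+
  then have "2 *\<^sub>R (z \<star> y) = 2 *\<^sub>R (3 *\<^sub>R y)" and yy: "y \<star> y = 6 *\<^sub>R z" by simp_all
  then have zy3: "z \<star> y = 3 *\<^sub>R y" unfolding scaleR_cancel_left by simp
  have ne: "z \<bullet> z + y \<bullet> y = 1"
    using e(1) split_facts(4)[OF zy] unfolding e_zy norm_eq_1
      by (simp add: inner_add_left inner_add_right inner_commute[of y z])
  have "F y y z = F z y y" by (simp add: F_swap12[of z y] F_swap23[of y z y])
  \<comment> \<open>Two evaluations of \<open>F z y y\<close>, one by each of the separated
    equations, fix the ratio of the norms.\<close>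
  then have "6 * (z \<bullet> z) = 3 * (y \<bullet> y)" by (simp add: F_def yy zy3)
  then have zz: "z \<bullet> z = 1 / 3" and yy2: "y \<bullet> y = 2 / 3" using ne by simp_all
  have "e \<star> h = (- 3) *\<^sub>R h \<Longrightarrow> F h h h = 9 * (z \<bullet> h) * F z h h" for h
  proof -
    assume h: "e \<star> h = (- 3) *\<^sub>R h"
    obtain z' y' where zy': "z' \<in> Z" "y' \<in> Y" and h_zy: "h = z' + y'" using split_facts(5) by blast
    \<comment> \<open>The eigenvector equation is paired with \<open>u \<star> y\<close>. Because
      \<open>u\<close> is orthogonal to \<open>z\<close>, \<open>split_polar\<close> makes the terms
      with \<open>y'\<close> cancel, leaving the inner product of \<open>z'\<close> and
      \<open>u\<close>.\<close>
    have perp: "u \<bullet> z' = 0" if u: "u \<in> Z" "u \<bullet> z = 0" for u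
    proof -
      have uy: "u \<star> y \<in> Y" using split_star_Y[OF u(1)] .
      have "(e \<star> h) \<bullet> (u \<star> y) = - 3 * (y' \<bullet> (u \<star> y))"
        unfolding h using split_facts(4)[OF zy'(1) uy] by (simp add: h_zy inner_add_left)
      moreover have "(e \<star> h) \<bullet> (u \<star> y) = (z \<star> y') \<bullet> (u \<star> y) + (z' \<star> y) \<bullet> (u \<star> y)"
        using split_facts(6)[OF zy(1) zy'(1)] split_facts(7)[OF zy(2) zy'(2) uy]
        by (simp add: e_zy h_zy star_expand inner_add_left commute[of y z'] flip: F_def)
      moreover have "(z \<star> y') \<bullet> (u \<star> y) = - 3 * (y' \<bullet> (u \<star> y))"
      proof -
        have "(z \<star> y') \<bullet> (u \<star> y) + (u \<star> y') \<bullet> (z \<star> y) = 0"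
          using split_polar[OF zy(1) u(1) zy'(2) zy(2)] u(2) by (simp add: inner_commute[of z u])
        moreover have "(u \<star> y') \<bullet> y = y' \<bullet> (u \<star> y)"
          using assoc[of y' u y] by (simp only: commute[of y' u])
        ultimately show ?thesis by (simp add: zy3)
      qed
      ultimately have "(z' \<star> y) \<bullet> (u \<star> y) = 0" by simp
      then have "2 * k * (z' \<bullet> u) * (y \<bullet> y) = 0"
        using split_polar[OF zy'(1) u(1) zy(2,2)] by (simp add: inner_commute[of "u \<star> y"])
      then show ?thesis using split_facts(3) yy2 by (simp add: inner_commute)
    qed
    define s where "s = 3 * (z \<bullet> z')"
    have "z' - s *\<^sub>R z \<in> Z" using zy zy' split_facts(1) by (simp add: subspace_diff subspace_scale)
    moreover have zs: "(z' - s *\<^sub>R z) \<bullet> z = 0"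
        by (simp add: s_def inner_diff_left zz inner_commute[of z z'])
    ultimately have "(z' - s *\<^sub>R z) \<bullet> z' = 0" by (rule perp)
    then have "(z' - s *\<^sub>R z) \<bullet> (z' - s *\<^sub>R z) = 0" using zs by (simp add: inner_diff_right)
    then have z': "z' = s *\<^sub>R z" by simp
    have Fz: "F z z u = 0" for u using split_facts(6)[OF zy(1,1)] by (simp add: F_def)
    have "F h h h = 3 * s * F z y' y'" unfolding h_zy F_split[OF zy'] by (simp add: z' F_expand)
    moreover have "F z h h = F z y' y'"
      unfolding h_zy z' by (simp add: F_expand Fz F_swap23[of z y' z])
    moreover have "z \<bullet> h = s / 3" unfolding h_zy z' using split_facts(4)[OF zy(1) zy'(2)]
        by (simp add: inner_add_right zz)
    ultimately show ?thesis by simp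
  qed
  moreover have "\<exists>h. e \<star> h = (- 3) *\<^sub>R h \<and> F h h h \<noteq> 0"
  proof (intro exI conjI)
    \<comment> \<open>The direction in the plane of \<open>z\<close> and \<open>y\<close> that is
      orthogonal to \<open>e\<close>, by the norms 1/3 and 2/3.\<close>
    let ?h = "2 *\<^sub>R z + (- 1) *\<^sub>R y"
    have "e \<star> ?h = 2 *\<^sub>R (y \<star> z) - z \<star> y - y \<star> y"
      using split_facts(6)[OF zy(1,1)] unfolding e_zy by (simp add: star_expand)
    also have "\<dots> = (- 3) *\<^sub>R ?h" by (simp add: commute[of y z] zy3 yy algebra_simps flip:
        scaleR_add_left)
    finally show "e \<star> ?h = (- 3) *\<^sub>R ?h" .
    have "2 *\<^sub>R z \<in> Z" "(- 1) *\<^sub>R y \<in> Y"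
      using subspace_scale[OF split_facts(1) zy(1), of 2] subspace_scale[OF split_facts(2) zy(2), of
        "- 1"] by simp_all
    from F_split[OF this] have "F ?h ?h ?h = 6 * F z y y" by (simp add: F_expand)
    also have "F z y y = 2" by (simp add: F_def zy3 yy2)
    finally show "F ?h ?h ?h \<noteq> 0" by simp
  qed
  ultimately show ?thesis using that by blast
qed

end

end

text \<open>Orthonormal bases of \<open>Z\<close> and \<open>Y\<close> serve as the rows of the
  orthogonal matrix. The entries of the Clifford system are those of multiplication by basis vectors
  of \<open>Z\<close> on \<open>Y\<close>, and the scalar \<open>r / (2 * c)\<close> comes from
  \<open>3 * F z y y = 6 * (c * f x)\<close>.\<close>

lemma clifford_type_if_split:
  fixes f :: "real^'n \<Rightarrow> real"
  assumes m: "metrised_algebra m" and split: "metrised_algebra.clifford_split m Z Y k" and Z: "Z \<noteq> {0}"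
    and tr: "\<And>x. metrised_algebra.tr m x = 0" and c: "c \<noteq> 0" and f: "\<And>x. m x x \<bullet> x = 6 * (c * f x)"
    and nz: "\<exists>x. f x \<noteq> 0"
  shows "clifford_type f"
proof -
  interpret metrised_algebra m by (rule m)
  note facts = split_facts[OF split]
  obtain z1 where "z1 \<in> Z" "z1 \<noteq> 0" using Z subspace_0[OF facts(1)] by blast
  then have "(1 / norm z1) *\<^sub>R z1 \<in> Z" "norm ((1 / norm z1) *\<^sub>R z1) = 1"
    using facts(1) by (simp_all add: subspace_scale)
  from split_eigenbasis[OF split this tr] obtain BY where BY: "BY \<subseteq> Y" "pairwise orthogonal BY"
    "\<And>b. b \<in> BY \<Longrightarrow> norm b = 1" "finite BY" "span BY = Y" and ev: "even (card BY)" by blast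
  obtain BZ where BZ: "BZ \<subseteq> Z" "pairwise orthogonal BZ" "\<And>x. x \<in> BZ \<Longrightarrow> norm x = 1"
    "independent BZ" "card BZ = dim Z" "span BZ = Z" using orthonormal_basis_subspace[OF facts(1)]
        by metis
  have fZ: "finite BZ" using BZ(4) by (simp add: independent_imp_finite)
  note un = orthonormal_basis_Un[OF BZ(1-3) fZ BZ(6) BY facts(4,5)]
  have "0 \<notin> BZ \<union> BY" using BZ(3) BY(3) by force
  then have "independent (BZ \<union> BY)" using un(2) by (rule pairwise_orthogonal_independent[rotated])
  then have "card (BZ \<union> BY) = CARD('n)" using indep_card_eq_dim_span[of "BZ \<union> BY"] un(3) by simp
  then have card: "card BZ + card BY = CARD('n)" using card_Un_disjoint[OF fZ BY(4) un(1)] by simp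
  have "BZ \<noteq> {}" using BZ(6) Z by auto
  then obtain q where q: "card BZ = q + 1" 
    using fZ that[of "card BZ - 1"] by (simp add: card_gt_0_iff)
  \<comment> \<open>Needed for \<open>m \<ge> 1\<close>: if \<open>Y\<close> were zero, the cubic
    form would vanish identically.\<close>
  have "BY \<noteq> {}"
  proof
    assume "BY = {}"
    then have Y0: "Y = {0}" using BY(5) by simp
    have "f x = 0" for x
    proof -
      obtain z y where zy: "z \<in> Z" "y \<in> Y" "x = z + y" using facts(5) by blast
      have "F x x x = 0" unfolding zy(3) F_split[OF split zy(1,2)] using zy(2) Y0 by simp
      then show ?thesis using f[of x] c by (simp add: F_def)
    qed
    then show False using nz by blast
  qed
  then obtain p where p: "card BY = 2 * p" "p \<ge> 1" 
  proof -
    obtain p where p: "card BY = 2 * p" using ev by (rule evenE)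
    moreover have "card BY \<noteq> 0" using \<open>BY \<noteq> {}\<close> BY(4) by simp
    ultimately show ?thesis using that[of p] by simp
  qed
  obtain hZ where hZ: "bij_betw hZ {..<q + 1} BZ"
    using ex_bij_betw_nat_finite[OF fZ] by (auto simp: q lessThan_atLeast0)
  obtain hY where hY: "bij_betw hY {..<2 * p} BY"
    using ex_bij_betw_nat_finite[OF BY(4)] by (auto simp: p lessThan_atLeast0)
  have hZ_in: "hZ i \<in> BZ" "hZ i \<in> Z" if "i < q + 1" for i using hZ that BZ(1)
      by (auto simp: bij_betw_def)
  have hY_in: "hY j \<in> BY" "hY j \<in> Y" if "j < 2 * p" for j using hY that BY(1)
      by (auto simp: bij_betw_def)
  note ZZ = orthonormal_enumeration[OF hZ BZ(2,3)] and YY = orthonormal_enumeration[OF hY BY(2,3)]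
  define w where "w = (\<lambda>i. if i < q + 1 then hZ i else hY (i - (q + 1)))"
  have wY: "w (q + 1 + j) = hY j" for j by (simp add: w_def)
  have wZ: "w i = hZ i" if "i \<le> q" for i using that by (simp add: w_def)
  have on: "w i \<bullet> w j = (if i = j then 1 else 0)" if ij: "i < q + 1 + 2 * p" "j < q + 1 + 2 * p" for i j
  proof (cases "i < q + 1"; cases "j < q + 1")
    assume "i < q + 1" "j < q + 1"
    then show ?thesis using ZZ[of i j] by (simp add: w_def)
  next
    assume "i < q + 1" "\<not> j < q + 1"
    then show ?thesis using facts(4)[OF hZ_in(2)[of i] hY_in(2)[of "j - (q + 1)"]] ij
        by (simp add: w_def)
  next
    assume "\<not> i < q + 1" "j < q + 1"
    then show ?thesis using facts(4)[OF hZ_in(2)[of j] hY_in(2)[of "i - (q + 1)"]] ij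
      by (simp add: w_def inner_commute[of "hY _"])
  next
    assume "\<not> i < q + 1" "\<not> j < q + 1"
    moreover from this have "i - (q + 1) = j - (q + 1) \<longleftrightarrow> i = j" by linarith
    ultimately show ?thesis using YY[of "i - (q + 1)" "j - (q + 1)"] ij by (simp add: w_def)
  qed
  \<comment> \<open>Dividing by \<open>sqrt k\<close> turns the factor \<open>2 * k\<close> of
    \<open>split_polar\<close> into the 2 of the Clifford relations.\<close>
  define r where "r = sqrt k"
  have r: "r \<noteq> 0" "r * r = k" using facts(3) by (simp_all add: r_def)
  define a where "a = (\<lambda>i j l. F (hZ i) (hY j) (hY l) / r)"
  have prod: "(\<Sum>l<2 * p. a i j l * a i' l j') = (m (hZ i) (hY j)) \<bullet> (m (hZ i') (hY j')) / k"
    if "i \<le> q" for i i' j j'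
  proof -
    have "(\<Sum>l<2 * p. F (hZ i) (hY j) (hY l) * F (hZ i') (hY l) (hY j'))
      = (\<Sum>b\<in>BY. F (hZ i) (hY j) b * F (hZ i') b (hY j'))"
      using sum.reindex_bij_betw[OF hY, of "\<lambda>b. F (hZ i) (hY j) b * F (hZ i') b (hY j')"] by simp
    also have "\<dots> = (\<Sum>b\<in>BY. ((m (hZ i) (hY j)) \<bullet> b) * (b \<bullet> (m (hZ i') (hY j'))))"
      by (simp add: F_def assoc commute[of "hZ i'"])
    also have "\<dots> = (m (hZ i) (hY j)) \<bullet> (m (hZ i') (hY j'))"
      using parseval_span[OF BY(2-4)] split_star_Y[OF split] hZ_in(2)[of i] that BY(5) by simp
    finally show ?thesis using r by (simp add: a_def sum_divide_distrib[symmetric])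
  qed
  have "clifford_coefficients (2 * p) q a"
    unfolding clifford_coefficients_def
  proof (intro conjI allI impI)
    show "a i j l = a i l j" for i j l by (simp add: a_def F_swap23[of "hZ i" "hY j"])
    fix i i' j j' assume ij: "i \<le> q" "i' \<le> q" "j < 2 * p" "j' < 2 * p"
    have "(\<Sum>l<2 * p. a i j l * a i' l j') + (\<Sum>l<2 * p. a i' j l * a i l j')
      = ((m (hZ i) (hY j)) \<bullet> (m (hZ i') (hY j')) + (m (hZ i') (hY j)) \<bullet> (m (hZ i) (hY j'))) / k"
      using prod[OF ij(1)] prod[OF ij(2)] by (simp add: add_divide_distrib)
    also have "\<dots> = 2 * (hZ i \<bullet> hZ i') * (hY j \<bullet> hY j')"
      using split_polar[OF split hZ_in(2)[of i] hZ_in(2)[of i'] hY_in(2)[of j] hY_in(2)[of j']] ij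
        facts(3) by simp
    also have "\<dots> = (if i = i' \<and> j = j' then 2 else 0)" using ZZ[of i i'] YY[of j j'] ij by simp
    finally show "(\<Sum>l<2 * p. a i j l * a i' l j') + (\<Sum>l<2 * p. a i' j l * a i l j') = (if i = i' \<and> j
        = j' then 2 else 0)" .
  qed
  moreover have "(\<Sum>j<2 * p. a 0 j j) = 0"
  proof -
    have "(\<Sum>j<2 * p. F (hZ 0) (hY j) (hY j)) = (\<Sum>b\<in>BY. F (hZ 0) b b)"
      using sum.reindex_bij_betw[OF hY, of "\<lambda>b. F (hZ 0) b b"] by simp
    also have "\<dots> = 0" using split_trace[OF split BY hZ_in(2)[of 0] tr] by simp
    finally show ?thesis by (simp add: a_def sum_divide_distrib[symmetric])
  qed
  moreover have "f x = r / (2 * c) * (\<Sum>i\<le>q. (w i \<bullet> x) *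
        (\<Sum>j<2 * p. \<Sum>l<2 * p. a i j l * (w (q + 1 + j) \<bullet> x) * (w (q + 1 + l) \<bullet> x)))" for x
  proof -
    obtain z y where zy: "z \<in> Z" "y \<in> Y" "x = z + y" using facts(5) by blast
    have "z = (\<Sum>b\<in>BZ. (z \<bullet> b) *\<^sub>R b)" using orthonormal_basis_expand[OF BZ(2,3) _ fZ] zy(1) BZ(6) by simp
    also have "\<dots> = (\<Sum>i<q + 1. (z \<bullet> hZ i) *\<^sub>R hZ i)"
      using sum.reindex_bij_betw[OF hZ, of "\<lambda>b. (z \<bullet> b) *\<^sub>R b"] by simp
    also have "\<dots> = (\<Sum>i\<le>q. (hZ i \<bullet> x) *\<^sub>R hZ i)"
    proof (rule sum.cong)
      show "(z \<bullet> hZ i) *\<^sub>R hZ i = (hZ i \<bullet> x) *\<^sub>R hZ i" if "i \<in> {..q}" for i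
        using facts(4)[OF hZ_in(2)[of i] zy(2)] that by (simp add: zy(3) inner_add_right inner_commute)
    qed auto
    finally have z: "z = (\<Sum>i\<le>q. (hZ i \<bullet> x) *\<^sub>R hZ i)" .
    have "y = (\<Sum>b\<in>BY. (y \<bullet> b) *\<^sub>R b)" using orthonormal_basis_expand[OF BY(2,3) _ BY(4)] zy(2) BY(5)
        by simp
    also have "\<dots> = (\<Sum>j<2 * p. (y \<bullet> hY j) *\<^sub>R hY j)"
      using sum.reindex_bij_betw[OF hY, of "\<lambda>b. (y \<bullet> b) *\<^sub>R b"] by simp
    also have "\<dots> = (\<Sum>j<2 * p. (hY j \<bullet> x) *\<^sub>R hY j)"
    proof (rule sum.cong)
      show "(y \<bullet> hY j) *\<^sub>R hY j = (hY j \<bullet> x) *\<^sub>R hY j" if "j \<in> {..<2 * p}" for j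
        using facts(4)[OF zy(1) hY_in(2)[of j]] that by (simp add: zy(3) inner_add_right inner_commute)
    qed auto
    finally have y: "y = (\<Sum>j<2 * p. (hY j \<bullet> x) *\<^sub>R hY j)" .
    have "F z y y = (\<Sum>i\<le>q. (hZ i \<bullet> x) * F (hZ i) y y)" by (subst z) (rule F_sum1)
    also have "\<dots> = (\<Sum>i\<le>q. (hZ i \<bullet> x) * (\<Sum>j<2 * p. \<Sum>l<2 * p. r * (a i j l * (hY j \<bullet> x) * (hY l \<bullet> x))))"
    proof (intro sum.cong refl arg_cong2[of _ _ _ _ "(*)"])
      fix i
      have "F (hZ i) y y = (\<Sum>j<2 * p. (hY j \<bullet> x) * F (hZ i) (hY j) y)"
        using F_sum2[of "hZ i" "\<lambda>j. hY j \<bullet> x" hY "{..<2 * p}" y] unfolding y[symmetric] .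
      also have "\<dots> = (\<Sum>j<2 * p. (hY j \<bullet> x) * (\<Sum>l<2 * p. (hY l \<bullet> x) * F (hZ i) (hY j) (hY l)))"
        using F_sum3[of "hZ i" _ "\<lambda>j. hY j \<bullet> x" hY "{..<2 * p}"] unfolding y[symmetric] by simp
      also have "\<dots> = (\<Sum>j<2 * p. \<Sum>l<2 * p. r * (a i j l * (hY j \<bullet> x) * (hY l \<bullet> x)))"
        unfolding sum_distrib_left using r(1) by (intro sum.cong refl) (simp add: a_def)
      finally show "F (hZ i) y y = (\<Sum>j<2 * p. \<Sum>l<2 * p. r * (a i j l * (hY j \<bullet> x) * (hY l \<bullet> x)))" .
    qed
    also have "\<dots> = r * (\<Sum>i\<le>q. (w i \<bullet> x) * (\<Sum>j<2 * p. \<Sum>l<2 * p. a i j l * (w (q + 1 + j) \<bullet> x) * (w (q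
        + 1 + l) \<bullet> x)))"
      unfolding wY sum_distrib_left by (intro sum.cong refl) (simp add: wZ)
    finally have Fz: "F z y y = r * (\<Sum>i\<le>q. (w i \<bullet> x) * (\<Sum>j<2 * p. \<Sum>l<2 * p. a i j l * (w (q + 1
        + j) \<bullet> x) * (w (q + 1 + l) \<bullet> x)))" .
    have "6 * (c * f x) = 3 * F z y y" using f[of x] F_split[OF split zy(1,2)] by (simp add: F_def zy(3))
    then have "f x = F z y y / (2 * c)" using c by (simp add: field_simps)
    then show ?thesis unfolding Fz by simp
  qed
  moreover have "q + 1 + 2 * p = CARD('n)" using card q p by simp
  moreover have "r / (2 * c) \<noteq> 0" using r c by simp
  ultimately have "clifford_coordinates f p q a w (r / (2 * c))"
    using on p(2) unfolding clifford_coordinates_def by blast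
  then show ?thesis by (rule clifford_type_if_clifford_coordinates)
qed

section \<open>From Clifford coordinates back to a splitting\<close>

lemma sum_lessThan_add:
  fixes g :: "nat \<Rightarrow> 'a::comm_monoid_add"
  shows "(\<Sum>i<a + b. g i) = (\<Sum>i<a. g i) + (\<Sum>j<b. g (a + j))"
  by (induction b) (simp_all add: add.assoc)

text \<open>The algebra belongs to a multiple \<open>\<kappa>\<close> of \<open>f\<close>, because a
  normal form prescribes its own scaling constant. The Clifford relations enter only through
  \<open>clifford_coefficients_norm\<close>.\<close>

lemma split_if_clifford_coordinates:
  fixes f :: "real^'n \<Rightarrow> real"
  assumes coords: "clifford_coordinates f p q a w c" and \<kappa>: "\<kappa> \<noteq> 0"
  shows "\<exists>M Z Y k. metrised_algebra M \<and> metrised_algebra.clifford_split M Z Y k \<and> (\<forall>x. M x x \<bullet> x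
      = 6 * (\<kappa> * f x))"
proof -
  define n N where "n = 2 * p" and "N = q + 1 + n"
  have c: "c \<noteq> 0" and card: "N = CARD('n)"
    and on: "\<And>i j. i < N \<Longrightarrow> j < N \<Longrightarrow> w i \<bullet> w j = (if i = j then 1 else 0)"
    and coeffs: "clifford_coefficients n q a"
    and f: "\<And>x. f x = c * (\<Sum>i\<le>q. (w i \<bullet> x) *
        (\<Sum>j<n. \<Sum>k<n. a i j k * (w (q + 1 + j) \<bullet> x) * (w (q + 1 + k) \<bullet> x)))"
    using coords unfolding clifford_coordinates_def n_def N_def by blast+
  have sym: "a i j k = a i k j" if "i \<le> q" "j < n" "k < n" for i j k
    using coeffs that by (simp add: clifford_coefficients_def)
  define v where "v = (\<lambda>j. w (q + 1 + j))"
  have expand: "x = (\<Sum>i<N. (w i \<bullet> x) *\<^sub>R w i)" for x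
  proof -
    have inj: "inj_on w {..<N}"
    proof (rule inj_onI)
      fix i j assume ij: "i \<in> {..<N}" "j \<in> {..<N}" "w i = w j"
      then have "w i \<bullet> w j = 1" using on[of i i] by simp
      then show "i = j" using on[of i j] ij by (auto split: if_splits)
    qed
    let ?B = "w ` {..<N}"
    have orth: "pairwise orthogonal ?B" unfolding pairwise_def orthogonal_def using on by auto
    have n1: "norm b = 1" if "b \<in> ?B" for b using that on by (auto simp: norm_eq_1)
    have "0 \<notin> ?B" using n1 by force
    then have "independent ?B" using orth by (rule pairwise_orthogonal_independent[rotated])
    moreover have "card ?B = DIM(real^'n)" using card_image[OF inj] card by simp
    ultimately have "UNIV \<subseteq> span ?B" by (intro card_ge_dim_independent) simp_all
    then have "(\<Sum>b\<in>?B. (x \<bullet> b) *\<^sub>R b) = x" using orth n1 by (intro orthonormal_basis_expand) auto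
    then show ?thesis by (simp add: sum.reindex[OF inj] inner_commute)
  qed
  have expand2: "x = (\<Sum>i\<le>q. (w i \<bullet> x) *\<^sub>R w i) + (\<Sum>j<n. (v j \<bullet> x) *\<^sub>R v j)" for x
    using expand[of x] sum_lessThan_add[of "\<lambda>i. (w i \<bullet> x) *\<^sub>R w i" "q + 1" n]
    by (simp add: N_def v_def lessThan_Suc_atMost)
  have inner2: "x \<bullet> y = (\<Sum>i\<le>q. (w i \<bullet> x) * (w i \<bullet> y)) + (\<Sum>j<n. (v j \<bullet> x) * (v j \<bullet> y))" for x y
    by (subst expand2[of x]) (simp add: inner_add_left inner_sum_left)
  define C where "C = (\<lambda>i x y. \<Sum>j<n. \<Sum>k<n. a i j k * (v j \<bullet> x) * (v k \<bullet> y))"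
  have C_sym: "C i x y = C i y x" if "i \<le> q" for i x y
  proof -
    have "C i x y = (\<Sum>k<n. \<Sum>j<n. a i j k * (v j \<bullet> x) * (v k \<bullet> y))" unfolding C_def by (rule sum.swap)
    also have "\<dots> = C i y x" unfolding C_def using sym[OF that] by (intro sum.cong refl) simp
    finally show ?thesis .
  qed
  have C_add: "C i (x + x') y = C i x y + C i x' y" for i x x' y
    by (simp add: C_def inner_add_right distrib_left distrib_right sum.distrib)
  have C_scale: "C i (t *\<^sub>R x) y = t * C i x y" for i t x y
    by (simp add: C_def sum_distrib_left mult.assoc mult.left_commute)
  \<comment> \<open>On the diagonal the three summands of \<open>S\<close> coincide, so
    \<open>3 * d\<close> has to equal \<open>6 * \<kappa> * c\<close>.\<close>
  define d where "d = 2 * \<kappa> * c"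
  have d: "d \<noteq> 0" using c \<kappa> by (simp add: d_def)
  define S where "S = (\<lambda>x y z. d * (\<Sum>i\<le>q. (w i \<bullet> x) * C i y z + (w i \<bullet> y) * C i x z
      + (w i \<bullet> z) * C i x y))"
  have "linear (\<lambda>x. S x y z)" for y z
    by (rule linearI)
      (simp_all add: S_def C_add C_scale inner_add_right sum.distrib sum_distrib_left algebra_simps)
  moreover have "S x y z = S y x z" "S x y z = S x z y" for x y z
    unfolding S_def using C_sym by (auto intro!: arg_cong[of _ _ "(*) d"] sum.cong)
  ultimately obtain M where M: "metrised_algebra M" and MS: "\<And>x y z. M x y \<bullet> z = S x y z"
    using metrised_algebra_of_trilinear[of S] by blast
  interpret metrised_algebra M by (rule M)
  define Z Y where "Z = {x. \<forall>j<n. v j \<bullet> x = 0}" and "Y = {x. \<forall>i\<le>q. w i \<bullet> x = 0}"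
  have FS: "F x y z = S x y z" for x y z by (simp add: F_def MS)
  have CZ: "C i z u = 0" "C i u z = 0" if "z \<in> Z" for i z u
    using that by (auto simp: C_def Z_def intro!: sum.neutral)
  have "clifford_split Z Y (d^2)"
    unfolding clifford_split_def
  proof (intro conjI ballI allI)
    show "subspace Z" "subspace Y" by (auto simp: Z_def Y_def subspace_def inner_add_right)
    show "d^2 > 0" using d by simp
    show "z \<bullet> y = 0" if "z \<in> Z" "y \<in> Y" for z y
      using that inner2[of z y] by (simp add: Z_def Y_def)
    show "\<exists>z\<in>Z. \<exists>y\<in>Y. x = z + y" for x
    proof (intro bexI)
      show "x = (\<Sum>i\<le>q. (w i \<bullet> x) *\<^sub>R w i) + (\<Sum>j<n. (v j \<bullet> x) *\<^sub>R v j)" by (rule expand2)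
      show "(\<Sum>i\<le>q. (w i \<bullet> x) *\<^sub>R w i) \<in> Z" using on
        by (auto simp: Z_def v_def N_def inner_sum_right intro!: sum.neutral)
      show "(\<Sum>j<n. (v j \<bullet> x) *\<^sub>R v j) \<in> Y" using on
        by (auto simp: Y_def v_def N_def inner_sum_right intro!: sum.neutral)
    qed
    show "M z z' = 0" if "z \<in> Z" "z' \<in> Z" for z z'
    proof -
      have "M z z' \<bullet> u = 0" for u using that by (simp add: MS S_def CZ)
      then show ?thesis using inner_eq_zero_iff by blast
    qed
    show "F x y z = 0" if "x \<in> Y" "y \<in> Y" "z \<in> Y" for x y z
      using that by (simp add: FS S_def Y_def)
    show "M z y \<bullet> M z y = d^2 * (z \<bullet> z) * (y \<bullet> y)" if zy: "z \<in> Z" "y \<in> Y" for z y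
    proof -
      define g where "g = (\<lambda>k. \<Sum>i\<le>q. \<Sum>j<n. (w i \<bullet> z) * (v j \<bullet> y) * a i j k)"
      have M1: "M z y \<bullet> u = d * (\<Sum>k<n. g k * (v k \<bullet> u))" for u
      proof -
        have "M z y \<bullet> u = d * (\<Sum>i\<le>q. (w i \<bullet> z) * C i y u)" using zy by (simp add: MS S_def CZ Y_def)
        also have "(\<Sum>i\<le>q. (w i \<bullet> z) * C i y u) = (\<Sum>i\<le>q. \<Sum>j<n. \<Sum>k<n. (w i \<bullet> z) * (v j \<bullet> y) * a i j k
            * (v k \<bullet> u))"
          unfolding C_def sum_distrib_left by (intro sum.cong refl) simp
        also have "\<dots> = (\<Sum>i\<le>q. \<Sum>k<n. \<Sum>j<n. (w i \<bullet> z) * (v j \<bullet> y) * a i j k * (v k \<bullet> u))"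
          by (intro sum.cong refl sum.swap)
        also have "\<dots> = (\<Sum>k<n. \<Sum>i\<le>q. \<Sum>j<n. (w i \<bullet> z) * (v j \<bullet> y) * a i j k * (v k \<bullet> u))"
            by (rule sum.swap)
        also have "\<dots> = (\<Sum>k<n. g k * (v k \<bullet> u))" by (simp add: g_def sum_distrib_right)
        finally show ?thesis .
      qed
      have vM: "v k \<bullet> M z y = d * g k" if k: "k < n" for k
      proof -
        have "v l \<bullet> v k = (if l = k then 1 else 0)" if "l < n" for l
          using on[of "q + 1 + l" "q + 1 + k"] that k by (simp add: v_def N_def)
        then have "(\<Sum>l<n. g l * (v l \<bullet> v k)) = (\<Sum>l<n. if l = k then g l else 0)"
          by (intro sum.cong refl) auto
        also have "\<dots> = g k" using k by simp
        finally show ?thesis using M1[of "v k"] by (simp add: inner_commute)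
      qed
      have "M z y \<bullet> M z y = d * (\<Sum>k<n. g k * (d * g k))" unfolding M1 using vM by simp
      also have "\<dots> = d^2 * (\<Sum>k<n. (g k)^2)"
        by (simp add: sum_distrib_left power2_eq_square mult.assoc mult.left_commute)
      also have "(\<Sum>k<n. (g k)^2) = (\<Sum>i\<le>q. (w i \<bullet> z)^2) * (\<Sum>j<n. (v j \<bullet> y)^2)"
        unfolding g_def by (rule clifford_coefficients_norm[OF coeffs])
      also have "(\<Sum>i\<le>q. (w i \<bullet> z)^2) = z \<bullet> z" using inner2[of z z] zy(1)
          by (simp add: Z_def power2_eq_square)
      also have "(\<Sum>j<n. (v j \<bullet> y)^2) = y \<bullet> y" using inner2[of y y] zy(2)
          by (simp add: Y_def power2_eq_square)
      finally show ?thesis by simp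
    qed
  qed
  moreover have "M x x \<bullet> x = 6 * (\<kappa> * f x)" for x
  proof -
    have "M x x \<bullet> x = d * (3 * (\<Sum>i\<le>q. (w i \<bullet> x) * C i x x))"
        by (simp add: MS S_def sum_distrib_left algebra_simps)
    then show ?thesis unfolding f by (simp add: d_def C_def v_def)
  qed
  ultimately show ?thesis using M by blast
qed

lemma (in metrised_algebra) real_polynomial_function_F:
  assumes "bounded_linear p" "bounded_linear q" "bounded_linear r"
  shows "real_polynomial_function (\<lambda>x. F (p x) (q x) (r x))"
proof -
  have "F (p x) (q x) (r x) = (\<Sum>b\<in>Basis. (q x \<bullet> b) * (\<Sum>b'\<in>Basis. (p x \<bullet> b') * ((b' \<star> b) \<bullet> r x)))" for x
  proof -
    have "F (p x) (q x) (r x) = F (\<Sum>b\<in>Basis. (p x \<bullet> b) *\<^sub>R b) (\<Sum>b\<in>Basis. (q x \<bullet> b) *\<^sub>R b) (r x)"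
      by (simp add: euclidean_representation)
    then show ?thesis unfolding F_sum1 F_sum2 by (simp add: F_def)
  qed
  moreover have "real_polynomial_function (\<lambda>x. p x \<bullet> b)" "real_polynomial_function (\<lambda>x. q x \<bullet> b)"
    "real_polynomial_function (\<lambda>x. b \<bullet> r x)" for b
    using assms
    by (simp_all add: real_polynomial_function.intros(1) bounded_linear_inner_left_comp
        bounded_linear_inner_right_comp)
  then have "real_polynomial_function (\<lambda>x. \<Sum>b\<in>Basis. (q x \<bullet> b) * (\<Sum>b'\<in>Basis. (p x \<bullet> b') * ((b' \<star> b)
      \<bullet> r x)))"
    by (intro real_polynomial_function_sum real_polynomial_function.intros(4) finite_Basis)
  ultimately show ?thesis by simp
qed

subsection \<open>The two implications\<close>

text \<open>Here \<open>e\<close> need not be a maximum. The shape of the normal form alone makes it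
  satisfy \<open>M e e = 6 *\<^sub>R e\<close> and makes \<open>V2\<close> the full eigenspace for
  -3, and \<open>split_idempotent\<close> supplies both the factorisation of \<psi>030 and a vector
  where it is nonzero.\<close>

lemma normal_form_reducible_if_clifford_type:
  fixes f :: "real^'n \<Rightarrow> real"
  assumes cl: "clifford_type f" and nf: "normal_form f c e V1 V2 V3 \<psi>111 \<psi>102 \<psi>012 \<psi>030"
  shows "(\<exists>\<eta>\<in>V2. \<psi>030 (0, \<eta>, 0) \<noteq> 0) \<and> reducible_on V2 (\<lambda>\<eta>. \<psi>030 (0, \<eta>, 0))"
proof -
  have c: "c \<noteq> 0" and dec: "orthogonal_decomposition e V1 V2 V3"
    and tri: "trihomogeneous_polynomial V1 V2 V3 1 1 1 \<psi>111"
        "trihomogeneous_polynomial V1 V2 V3 1 0 2 \<psi>102"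
      "trihomogeneous_polynomial V1 V2 V3 0 1 2 \<psi>012"
    and f: "\<And>t \<xi> \<eta> \<zeta>. \<xi> \<in> V1 \<Longrightarrow> \<eta> \<in> V2 \<Longrightarrow> \<zeta> \<in> V3 \<Longrightarrow>
        c * f (t *\<^sub>R e + \<xi> + \<eta> + \<zeta>) =
          t ^ 3 - 3 / 2 * t * (2 * (norm \<xi>)\<^sup>2 + (norm \<eta>)\<^sup>2 - (norm \<zeta>)\<^sup>2)
          + \<psi>111 (\<xi>, \<eta>, \<zeta>) + \<psi>102 (\<xi>, \<eta>, \<zeta>) + \<psi>012 (\<xi>, \<eta>, \<zeta>) + \<psi>030 (\<xi>, \<eta>, \<zeta>)"
    using nf by (simp_all add: normal_form_def)
  have e1: "norm e = 1" and sub: "subspace V1" "subspace V2" "subspace V3"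
    and eV: "orthogonal_subspaces (span {e}) V1" "orthogonal_subspaces (span {e}) V2"
        "orthogonal_subspaces (span {e}) V3"
    and VV: "orthogonal_subspaces V1 V2" "orthogonal_subspaces V1 V3" "orthogonal_subspaces V2 V3"
    and decomp: "\<And>x. \<exists>t. \<exists>\<xi>\<in>V1. \<exists>\<eta>\<in>V2. \<exists>\<zeta>\<in>V3. x = t *\<^sub>R e + \<xi> + \<eta> + \<zeta>"
    using dec by (simp_all add: orthogonal_decomposition_def)
  have e_in: "e \<in> span {e}" by (simp add: span_base)
  have pe: "x \<bullet> e = 0" "e \<bullet> x = 0" if "x \<in> V1 \<or> x \<in> V2 \<or> x \<in> V3" for x
    using that eV e_in by (auto simp: orthogonal_subspaces_def orthogonal_def inner_commute)
  have p12: "x \<bullet> y = 0" "y \<bullet> x = 0" if "x \<in> V1" "y \<in> V2" for x y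
    using that VV by (auto simp: orthogonal_subspaces_def orthogonal_def inner_commute)
  have p13: "x \<bullet> y = 0" "y \<bullet> x = 0" if "x \<in> V1" "y \<in> V3" for x y
    using that VV by (auto simp: orthogonal_subspaces_def orthogonal_def inner_commute)
  have p23: "x \<bullet> y = 0" "y \<bullet> x = 0" if "x \<in> V2" "y \<in> V3" for x y
    using that VV by (auto simp: orthogonal_subspaces_def orthogonal_def inner_commute)
  have ee: "e \<bullet> e = 1" using e1 by (simp add: norm_eq_1)
  note zero = subspace_0[OF sub(1)] subspace_0[OF sub(2)] subspace_0[OF sub(3)]
  obtain p q a w c0 where "clifford_coordinates f p q a w c0"
    using clifford_coordinates_if_clifford_type[OF cl] by blast
  then obtain M Z Y k where M: "metrised_algebra M" and split: "metrised_algebra.clifford_split M Z Y k"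
    and Mf: "\<And>x. M x x \<bullet> x = 6 * (c * f x)" using split_if_clifford_coordinates[OF _ c] by blast
  interpret metrised_algebra M by (rule M)
  have Ff: "F x x x = 6 * (c * f x)" for x using Mf by (simp add: F_def)
  define N :: "real^'n \<Rightarrow> real^'n \<Rightarrow> real^'n \<Rightarrow> real" where
    "N = (\<lambda>\<xi> \<eta> \<zeta>. 2 * (\<xi> \<bullet> \<xi>) + \<eta> \<bullet> \<eta> - \<zeta> \<bullet> \<zeta>)"
  have cf: "F e e e = 6 \<and> F e e (\<xi> + \<eta> + \<zeta>) = 0 \<and> F e (\<xi> + \<eta> + \<zeta>) (\<xi> + \<eta> + \<zeta>) = - 3 * N \<xi> \<eta> \<zeta>"
    if V: "\<xi> \<in> V1" "\<eta> \<in> V2" "\<zeta> \<in> V3" for \<xi> \<eta> \<zeta>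
  proof -
    let ?y = "\<xi> + \<eta> + \<zeta>"
    let ?\<psi> = "\<psi>111 (\<xi>, \<eta>, \<zeta>) + \<psi>102 (\<xi>, \<eta>, \<zeta>) + \<psi>012 (\<xi>, \<eta>, \<zeta>) + \<psi>030 (\<xi>, \<eta>, \<zeta>)"
    \<comment> \<open>Both sides are polynomials in \<open>t\<close>; the coefficients of
      \<open>t\<close>, \<open>t^2\<close> and \<open>t^3\<close> determine multiplication by
      \<open>e\<close>, whatever the \<psi> are.\<close>
    have main: "(F ?y ?y ?y - 6 * ?\<psi>) + t * (3 * F e ?y ?y + 9 * N \<xi> \<eta> \<zeta>) + t^2 * (3 * F e e ?y)
        + t^3 * (F e e e - 6)
        + t^4 * 0 + t^5 * 0 = 0" for t
    proof -
      have "F (t *\<^sub>R e + ?y) (t *\<^sub>R e + ?y) (t *\<^sub>R e + ?y) = 6 * (c * f (t *\<^sub>R e + \<xi> + \<eta> + \<zeta>))"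
        using Ff[of "t *\<^sub>R e + ?y"] by (simp add: add.assoc)
      also have "\<dots> = 6 * t^3 - 9 * t * N \<xi> \<eta> \<zeta> + 6 * ?\<psi>"
        unfolding f[OF V] by (simp add: N_def power2_norm_eq_inner algebra_simps)
      also have "F (t *\<^sub>R e + u) (t *\<^sub>R e + u) (t *\<^sub>R e + u)
          = t^3 * F e e e + 3 * t^2 * F e e u + 3 * t * F e u u + F u u u" for u
        by (simp add: F_expand F_swap12[of u e] F_swap23[of e u e] F_swap23[of u u e] algebra_simps
          power_numeral_reduce)
      finally show ?thesis by (simp add: algebra_simps)
    qed
    from quintic_coeffs_zero[OF main] show ?thesis by simp
  qed
  have Feee: "F e e e = 6" using cf[OF zero] by blast
  have Fee: "F e e x = 6 * (e \<bullet> x)" for x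
  proof -
    obtain t \<xi> \<eta> \<zeta> where V: "\<xi> \<in> V1" "\<eta> \<in> V2" "\<zeta> \<in> V3" and x: "x = t *\<^sub>R e + \<xi> + \<eta> + \<zeta>"
        using decomp[of x] by blast
    have "F e e x = t * 6 + F e e (\<xi> + \<eta> + \<zeta>)" unfolding x by (simp add: F_expand Feee)
    moreover have "e \<bullet> x = t" unfolding x using V pe by (simp add: inner_add_right ee)
    ultimately show ?thesis using cf[OF V] by simp
  qed
  have star_e: "M e e = 6 *\<^sub>R e"
  proof -
    have "(M e e - 6 *\<^sub>R e) \<bullet> x = 0" for x using Fee[of x] by (simp add: F_def inner_diff_left)
    then have "M e e - 6 *\<^sub>R e = 0" using inner_eq_zero_iff by blast
    then show ?thesis by simp
  qed
  have Fe: "F e (\<xi> + \<eta> + \<zeta>) (\<xi>' + \<eta>' + \<zeta>') = - 6 * (\<xi> \<bullet> \<xi>') - 3 * (\<eta> \<bullet> \<eta>') + 3 * (\<zeta> \<bullet> \<zeta>')"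
    if V: "\<xi> \<in> V1" "\<eta> \<in> V2" "\<zeta> \<in> V3" and V': "\<xi>' \<in> V1" "\<eta>' \<in> V2" "\<zeta>' \<in> V3" for \<xi> \<eta> \<zeta> \<xi>' \<eta>' \<zeta>'
  proof -
    let ?y = "\<xi> + \<eta> + \<zeta>" and ?y' = "\<xi>' + \<eta>' + \<zeta>'"
    have "\<xi> + \<xi>' \<in> V1" "\<eta> + \<eta>' \<in> V2" "\<zeta> + \<zeta>' \<in> V3" using V V' sub by (simp_all add: subspace_add)
    from cf[OF this] have "F e ((\<xi> + \<xi>') + (\<eta> + \<eta>') + (\<zeta> + \<zeta>')) ((\<xi> + \<xi>') + (\<eta> + \<eta>') + (\<zeta> + \<zeta>'))
      = - 3 * N (\<xi> + \<xi>') (\<eta> + \<eta>') (\<zeta> + \<zeta>')" by blast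
    moreover have "(\<xi> + \<xi>') + (\<eta> + \<eta>') + (\<zeta> + \<zeta>') = ?y + ?y'" by simp
    ultimately have "F e (?y + ?y') (?y + ?y') = - 3 * N (\<xi> + \<xi>') (\<eta> + \<eta>') (\<zeta> + \<zeta>')" by simp
    moreover have "F e (u + u') (u + u') = F e u u + 2 * F e u u' + F e u' u'" for u u'
      by (simp add: F_expand F_swap23[of e u' u])
    moreover have "F e ?y ?y = - 3 * N \<xi> \<eta> \<zeta>" "F e ?y' ?y' = - 3 * N \<xi>' \<eta>' \<zeta>'"
        using cf[OF V] cf[OF V'] by blast+
    moreover have "N (\<xi> + \<xi>') (\<eta> + \<eta>') (\<zeta> + \<zeta>') = N \<xi> \<eta> \<zeta> + N \<xi>' \<eta>' \<zeta>' + 2 * (2 * (\<xi> \<bullet> \<xi>') + \<eta> \<bullet> \<eta>'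
        - \<zeta> \<bullet> \<zeta>')"
      by (simp add: N_def inner_add_left inner_add_right inner_commute[of \<xi>' \<xi>] inner_commute[of \<eta>' \<eta>]
          inner_commute[of \<zeta>' \<zeta>])
    ultimately show ?thesis by simp
  qed
  have Fe_x: "F e y x = - 6 * (\<xi> \<bullet> x) - 3 * (\<eta> \<bullet> x) + 3 * (\<zeta> \<bullet> x)"
    if V: "\<xi> \<in> V1" "\<eta> \<in> V2" "\<zeta> \<in> V3" and y: "y = \<xi> + \<eta> + \<zeta>" for \<xi> \<eta> \<zeta> y x
  proof -
    obtain t \<xi>' \<eta>' \<zeta>' where V': "\<xi>' \<in> V1" "\<eta>' \<in> V2" "\<zeta>' \<in> V3" and x: "x = t *\<^sub>R e + \<xi>' + \<eta>' + \<zeta>'"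
      using decomp[of x] by blast
    have "F e y e = 0" using cf[OF V] F_swap23[of e y e] y by simp
    then have "F e y x = F e (\<xi> + \<eta> + \<zeta>) (\<xi>' + \<eta>' + \<zeta>')"
      unfolding x by (simp add: F_expand(3,12) y)
    moreover have "\<xi> \<bullet> x = \<xi> \<bullet> \<xi>'" "\<eta> \<bullet> x = \<eta> \<bullet> \<eta>'" "\<zeta> \<bullet> x = \<zeta> \<bullet> \<zeta>'"
      unfolding x using V V' pe p12 p13 p23 by (simp_all add: inner_add_right)
    ultimately show ?thesis using Fe[OF V V'] by simp
  qed
  have V2_eig: "M e \<eta> = (- 3) *\<^sub>R \<eta>" if "\<eta> \<in> V2" for \<eta>
  proof -
    have "(M e \<eta> - (- 3) *\<^sub>R \<eta>) \<bullet> x = 0" for x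
      using Fe_x[OF zero(1) that zero(3), of \<eta> x] by (simp add: F_def inner_diff_left inner_add_left)
    then have "M e \<eta> - (- 3) *\<^sub>R \<eta> = 0" using inner_eq_zero_iff by blast
    then show ?thesis by (simp only: right_minus_eq)
  qed
  \<comment> \<open>The inclusion of the eigenspace in \<open>V2\<close> brings the vector
    \<open>h\<close> of \<open>split_idempotent\<close> into \<open>V2\<close>, so that \<psi>030
    and both factors are nonzero there.\<close>
  have eig_V2: "h \<in> V2" if h: "M e h = (- 3) *\<^sub>R h" for h
  proof -
    obtain t \<xi> \<eta> \<zeta> where V: "\<xi> \<in> V1" "\<eta> \<in> V2" "\<zeta> \<in> V3" and hx: "h = t *\<^sub>R e + \<xi> + \<eta> + \<zeta>"
        using decomp[of h] by blast
    have Fh: "F e h x = - 3 * (h \<bullet> x)" for x by (simp add: F_def h)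
    have "F e h e = 6 * (e \<bullet> h)" using Fee[of h] F_swap23[of e h e] by simp
    then have "h \<bullet> e = 0" using Fh[of e] by (simp add: inner_commute)
    moreover have "h \<bullet> e = t" unfolding hx using V pe by (simp add: inner_add_left ee)
    ultimately have t: "t = 0" by simp
    have "F e h \<xi> = - 6 * (\<xi> \<bullet> h)" using Fe_x[OF V(1) zero(2,3), of \<xi> h] F_swap23[of e h \<xi>] by simp
    then have "\<xi> \<bullet> h = 0" using Fh[of \<xi>] by (simp add: inner_commute)
    moreover have "\<xi> \<bullet> h = \<xi> \<bullet> \<xi>" unfolding hx using V pe p12 p13 by (simp add: inner_add_right)
    ultimately have \<xi>: "\<xi> = 0" by simp
    have "F e h \<zeta> = 3 * (\<zeta> \<bullet> h)" using Fe_x[OF zero(1,2) V(3), of \<zeta> h] F_swap23[of e h \<zeta>] by simp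
    then have "\<zeta> \<bullet> h = 0" using Fh[of \<zeta>] by (simp add: inner_commute)
    moreover have "\<zeta> \<bullet> h = \<zeta> \<bullet> \<zeta>" unfolding hx using V pe p23 p13 by (simp add: inner_add_right)
    ultimately have \<zeta>: "\<zeta> = 0" by simp
    show ?thesis using V(2) by (simp add: hx t \<xi> \<zeta>)
  qed
  obtain z where z: "\<And>h. M e h = (- 3) *\<^sub>R h \<Longrightarrow> F h h h = 9 * (z \<bullet> h) * F z h h"
    and "\<exists>h. M e h = (- 3) *\<^sub>R h \<and> F h h h \<noteq> 0" using split_idempotent[OF split e1 star_e] by blast
  then obtain h where h: "M e h = (- 3) *\<^sub>R h" "F h h h \<noteq> 0" by blast
  have hV: "h \<in> V2" using eig_V2[OF h(1)] .
  have \<psi>: "\<psi>030 (0, \<eta>, 0) = F \<eta> \<eta> \<eta> / 6" if \<eta>: "\<eta> \<in> V2" for \<eta>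
  proof -
    have "\<psi>111 (0, \<eta>, 0) = 0" "\<psi>102 (0, \<eta>, 0) = 0" "\<psi>012 (0, \<eta>, 0) = 0"
    proof -
      have "\<psi>111 (0 *\<^sub>R 0, 1 *\<^sub>R \<eta>, 0 *\<^sub>R 0) = 0 ^ 1 * 1 ^ 1 * 0 ^ 1 * \<psi>111 (0, \<eta>, 0)"
        using tri(1) zero \<eta> unfolding trihomogeneous_polynomial_def by blast
      then show "\<psi>111 (0, \<eta>, 0) = 0" by simp
      have "\<psi>102 (0 *\<^sub>R 0, 1 *\<^sub>R \<eta>, 0 *\<^sub>R 0) = 0 ^ 1 * 1 ^ 0 * 0 ^ 2 * \<psi>102 (0, \<eta>, 0)"
        using tri(2) zero \<eta> unfolding trihomogeneous_polynomial_def by blast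
      then show "\<psi>102 (0, \<eta>, 0) = 0" by simp
      have "\<psi>012 (0 *\<^sub>R 0, 1 *\<^sub>R \<eta>, 0 *\<^sub>R 0) = 0 ^ 0 * 1 ^ 1 * 0 ^ 2 * \<psi>012 (0, \<eta>, 0)"
        using tri(3) zero \<eta> unfolding trihomogeneous_polynomial_def by blast
      then show "\<psi>012 (0, \<eta>, 0) = 0" by simp
    qed
    then show ?thesis using f[OF zero(1) \<eta> zero(3), of 0] Ff[of \<eta>] by simp
  qed
  have fact: "\<psi>030 (0, \<eta>, 0) = (z \<bullet> \<eta>) * (3 / 2 * F z \<eta> \<eta>)" if "\<eta> \<in> V2" for \<eta>
    using \<psi>[OF that] z[OF V2_eig[OF that]] by simp
  have nz: "z \<bullet> h \<noteq> 0" "F z h h \<noteq> 0" using z[OF h(1)] h(2) by auto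
  show ?thesis
  proof
    show "\<exists>\<eta>\<in>V2. \<psi>030 (0, \<eta>, 0) \<noteq> 0" using hV \<psi>[OF hV] h(2) by (intro bexI[of _ h]) simp_all
    show "reducible_on V2 (\<lambda>\<eta>. \<psi>030 (0, \<eta>, 0))"
      unfolding reducible_on_def
    proof (intro exI conjI)
      show "real_polynomial_function (\<lambda>\<eta>. z \<bullet> \<eta>)"
        by (intro real_polynomial_function.intros(1) bounded_linear_inner_right)
      have "real_polynomial_function (\<lambda>\<eta>. M z \<eta> \<bullet> \<eta>)"
      proof -
        have "M z \<eta> \<bullet> \<eta> = (\<Sum>b\<in>Basis. (M z \<eta> \<bullet> b) * (\<eta> \<bullet> b))" for \<eta> by (rule euclidean_inner)
        moreover have "bounded_linear (M z)" using linear_star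
            by (simp add: linear_conv_bounded_linear[symmetric])
        ultimately show ?thesis
          by (simp only:) (intro real_polynomial_function_sum real_polynomial_function.intros(1,4)
            finite_Basis
              bounded_linear_inner_left_comp bounded_linear_ident)
      qed
      then show "real_polynomial_function (\<lambda>\<eta>. 3 / 2 * F z \<eta> \<eta>)"
        unfolding F_def by (intro real_polynomial_function.intros(2,4))
      show "\<not> (\<lambda>\<eta>. z \<bullet> \<eta>) constant_on V2"
        using nz(1) hV zero(2) unfolding constant_on_def by (metis inner_zero_right)
      show "\<not> (\<lambda>\<eta>. 3 / 2 * F z \<eta> \<eta>) constant_on V2"
      proof
        assume "(\<lambda>\<eta>. 3 / 2 * F z \<eta> \<eta>) constant_on V2"
        then have "3 / 2 * F z h h = 3 / 2 * F z 0 0" using hV zero(2) unfolding constant_on_def by metis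
        then show False using nz(2) by simp
      qed
      show "\<forall>x\<in>V2. \<psi>030 (0, x, 0) = (z \<bullet> x) * (3 / 2 * F z x x)" using fact by blast
    qed
  qed
qed

section \<open>The normal form at a maximum and the remaining implication\<close>

context harmonic_hsiang
begin

text \<open>The coefficients count orderings of the arguments. After division by 6 they become the
  1, 1/2, 1/2 and 1/6 in \<open>normal_form_exists\<close>.\<close>

lemma F_expand_V:
  assumes x: "V1 x" and y: "V2 y" and z: "V3 z"
  shows "F (t *\<^sub>R e + x + y + z) (t *\<^sub>R e + x + y + z) (t *\<^sub>R e + x + y + z)
    = 6 * t^3 - 9 * t * (2 * (x \<bullet> x) + y \<bullet> y - z \<bullet> z) + 6 * F x y z + 3 * F x z z + 3 * F y z z + F
        y y y"
proof -
  have perp: "e \<bullet> x = 0" "e \<bullet> y = 0" "e \<bullet> z = 0" "x \<bullet> y = 0" "x \<bullet> z = 0" "y \<bullet> z = 0"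
    using V_e(2)[OF x] V_e(2)[OF y] V_e(2)[OF z] V_perp(1)[OF x y] V_perp(2)[OF x z] V_perp(3)[OF y
      z] by simp_all
  then have perp': "y \<bullet> x = 0" "z \<bullet> x = 0" "z \<bullet> y = 0" by (simp_all add: inner_commute)
  let ?u = "x + y + z"
  have A: "F e e ?u = 0" by (simp add: F_ee inner_add_right perp)
  have B: "F e ?u ?u = - 6 * (x \<bullet> x) - 3 * (y \<bullet> y) + 3 * (z \<bullet> z)"
    using perp perp' by (simp add: F_expand eig_F[OF x] eig_F[OF y] eig_F[OF z])
  have C: "F ?u ?u ?u = 6 * F x y z + 3 * F x z z + 3 * F y z z + F y y y"
    using F_selection(1)[OF x x x] F_selection(2)[OF x x y] F_selection(3)[OF x x z]
      F_selection(4)[OF x y y]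
      F_selection(5)[OF y y z] F_selection(6)[OF z z z]
    by (simp add: F_expand F_swap12[of y x] F_swap12[of z x] F_swap12[of z y] F_swap23[of _ z y]
        F_swap23[of _ z x] F_swap23[of _ y x])
  have D: "F (t *\<^sub>R e + u) (t *\<^sub>R e + u) (t *\<^sub>R e + u)
      = 6 * t^3 + 3 * t^2 * F e e u + 3 * t * F e u u + F u u u" for u
  proof -
    have "F e e e = 6" by (simp add: F_ee inner_e)
    then show ?thesis
      by (simp add: F_expand F_swap12[of u e] F_swap23[of e u e] F_swap23[of u u e] algebra_simps
        power_numeral_reduce)
  qed
  have E: "t *\<^sub>R e + x + y + z = t *\<^sub>R e + ?u" by simp
  show ?thesis unfolding E D A B C by (simp add: algebra_simps)
qed

lemma subspace_eig: "subspace {x. eig k x}"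
  by (auto simp: subspace_def eig_add eig_scale) (simp add: eig_def)

end

lemma normal_form_exists:
  fixes f :: "real^'n \<Rightarrow> real"
  assumes "harmonic_hsiang m e" and c: "c \<noteq> 0" and f: "\<And>x. m x x \<bullet> x = 6 * (c * f x)"
  shows "normal_form f c e {x. hsiang_idempotent.eig m e (- 6) x} {x. hsiang_idempotent.eig m e (- 3) x}
    {x. hsiang_idempotent.eig m e 3 x}
    (\<lambda>(\<xi>, \<eta>, \<zeta>). metrised_algebra.F m \<xi> \<eta> \<zeta>) (\<lambda>(\<xi>, \<eta>, \<zeta>). metrised_algebra.F m \<xi> \<zeta> \<zeta> / 2)
    (\<lambda>(\<xi>, \<eta>, \<zeta>). metrised_algebra.F m \<eta> \<zeta> \<zeta> / 2) (\<lambda>(\<xi>, \<eta>, \<zeta>). metrised_algebra.F m \<eta> \<eta> \<eta> / 6)"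
proof -
  interpret harmonic_hsiang m e by fact
  have b: "bounded_linear (\<lambda>x :: (real^'n) \<times> (real^'n) \<times> (real^'n). fst x)"
    "bounded_linear (\<lambda>x :: (real^'n) \<times> (real^'n) \<times> (real^'n). fst (snd x))"
    "bounded_linear (\<lambda>x :: (real^'n) \<times> (real^'n) \<times> (real^'n). snd (snd x))"
    by (intro bounded_linear_intros)+
  have Ff: "F x x x = 6 * (c * f x)" for x using f by (simp add: F_def)
  show ?thesis
    unfolding normal_form_def
  proof (intro conjI allI ballI)
    show "c \<noteq> 0" by (rule c)
    show "orthogonal_decomposition e {x. V1 x} {x. V2 x} {x. V3 x}"
      unfolding orthogonal_decomposition_def
    proof (intro conjI allI)
      show "norm e = 1" by (rule norm_e)
      show "subspace {x. V1 x}" "subspace {x. V2 x}" "subspace {x. V3 x}" by (rule subspace_eig)+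
      have "orthogonal_subspaces (span {e}) {x. eig k x}" for k
        unfolding orthogonal_subspaces_def orthogonal_def by (auto simp: span_singleton V_e(2))
      then show "orthogonal_subspaces (span {e}) {x. V1 x}" "orthogonal_subspaces (span {e}) {x. V2 x}"
        "orthogonal_subspaces (span {e}) {x. V3 x}" by blast+
      show "orthogonal_subspaces {x. V1 x} {x. V2 x}" "orthogonal_subspaces {x. V1 x} {x. V3 x}"
        "orthogonal_subspaces {x. V2 x} {x. V3 x}"
        using V_perp by (auto simp: orthogonal_subspaces_def orthogonal_def)
      fix x
      have "(x - (x \<bullet> e) *\<^sub>R e) \<bullet> e = 0" by (simp add: inner_diff_left inner_e)
      then obtain x1 x2 x3 where "V1 x1" "V2 x2" "V3 x3" "x - (x \<bullet> e) *\<^sub>R e = x1 + x2 + x3"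
          using V_decomp by blast
      moreover from this have "x = (x \<bullet> e) *\<^sub>R e + x1 + x2 + x3" by (simp add: algebra_simps)
      ultimately show "\<exists>t. \<exists>\<xi>\<in>{x. V1 x}. \<exists>\<eta>\<in>{x. V2 x}. \<exists>\<zeta>\<in>{x. V3 x}. x = t *\<^sub>R e + \<xi> + \<eta> + \<zeta>"
        by (intro exI[of _ "x \<bullet> e"] bexI[of _ x1] bexI[of _ x2] bexI[of _ x3]) simp_all
    qed
    show "trihomogeneous_polynomial {x. V1 x} {x. V2 x} {x. V3 x} 1 1 1 (\<lambda>(\<xi>, \<eta>, \<zeta>). F \<xi> \<eta> \<zeta>)"
      using real_polynomial_function_F[OF b]
      by (simp add: trihomogeneous_polynomial_def case_prod_unfold F_expand)
    show "trihomogeneous_polynomial {x. V1 x} {x. V2 x} {x. V3 x} 1 0 2 (\<lambda>(\<xi>, \<eta>, \<zeta>). F \<xi> \<zeta> \<zeta> / 2)"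
      using real_polynomial_function_divide[OF real_polynomial_function_F[OF b(1,3,3)]]
      by (simp add: trihomogeneous_polynomial_def case_prod_unfold F_expand power2_eq_square)
    show "trihomogeneous_polynomial {x. V1 x} {x. V2 x} {x. V3 x} 0 1 2 (\<lambda>(\<xi>, \<eta>, \<zeta>). F \<eta> \<zeta> \<zeta> / 2)"
      using real_polynomial_function_divide[OF real_polynomial_function_F[OF b(2,3,3)]]
      by (simp add: trihomogeneous_polynomial_def case_prod_unfold F_expand power2_eq_square)
    show "trihomogeneous_polynomial {x. V1 x} {x. V2 x} {x. V3 x} 0 3 0 (\<lambda>(\<xi>, \<eta>, \<zeta>). F \<eta> \<eta> \<eta> / 6)"
      using real_polynomial_function_divide[OF real_polynomial_function_F[OF b(2,2,2)]]
      by (simp add: trihomogeneous_polynomial_def case_prod_unfold F_expand power3_eq_cube)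
    fix t \<xi> \<eta> \<zeta> assume "\<xi> \<in> {x. V1 x}" "\<eta> \<in> {x. V2 x}" "\<zeta> \<in> {x. V3 x}"
    then have V: "V1 \<xi>" "V2 \<eta>" "V3 \<zeta>" by auto
    show "c * f (t *\<^sub>R e + \<xi> + \<eta> + \<zeta>) =
        t ^ 3 - 3 / 2 * t * (2 * (norm \<xi>)\<^sup>2 + (norm \<eta>)\<^sup>2 - (norm \<zeta>)\<^sup>2)
        + (case (\<xi>, \<eta>, \<zeta>) of (\<xi>, \<eta>, \<zeta>) \<Rightarrow> F \<xi> \<eta> \<zeta>) + (case (\<xi>, \<eta>, \<zeta>) of (\<xi>, \<eta>, \<zeta>) \<Rightarrow> F \<xi> \<zeta> \<zeta> / 2)
        + (case (\<xi>, \<eta>, \<zeta>) of (\<xi>, \<eta>, \<zeta>) \<Rightarrow> F \<eta> \<zeta> \<zeta> / 2) + (case (\<xi>, \<eta>, \<zeta>) of (\<xi>, \<eta>, \<zeta>) \<Rightarrow> F \<eta> \<eta> \<eta> / 6)"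
      using F_expand_V[OF V, of t] Ff[of "t *\<^sub>R e + \<xi> + \<eta> + \<zeta>"]
      by (simp add: power2_norm_eq_inner field_simps)
  qed
qed

text \<open>The hypothesis is applied to the normal form of \<open>normal_form_exists\<close>. A
  linear factor of its \<psi>030 gives the hyperplane of \<open>V2\<close> required by
  \<open>clifford_split_if_hyperplane\<close>.\<close>

lemma clifford_type_if_normal_forms_reducible:
  fixes f :: "real^'n \<Rightarrow> real"
  assumes f: "radial_eigencubic f"
    and red: "\<And>c e V1 V2 V3 \<psi>111 \<psi>102 \<psi>012 \<psi>030. normal_form f c e V1 V2 V3 \<psi>111 \<psi>102 \<psi>012 \<psi>030 \<Longrightarrow>
      (\<exists>\<eta>\<in>V2. \<psi>030 (0, \<eta>, 0) \<noteq> 0) \<and> reducible_on V2 (\<lambda>\<eta>. \<psi>030 (0, \<eta>, 0))"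
  shows "clifford_type f"
proof -
  obtain c m e where c: "c \<noteq> 0" and h: "harmonic_hsiang m e" and mf: "\<And>x. m x x \<bullet> x = 6 * (c * f x)"
    using radial_eigencubic_normalised[OF f] by blast
  interpret harmonic_hsiang m e by (rule h)
  have "(\<exists>\<eta>\<in>{x. V2 x}. F \<eta> \<eta> \<eta> / 6 \<noteq> 0) \<and> reducible_on {x. V2 x} (\<lambda>\<eta>. F \<eta> \<eta> \<eta> / 6)"
    using red[OF normal_form_exists[OF h c mf]] by simp
  moreover have "F (t *\<^sub>R x) (t *\<^sub>R x) (t *\<^sub>R x) / 6 = t^3 * (F x x x / 6)" for x t
    by (simp add: F_expand power3_eq_cube)
  ultimately obtain a where a: "a \<in> {x. V2 x}" "norm a = 1"
      "\<And>y. y \<in> {x. V2 x} \<Longrightarrow> a \<bullet> y = 0 \<Longrightarrow> F y y y / 6 = 0"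
    using reducible_cubic_vanishes_on_hyperplane[OF subspace_eig[of "- 3"], of "\<lambda>\<eta>. F \<eta> \<eta> \<eta> / 6"]
      by blast
  have "V2 a" "\<And>y. V2 y \<Longrightarrow> a \<bullet> y = 0 \<Longrightarrow> F y y y = 0" using a by auto
  from clifford_split_if_hyperplane[OF this(1) a(2) this(2)] obtain Z Y
      where "clifford_split Z Y 27" "Z \<noteq> {0}" by blast
  moreover have "\<exists>x. f x \<noteq> 0" using f by (simp add: radial_eigencubic_def)
  ultimately show ?thesis
    using clifford_type_if_split[OF metrised_algebra_axioms _ _ tr_zero c mf] by blast
qed

theorem theorem3:
  fixes f :: "real^'n \<Rightarrow> real"
  assumes "radial_eigencubic f"
  shows "clifford_type f \<longleftrightarrow>
    (\<forall>c e V1 V2 V3 \<psi>111 \<psi>102 \<psi>012 \<psi>030.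
       normal_form f c e V1 V2 V3 \<psi>111 \<psi>102 \<psi>012 \<psi>030 \<longrightarrow>
         (\<exists>\<eta>\<in>V2. \<psi>030 (0, \<eta>, 0) \<noteq> 0) \<and> reducible_on V2 (\<lambda>\<eta>. \<psi>030 (0, \<eta>, 0)))"
  using normal_form_reducible_if_clifford_type clifford_type_if_normal_forms_reducible[OF assms] by blast

end
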